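(* Let $u$ be an almost minimizer for $J$ or for $J^+$ in $\Omega$ (with constant $\kappa$ and exponent $\alpha$), and set $\beta=\frac{\alpha}{n+2+\alpha}$. Then $u$ is $C^{1,\beta}$ locally in the open sets $\{x\in\Omega: u(x)>0\}$ and $\{x\in\Omega:u(x)<0\}$.
   Context: Let $n\ge 2$, let $\Omega\subset\mathbb{R}^n$ be a domain (open set), let $q_+,q_-\in L^\infty(\Omega)$ be bounded real-valued functions, and let $\kappa\in(0,\infty)$, $\alpha\in(0,1]$. Set $K_{\mathrm{loc}}(\Omega)=\{u\in L^1_{\mathrm{loc}}(\Omega): \nabla u\in L^2(B(x,r))$ for every open ball $B(x,r)\subset\Omega\}$ and $K^+_{\mathrm{loc}}(\Omega)=\{u\in K_{\mathrm{loc}}(\Omega): u\ge 0$ a.e. on $\Omega\}$. Let $$J_{x,r}(v)=\int_{B(x,r)}|\nabla v|^2+q_+^2\,\chi_{\{v>0\}}+q_-^2\,\chi_{\{v<0\}},\qquad J^+_{x,r}(v)=\int_{B(x,r)}|\nabla v|^2+q_+^2\,\chi_{\{v>0\}}.$$ $u$ is an almost minimizer for $J$ in $\Omega$ (with constant $\kappa$ and exponent $\alpha$) if $u\in K_{\mathrm{loc}}(\Omega)$ and $J_{x,r}(u)\le(1+\kappa r^\alpha)J_{x,r}(v)$ for every ball $B(x,r)\subset\Omega$ and every $v\in L^1(B(x,r))$ with $\nabla v\in L^2(B(x,r))$ and $v=u$ on $\partial B(x,r)$ (equality of traces). $u$ is an almost minimizer for $J^+$ in $\Omega$ if $u\in K^+_{\mathrm{loc}}(\Omega)$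 and $J^+_{x,r}(u)\le(1+\kappa r^\alpha)J^+_{x,r}(v)$ for every ball with $\overline B(x,r)\subset\Omega$ and every such $v$. Almost minimizers agree a.e. with a continuous function and are identified with it. *)

theory Defs
  imports "HOL-Analysis.Analysis"
begin

section \<open>Test functions and weak gradients\<close>

primrec Ck :: "nat \<Rightarrow> ('a::euclidean_space \<Rightarrow> real) \<Rightarrow> bool" where
  "Ck 0 f \<longleftrightarrow> continuous_on UNIV f"
| "Ck (Suc k) f \<longleftrightarrow> f differentiable_on UNIV \<and>
     (\<forall>b\<in>Basis. Ck k (\<lambda>x. frechet_derivative f (at x) b))"

definition smooth :: "('a::euclidean_space \<Rightarrow> real) \<Rightarrow> bool" where
  "smooth f \<longleftrightarrow> (\<forall>k. Ck k f)"

definition test_function_on :: "'a::euclidean_space set \<Rightarrow> ('a \<Rightarrow> real) \<Rightarrow> bool" where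
  "test_function_on U \<phi> \<longleftrightarrow>
     smooth \<phi> \<and> compact (closure {x. \<phi> x \<noteq> 0}) \<and> closure {x. \<phi> x \<noteq> 0} \<subseteq> U"

definition grad :: "('a::euclidean_space \<Rightarrow> real) \<Rightarrow> 'a \<Rightarrow> 'a" where
  "grad f x = (\<Sum>b\<in>Basis. frechet_derivative f (at x) b *\<^sub>R b)"

definition L1_loc :: "'a::euclidean_space set \<Rightarrow> ('a \<Rightarrow> 'b::euclidean_space) \<Rightarrow> bool" where
  "L1_loc U f \<longleftrightarrow> (\<forall>K. compact K \<and> K \<subseteq> U \<longrightarrow> set_integrable lebesgue K f)"

definition L1_on :: "'a::euclidean_space set \<Rightarrow> ('a \<Rightarrow> 'b::euclidean_space) \<Rightarrow> bool" where
  "L1_on S f \<longleftrightarrow> set_integrable lebesgue S f"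

definition L2_on :: "'a::euclidean_space set \<Rightarrow> ('a \<Rightarrow> 'b::euclidean_space) \<Rightarrow> bool" where
  "L2_on S f \<longleftrightarrow>
     set_borel_measurable lebesgue S f \<and> set_integrable lebesgue S (\<lambda>x. (norm (f x))\<^sup>2)"

definition Linfty_on :: "'a::euclidean_space set \<Rightarrow> ('a \<Rightarrow> real) \<Rightarrow> bool" where
  "Linfty_on S f \<longleftrightarrow>
     set_borel_measurable lebesgue S f \<and> (\<exists>M. AE x in lebesgue. x \<in> S \<longrightarrow> \<bar>f x\<bar> \<le> M)"

text \<open>The distributional gradient is unique only up to null sets, so it is rendered as a
  relation: \<open>g\<close> is a version of \<open>\<nabla>u\<close> on the open set \<open>U\<close>.\<close>

definition has_weak_gradient_on ::
    "'a::euclidean_space set \<Rightarrow> ('a \<Rightarrow> real) \<Rightarrow> ('a \<Rightarrow> 'a) \<Rightarrow> bool" where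
  "has_weak_gradient_on U u g \<longleftrightarrow> L1_loc U u \<and> L1_loc U g \<and>
     (\<forall>\<phi>. test_function_on U \<phi> \<longrightarrow>
        (LINT x:U|lebesgue. u x *\<^sub>R grad \<phi> x) = - (LINT x:U|lebesgue. \<phi> x *\<^sub>R g x))"

definition K_loc :: "'a::euclidean_space set \<Rightarrow> ('a \<Rightarrow> real) set" where
  "K_loc \<Omega> = {u. L1_loc \<Omega> u \<and>
     (\<exists>Du. has_weak_gradient_on \<Omega> u Du \<and> (\<forall>x r. ball x r \<subseteq> \<Omega> \<longrightarrow> L2_on (ball x r) Du))}"

definition K_loc_plus :: "'a::euclidean_space set \<Rightarrow> ('a \<Rightarrow> real) set" where
  "K_loc_plus \<Omega> = {u \<in> K_loc \<Omega>. AE x in lebesgue. x \<in> \<Omega> \<longrightarrow> 0 \<le> u x}"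


section \<open>Traces on spheres\<close>

text \<open>Surface measure of the sphere of radius \<open>r\<close> about \<open>x\<close>, as the normalised cone measure:
  a Borel part \<open>A\<close> of the sphere has area \<open>n / r\<close> times the volume of the cone over \<open>A\<close>
  with apex \<open>x\<close>.\<close>

definition sphere_measure :: "'a::euclidean_space \<Rightarrow> real \<Rightarrow> 'a measure" where
  "sphere_measure x r =
     scale_measure (ennreal (real DIM('a) / r))
       (distr (restrict_space lborel (ball x r - {x})) borel
          (\<lambda>y. x + (r / norm (y - x)) *\<^sub>R (y - x)))"

text \<open>The trace operator on \<open>W\<^sup>1\<^sup>,\<^sup>1\<close> of the ball is the continuous extension, into \<open>L\<^sup>1\<close> of
  the sphere, of the restriction of functions that are smooth up to the boundary.\<close>

definition has_trace :: "'a::euclidean_space \<Rightarrow> real \<Rightarrow> ('a \<Rightarrow> real) \<Rightarrow> ('a \<Rightarrow> real) \<Rightarrow> bool" where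
  "has_trace x r v t \<longleftrightarrow> integrable (sphere_measure x r) t \<and> L1_on (ball x r) v \<and>
     (\<exists>Dv \<phi>. has_weak_gradient_on (ball x r) v Dv \<and> L1_on (ball x r) Dv \<and>
        (\<forall>k. smooth (\<phi> k)) \<and>
        (\<lambda>k::nat. LINT y:ball x r|lebesgue. \<bar>\<phi> k y - v y\<bar>) \<longlonglongrightarrow> 0 \<and>
        (\<lambda>k. LINT y:ball x r|lebesgue. norm (grad (\<phi> k) y - Dv y)) \<longlonglongrightarrow> 0 \<and>
        (\<lambda>k. LINT y|sphere_measure x r. \<bar>\<phi> k y - t y\<bar>) \<longlonglongrightarrow> 0)"

definition same_trace :: "'a::euclidean_space \<Rightarrow> real \<Rightarrow> ('a \<Rightarrow> real) \<Rightarrow> ('a \<Rightarrow> real) \<Rightarrow> bool" where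
  "same_trace x r v w \<longleftrightarrow> (\<exists>t. has_trace x r v t \<and> has_trace x r w t)"


section \<open>Almost minimizers\<close>

text \<open>In the functionals the last argument is the gradient of the function before it.\<close>

definition J :: "('a::euclidean_space \<Rightarrow> real) \<Rightarrow> ('a \<Rightarrow> real) \<Rightarrow> 'a \<Rightarrow> real \<Rightarrow>
    ('a \<Rightarrow> real) \<Rightarrow> ('a \<Rightarrow> 'a) \<Rightarrow> real" where
  "J qp qm x r v Dv =
     (LINT y:ball x r|lebesgue. (norm (Dv y))\<^sup>2
        + (qp y)\<^sup>2 * indicator {y. v y > 0} y + (qm y)\<^sup>2 * indicator {y. v y < 0} y)"

definition J_plus :: "('a::euclidean_space \<Rightarrow> real) \<Rightarrow> 'a \<Rightarrow> real \<Rightarrow>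
    ('a \<Rightarrow> real) \<Rightarrow> ('a \<Rightarrow> 'a) \<Rightarrow> real" where
  "J_plus qp x r v Dv =
     (LINT y:ball x r|lebesgue. (norm (Dv y))\<^sup>2 + (qp y)\<^sup>2 * indicator {y. v y > 0} y)"

definition competitor :: "'a::euclidean_space \<Rightarrow> real \<Rightarrow> ('a \<Rightarrow> real) \<Rightarrow> ('a \<Rightarrow> real) \<Rightarrow> ('a \<Rightarrow> 'a) \<Rightarrow> bool" where
  "competitor x r u v Dv \<longleftrightarrow> L1_on (ball x r) v \<and>
     has_weak_gradient_on (ball x r) v Dv \<and> L2_on (ball x r) Dv \<and> same_trace x r v u"

definition almost_minimizer :: "('a::euclidean_space \<Rightarrow> real) \<Rightarrow> ('a \<Rightarrow> real) \<Rightarrow>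
    real \<Rightarrow> real \<Rightarrow> 'a set \<Rightarrow> ('a \<Rightarrow> real) \<Rightarrow> bool" where
  "almost_minimizer qp qm \<kappa> \<alpha> \<Omega> u \<longleftrightarrow> u \<in> K_loc \<Omega> \<and>
     (\<forall>x r Du v Dv. 0 < r \<and> ball x r \<subseteq> \<Omega> \<and> has_weak_gradient_on (ball x r) u Du \<and>
        competitor x r u v Dv \<longrightarrow>
        J qp qm x r u Du \<le> (1 + \<kappa> * r powr \<alpha>) * J qp qm x r v Dv)"

definition almost_minimizer_plus :: "('a::euclidean_space \<Rightarrow> real) \<Rightarrow>
    real \<Rightarrow> real \<Rightarrow> 'a set \<Rightarrow> ('a \<Rightarrow> real) \<Rightarrow> bool" where
  "almost_minimizer_plus qp \<kappa> \<alpha> \<Omega> u \<longleftrightarrow> u \<in> K_loc_plus \<Omega> \<and>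
     (\<forall>x r Du v Dv. 0 < r \<and> cball x r \<subseteq> \<Omega> \<and> has_weak_gradient_on (ball x r) u Du \<and>
        competitor x r u v Dv \<longrightarrow>
        J_plus qp x r u Du \<le> (1 + \<kappa> * r powr \<alpha>) * J_plus qp x r v Dv)"


section \<open>Local Hoelder regularity of the gradient\<close>

definition locally_C1_holder :: "real \<Rightarrow> 'a::euclidean_space set \<Rightarrow> ('a \<Rightarrow> real) \<Rightarrow> bool" where
  "locally_C1_holder \<beta> U f \<longleftrightarrow>
     (\<exists>G. (\<forall>x\<in>U. GDERIV f x :> G x) \<and>
        (\<forall>K. compact K \<and> K \<subseteq> U \<longrightarrow>
           (\<exists>C. \<forall>x\<in>K. \<forall>y\<in>K. norm (G x - G y) \<le> C * dist x y powr \<beta>)))"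

end

(*
No harmonic replacement is needed.  Inside {u > 0} or {u < 0} a competitor of the same sign pays the
same volume term, so u almost minimises the Dirichlet energy.  The competitor (1 - h) u + h u(x), with
h a bump around x, turns Hoelder continuity of u with exponent g < 1 into the growth
C r^(n - 2 + 2 g) of the energy on balls B(x,r) (hole filling).  The competitors u +- t f((y - x)/s)
then bound the integrals of u against rescaled Laplacians of test functions f by
C s^(n + g + alpha/2).

For a radial f with gradient z k(z), d/ds of the mollification of u by k at scale s is such an
integral, and the same holds after differentiating both in space.  Hence the decay exponent
m = g + alpha/2 is a Hoelder exponent of u if m < 1, and if 1 < m < 2 the gradients of the mollified
functions converge to a gradient of u that is Hoelder of exponent m - 1.  Starting from g = 0 one
reaches g = 1 - alpha/4, which gives a gradient of class C^(alpha/4); and beta <= alpha/4 as n >= 2.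
*)
theory Submission
  imports Defs
begin

section \<open>Calculus of smooth functions\<close>

text \<open>All estimates live in a closed box inside one phase, where \<open>\<bar>u\<bar>\<close>
  has a positive minimum; this minimum limits how large a perturbation may be without a change of
  sign. Traces are harmless because a competitor differs from \<open>u\<close> only by compactly
  supported modifications: a smooth approximation of \<open>u\<close>, modified in the same way,
  approximates the competitor and keeps the boundary values. The gain alpha/2 is a balance. A
  perturbation of amplitude T at scale s turns almost minimality into: T times the weak Laplacian is
  at most a constant times s^alpha E + T^2 s^(n-2), where the energy is E = s^(n-2+2g) up to a
  constant. The amplitude T = s^(g+alpha/2) makes both terms equal, and division by T gives the
  decay. Exponents come from integrating r^(m-k-1) in the scale r, with k the number of derivatives
  taken. For m = k this would be a logarithm, so m must avoid the integers 1 and 2. Hence the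
  iteration is capped at 1 - alpha/4: its last step jumps over 1 and lands at 1 + alpha/4.\<close>

definition pd :: "'a::euclidean_space \<Rightarrow> ('a \<Rightarrow> real) \<Rightarrow> 'a \<Rightarrow> real" where
  "pd b f x = frechet_derivative f (at x) b"

lemma Ck_Suc_pd: "Ck (Suc k) f \<longleftrightarrow> f differentiable_on UNIV \<and> (\<forall>b\<in>Basis. Ck k (pd b f))"
  by (simp add: pd_def[abs_def])

declare Ck.simps(2)[simp del]

text \<open>Serves families that are closed under partial derivatives, such as affine substitutions
  and kernel integrals, without handling each \<open>Ck k\<close> separately. Sums and products are
  treated by induction on \<open>k\<close> instead, since the Leibniz rule leads out of a family of
  single products.\<close>

lemma smooth_coinduct:
  assumes "P f"
    and step: "\<And>f. P f \<Longrightarrow> f differentiable_on UNIV \<and> (\<forall>b\<in>Basis. P (pd b f))"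
  shows "smooth f"
proof -
  have "\<forall>f. P f \<longrightarrow> Ck k f" for k
  proof (induction k)
    case 0
    then show ?case using step differentiable_imp_continuous_on by auto
  next
    case (Suc k)
    then show ?case using step by (auto simp: Ck_Suc_pd)
  qed
  then show ?thesis using assms(1) by (auto simp: smooth_def)
qed

lemma Ck_pred: "Ck (Suc k) f \<Longrightarrow> Ck k f"
proof (induction k arbitrary: f)
  case 0
  then show ?case by (auto simp: Ck_Suc_pd differentiable_imp_continuous_on)
next
  case (Suc k)
  then show ?case using Ck_Suc_pd by blast
qed

lemma smooth_Ck: "smooth f \<Longrightarrow> Ck k f"
  by (simp only: smooth_def)

lemma smooth_differentiable_on: "smooth f \<Longrightarrow> f differentiable_on UNIV"
  by (drule smooth_Ck[of f "Suc 0"]) (simp only: Ck_Suc_pd)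

lemma smooth_differentiable: "smooth f \<Longrightarrow> f differentiable at x"
  by (drule smooth_differentiable_on) (simp add: differentiable_on_def)

lemma smooth_pd:
  assumes "smooth f" "b \<in> Basis"
  shows "smooth (pd b f)"
  unfolding smooth_def
proof
  fix k
  show "Ck k (pd b f)"
    using smooth_Ck[OF assms(1), of "Suc k"] assms(2) by (simp only: Ck_Suc_pd)
qed

lemma smooth_continuous: "smooth f \<Longrightarrow> continuous_on S f"
  using differentiable_imp_continuous_on smooth_differentiable_on
  by (meson continuous_on_subset subset_UNIV)

lemma smooth_continuous':
  "smooth f \<Longrightarrow> continuous_on S g \<Longrightarrow> continuous_on S (\<lambda>x. f (g x))"
  by (rule continuous_on_compose2[of UNIV]) (auto intro: smooth_continuous)

lemma frechet_eq_inner_grad: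
  assumes "f differentiable at x"
  shows "frechet_derivative f (at x) h = grad f x \<bullet> h"
proof -
  interpret linear "frechet_derivative f (at x)"
    using assms linear_frechet_derivative by blast
  have "frechet_derivative f (at x) h = frechet_derivative f (at x) (\<Sum>b\<in>Basis. (h \<bullet> b) *\<^sub>R b)"
    by (simp add: euclidean_representation)
  also have "\<dots> = (\<Sum>b\<in>Basis. (h \<bullet> b) * frechet_derivative f (at x) b)"
    by (simp add: sum scale)
  finally show ?thesis
    unfolding grad_def inner_sum_left inner_scaleR_left by (simp add: inner_commute mult.commute)
qed

lemma grad_pd: "grad f x = (\<Sum>b\<in>Basis. pd b f x *\<^sub>R b)"
  by (simp add: grad_def pd_def)

lemma grad_inner_Basis: "b \<in> Basis \<Longrightarrow> grad f x \<bullet> b = pd b f x"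
  by (simp add: grad_def pd_def)

lemma has_derivative_grad:
  assumes "f differentiable at x"
  shows "(f has_derivative (\<lambda>h. grad f x \<bullet> h)) (at x)"
  using assms frechet_eq_inner_grad[OF assms] frechet_derivative_works
  by (metis (no_types, lifting) ext)

lemma grad_unique:
  assumes "(f has_derivative (\<lambda>h. g \<bullet> h)) (at x)"
  shows "grad f x = g"
proof -
  have "frechet_derivative f (at x) = (\<lambda>h. g \<bullet> h)"
    using frechet_derivative_at assms by metis
  then show ?thesis by (simp add: grad_def euclidean_representation)
qed

lemma pd_unique:
  assumes "(f has_derivative f') (at x)"
  shows "pd b f x = f' b"
  using frechet_derivative_at[OF assms] by (simp add: pd_def)

lemma smooth_has_derivative:
  "smooth f \<Longrightarrow> (f has_derivative (\<lambda>h. grad f x \<bullet> h)) (at x)"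
  using has_derivative_grad smooth_differentiable by blast

lemma smooth_has_derivative':
  assumes "smooth f" "(g has_derivative g') (at x within S)"
  shows "((\<lambda>x. f (g x)) has_derivative (\<lambda>h. grad f (g x) \<bullet> g' h)) (at x within S)"
  using has_derivative_compose[OF assms(2) smooth_has_derivative[OF assms(1)]] .

lemma smooth_const [simp]: "smooth (\<lambda>x. c)"
  by (rule smooth_coinduct[where P="\<lambda>f. \<exists>c. f = (\<lambda>x. c)"]) (auto simp: pd_def[abs_def])

lemma pd_add:
  assumes "f differentiable at x" "g differentiable at x"
  shows "pd b (\<lambda>x. f x + g x) x = pd b f x + pd b g x"
proof -
  have "((\<lambda>x. f x + g x) has_derivative
     (\<lambda>h. frechet_derivative f (at x) h + frechet_derivative g (at x) h)) (at x)"
    by (intro has_derivative_add) (use assms frechet_derivative_works in blast)+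
  from pd_unique[OF this] show ?thesis by (simp add: pd_def)
qed

lemma pd_mult:
  assumes "f differentiable at x" "g differentiable at x"
  shows "pd b (\<lambda>x. f x * g x) x = f x * pd b g x + pd b f x * g x"
proof -
  have "((\<lambda>x. f x * g x) has_derivative
     (\<lambda>h. f x * frechet_derivative g (at x) h + frechet_derivative f (at x) h * g x)) (at x)"
    by (intro has_derivative_mult) (use assms frechet_derivative_works in blast)+
  from pd_unique[OF this] show ?thesis by (simp add: pd_def)
qed

lemma Ck_differentiable: "Ck (Suc k) f \<Longrightarrow> f differentiable at x"
  using Ck_Suc_pd differentiable_on_def by (metis UNIV_I)

lemma Ck_add: "Ck k f \<Longrightarrow> Ck k g \<Longrightarrow> Ck k (\<lambda>x. f x + g x)"
proof (induction k arbitrary: f g)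
  case 0
  then show ?case by (auto intro!: continuous_intros)
next
  case (Suc k)
  have "pd b (\<lambda>x. f x + g x) = (\<lambda>x. pd b f x + pd b g x)" for b
    using Suc.prems Ck_differentiable pd_add by blast
  then show ?case using Suc by (simp add: Ck_Suc_pd differentiable_on_add)
qed

lemma Ck_mult: "Ck k f \<Longrightarrow> Ck k g \<Longrightarrow> Ck k (\<lambda>x. f x * g x)"
proof (induction k arbitrary: f g)
  case 0
  then show ?case by (auto intro!: continuous_intros)
next
  case (Suc k)
  have "pd b (\<lambda>x. f x * g x) = (\<lambda>x. f x * pd b g x + pd b f x * g x)" for b
    using Suc.prems Ck_differentiable pd_mult by blast
  moreover have "Ck k (\<lambda>x. f x * pd b g x + pd b f x * g x)" if "b \<in> Basis" for b
    by (intro Ck_add Suc.IH) (use that Suc.prems Ck_pred Ck_Suc_pd in blast)+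
  ultimately show ?case using Suc.prems by (simp add: Ck_Suc_pd differentiable_on_mult)
qed

lemma smooth_add: "smooth f \<Longrightarrow> smooth g \<Longrightarrow> smooth (\<lambda>x. f x + g x)"
  by (simp add: smooth_def Ck_add)

lemma smooth_mult: "smooth f \<Longrightarrow> smooth g \<Longrightarrow> smooth (\<lambda>x. f x * g x)"
  by (simp add: smooth_def Ck_mult)

lemma smooth_diff: "smooth f \<Longrightarrow> smooth g \<Longrightarrow> smooth (\<lambda>x. f x - g x)"
  using smooth_add[OF _ smooth_mult[OF smooth_const[of "-1"]]] by force

lemma smooth_sum: "(\<And>i. i \<in> I \<Longrightarrow> smooth (f i)) \<Longrightarrow> smooth (\<lambda>x. \<Sum>i\<in>I. f i x)"
  by (induction I rule: infinite_finite_induct) (auto intro: smooth_add)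

lemma smooth_inner [simp]: "smooth (\<lambda>x. x \<bullet> a)"
proof -
  have 1: "((\<lambda>x. x \<bullet> a) has_derivative (\<lambda>h. h \<bullet> a)) (at x)" for x :: 'a
    by (auto intro!: derivative_eq_intros)
  then have 2: "pd b (\<lambda>x. x \<bullet> a) = (\<lambda>x. b \<bullet> a)" for b :: 'a
    using pd_unique by blast
  have "Ck k (\<lambda>x. x \<bullet> a)" for k
  proof (cases k)
    case 0 then show ?thesis by (auto intro!: continuous_intros)
  next
    case (Suc m)
    have "Ck m (\<lambda>x::'a. b \<bullet> a)" for b using smooth_const smooth_def by blast
    then show ?thesis unfolding Suc Ck_Suc_pd 2
      using 1 by (auto simp: differentiable_on_def differentiable_def)
  qed
  then show ?thesis by (simp add: smooth_def)
qed

lemma smooth_norm_power2 [simp]: "smooth (\<lambda>x::'a::euclidean_space. (norm x)\<^sup>2)"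
proof -
  have "smooth (\<lambda>x::'a. \<Sum>b\<in>Basis. (x \<bullet> b) * (x \<bullet> b))"
    by (intro smooth_sum smooth_mult smooth_inner)
  moreover have "(norm x)\<^sup>2 = (\<Sum>b\<in>Basis. (x \<bullet> b) * (x \<bullet> b))" for x :: 'a
    unfolding power2_norm_eq_inner by (rule euclidean_inner)
  ultimately show ?thesis by simp
qed

lemma grad_add:
  "f differentiable at x \<Longrightarrow> g differentiable at x \<Longrightarrow> grad (\<lambda>x. f x + g x) x = grad f x + grad g x"
  by (rule grad_unique) (auto intro!: derivative_eq_intros has_derivative_grad simp: inner_add_left)

lemma grad_mult:
  "f differentiable at x \<Longrightarrow> g differentiable at x \<Longrightarrow>
    grad (\<lambda>x. f x * g x) x = f x *\<^sub>R grad g x + g x *\<^sub>R grad f x"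
  by (rule grad_unique)
    (auto intro!: derivative_eq_intros has_derivative_grad simp: inner_add_left mult.commute)

lemma has_derivative_affine:
  assumes "f differentiable at (c *\<^sub>R (y - a))"
  shows "((\<lambda>y. f (c *\<^sub>R (y - a))) has_derivative (\<lambda>h. (c *\<^sub>R grad f (c *\<^sub>R (y - a))) \<bullet> h)) (at y)"
proof -
  have 1: "((\<lambda>y. c *\<^sub>R (y - a)) has_derivative (\<lambda>h. c *\<^sub>R h)) (at y)"
    by (auto intro!: derivative_eq_intros)
  show ?thesis
    using has_derivative_compose[OF 1 has_derivative_grad[OF assms]] by simp
qed

lemma grad_affine:
  "smooth f \<Longrightarrow> grad (\<lambda>y. f (c *\<^sub>R (y - a))) y = c *\<^sub>R grad f (c *\<^sub>R (y - a))"
  by (intro grad_unique has_derivative_affine smooth_differentiable)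

lemma pd_affine:
  "smooth f \<Longrightarrow> b \<in> Basis \<Longrightarrow> pd b (\<lambda>y. f (c *\<^sub>R (y - a))) y = c * pd b f (c *\<^sub>R (y - a))"
  using grad_affine[of f c a y] by (metis grad_inner_Basis inner_scaleR_left)

lemma pd_cmult: "f differentiable at x \<Longrightarrow> pd b (\<lambda>x. c * f x) x = c * pd b f x"
  using pd_mult[of "\<lambda>_. c" x f b] by (simp add: pd_def)

lemma smooth_cmult: "smooth f \<Longrightarrow> smooth (\<lambda>x. c * f x)"
  by (intro smooth_mult) auto

lemma smooth_affine:
  assumes "smooth f"
  shows "smooth (\<lambda>y. f (c *\<^sub>R (y - a)))"
proof (rule smooth_coinduct[where P="\<lambda>g. \<exists>f k. smooth f \<and> g = (\<lambda>y. k * f (c *\<^sub>R (y - a)))"])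
  show "\<exists>fa k. smooth fa \<and> (\<lambda>y. f (c *\<^sub>R (y - a))) = (\<lambda>y. k * fa (c *\<^sub>R (y - a)))"
    using assms by (intro exI[of _ f] exI[of _ 1]) auto
next
  fix g assume "\<exists>f k. smooth f \<and> g = (\<lambda>y. k * f (c *\<^sub>R (y - a)))"
  then obtain f k where f: "smooth f" and g: "g = (\<lambda>y. k * f (c *\<^sub>R (y - a)))" by blast
  have d: "(\<lambda>y. f (c *\<^sub>R (y - a))) differentiable at y" for y
    using has_derivative_affine smooth_differentiable[OF f] differentiable_def by blast
  have "pd b g = (\<lambda>y. (k * c) * pd b f (c *\<^sub>R (y - a)))" if "b \<in> Basis" for b
    unfolding g using that f d by (simp add: fun_eq_iff pd_cmult pd_affine)
  then have "\<forall>b\<in>Basis. \<exists>f k. smooth f \<and> pd b g = (\<lambda>y. k * f (c *\<^sub>R (y - a)))"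
    using smooth_pd[OF f] by blast
  moreover have "g differentiable_on UNIV"
    unfolding g differentiable_on_def using d by auto
  ultimately show "g differentiable_on UNIV \<and> (\<forall>b\<in>Basis. \<exists>f k. smooth f \<and> pd b g = (\<lambda>y. k * f (c *\<^sub>R (y - a))))"
    by blast
qed

text \<open>The family \<open>H\<close> is closed under differentiation and so stands in for
  smoothness of a function of one variable. By the chain rule a derivative of \<open>h (q x)\<close>
  is a derivative of \<open>q\<close> times a composition with another member of \<open>H\<close>,
  so the induction has to run over all of \<open>H\<close> at once.\<close>

lemma smooth_compose_real:
  fixes q :: "'a::euclidean_space \<Rightarrow> real"
  assumes q: "smooth q" and "h \<in> H"
    and H: "\<And>h. h \<in> H \<Longrightarrow> \<exists>h'\<in>H. \<forall>t. (h has_real_derivative h' t) (at t)"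
  shows "smooth (\<lambda>x. h (q x))"
proof -
  have "\<forall>h\<in>H. Ck k (\<lambda>x. h (q x))" for k
  proof (induction k)
    case 0
    show ?case
    proof
      fix h assume "h \<in> H"
      then have "continuous_on UNIV h" using H
        by (meson DERIV_continuous continuous_at_imp_continuous_on)
      then show "Ck 0 (\<lambda>x. h (q x))"
        using smooth_continuous[OF q] by (auto intro: continuous_on_compose2)
    qed
  next
    case (Suc k)
    show ?case
    proof
      fix h assume "h \<in> H"
      then obtain h' where h': "h' \<in> H" "\<And>t. (h has_real_derivative h' t) (at t)"
        using H by blast
      have *: "((\<lambda>x. h (q x)) has_derivative (\<lambda>v. (grad q x \<bullet> v) * h' (q x))) (at x)" for x
        using has_derivative_compose[OF smooth_has_derivative[OF q] h'(2)[unfolded has_field_derivative_def]]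
        by (simp add: mult.commute)
      then have "(\<lambda>x. h (q x)) differentiable_on UNIV"
        unfolding differentiable_on_def differentiable_def by blast
      moreover have "pd b (\<lambda>x. h (q x)) = (\<lambda>x. pd b q x * h' (q x))" if "b \<in> Basis" for b
        using pd_unique[OF *] grad_inner_Basis[OF that] by auto
      moreover have "Ck k (\<lambda>x. pd b q x * h' (q x))" if "b \<in> Basis" for b
        using smooth_pd[OF q that] Suc h'(1) by (intro Ck_mult) (auto simp: smooth_def)
      ultimately show "Ck (Suc k) (\<lambda>x. h (q x))" by (simp add: Ck_Suc_pd)
    qed
  qed
  then show ?thesis using assms(2) by (simp add: smooth_def)
qed

section \<open>Test functions on the unit ball\<close>

lemma smooth_line_derivative:
  assumes "smooth f"
  shows "((\<lambda>s. f (x + s *\<^sub>R a)) has_real_derivative grad f (x + s *\<^sub>R a) \<bullet> a) (at s)"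
proof -
  have "((\<lambda>s. x + s *\<^sub>R a) has_derivative (\<lambda>h. h *\<^sub>R a)) (at s)"
    by (auto intro!: derivative_eq_intros)
  from has_derivative_compose[OF this smooth_has_derivative[OF assms]]
  show ?thesis unfolding has_field_derivative_def
    by (rule has_derivative_eq_rhs) (simp add: fun_eq_iff mult.commute)
qed

text \<open>Two applications of the mean value theorem to a second difference, first along
  \<open>a\<close>, then along \<open>b\<close>. The second difference is symmetric in the two
  directions, which makes this the core of Schwarz's theorem.\<close>

lemma pd_pd_mean_value:
  assumes f: "smooth f" and ab: "a \<in> Basis" "b \<in> Basis" and t: "t > 0"
  obtains p where "dist p x \<le> 2 * t"
    "f (x + t *\<^sub>R a + t *\<^sub>R b) - f (x + t *\<^sub>R a) - f (x + t *\<^sub>R b) + f x = t * t * pd b (pd a f) p"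
proof -
  have d1: "((\<lambda>s. f (x + t *\<^sub>R b + s *\<^sub>R a) - f (x + s *\<^sub>R a)) has_real_derivative
     pd a f (x + t *\<^sub>R b + s *\<^sub>R a) - pd a f (x + s *\<^sub>R a)) (at s)" for s
    using DERIV_diff[OF smooth_line_derivative[OF f, of "x + t *\<^sub>R b" a s] smooth_line_derivative[OF f, of x a s]]
    by (simp add: grad_inner_Basis ab)
  obtain \<xi> where \<xi>: "0 < \<xi>" "\<xi> < t"
    "(f (x + t *\<^sub>R b + t *\<^sub>R a) - f (x + t *\<^sub>R a)) - (f (x + t *\<^sub>R b + 0 *\<^sub>R a) - f (x + 0 *\<^sub>R a))
      = (t - 0) * (pd a f (x + t *\<^sub>R b + \<xi> *\<^sub>R a) - pd a f (x + \<xi> *\<^sub>R a))"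
    using MVT2[OF t d1] by blast
  have d2: "((\<lambda>s. pd a f (x + \<xi> *\<^sub>R a + s *\<^sub>R b)) has_real_derivative
     pd b (pd a f) (x + \<xi> *\<^sub>R a + s *\<^sub>R b)) (at s)" for s
    using smooth_line_derivative[OF smooth_pd[OF f ab(1)], of "x + \<xi> *\<^sub>R a" b s]
    by (simp add: grad_inner_Basis ab)
  obtain \<zeta> where \<zeta>: "0 < \<zeta>" "\<zeta> < t"
    "pd a f (x + \<xi> *\<^sub>R a + t *\<^sub>R b) - pd a f (x + \<xi> *\<^sub>R a + 0 *\<^sub>R b)
      = (t - 0) * pd b (pd a f) (x + \<xi> *\<^sub>R a + \<zeta> *\<^sub>R b)"
    using MVT2[OF t d2] by blast
  have "dist (x + \<xi> *\<^sub>R a + \<zeta> *\<^sub>R b) x = norm (\<xi> *\<^sub>R a + \<zeta> *\<^sub>R b)"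
    by (simp add: dist_norm)
  also have "\<dots> \<le> \<bar>\<xi>\<bar> + \<bar>\<zeta>\<bar>"
    using norm_triangle_ineq[of "\<xi> *\<^sub>R a" "\<zeta> *\<^sub>R b"] ab by simp
  finally have "dist (x + \<xi> *\<^sub>R a + \<zeta> *\<^sub>R b) x \<le> 2 * t" using \<xi> \<zeta> by simp
  moreover have "f (x + t *\<^sub>R a + t *\<^sub>R b) - f (x + t *\<^sub>R a) - f (x + t *\<^sub>R b) + f x
     = t * t * pd b (pd a f) (x + \<xi> *\<^sub>R a + \<zeta> *\<^sub>R b)"
    using \<xi>(3) \<zeta>(3) by (simp add: algebra_simps)
  ultimately show ?thesis using that by blast
qed

text \<open>Both mixed derivatives, taken at suitable points within \<open>2 * t\<close> of
  \<open>x\<close>, equal the same second difference divided by \<open>t * t\<close>; continuity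
  then excludes different values at \<open>x\<close>.\<close>

lemma pd_commute:
  assumes f: "smooth f" and ab: "a \<in> Basis" "b \<in> Basis"
  shows "pd a (pd b f) x = pd b (pd a f) x"
proof (rule ccontr)
  let ?A = "pd a (pd b f)" and ?B = "pd b (pd a f)"
  assume "?A x \<noteq> ?B x"
  define e where "e = \<bar>?A x - ?B x\<bar> / 2"
  have e: "e > 0" using \<open>?A x \<noteq> ?B x\<close> by (simp add: e_def)
  have cA: "isCont ?A x" and cB: "isCont ?B x"
    using f ab smooth_pd smooth_continuous continuous_on_eq_continuous_at by blast+
  obtain dA where dA: "dA > 0" "\<And>y. dist y x < dA \<Longrightarrow> dist (?A y) (?A x) < e"
    using cA e unfolding continuous_at_eps_delta by metis
  obtain dB where dB: "dB > 0" "\<And>y. dist y x < dB \<Longrightarrow> dist (?B y) (?B x) < e"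
    using cB e unfolding continuous_at_eps_delta by metis
  define t where "t = min dA dB / 3"
  have t: "t > 0" "2 * t < dA" "2 * t < dB" using dA dB by (auto simp: t_def)
  obtain p where p: "dist p x \<le> 2 * t"
    "f (x + t *\<^sub>R a + t *\<^sub>R b) - f (x + t *\<^sub>R a) - f (x + t *\<^sub>R b) + f x = t * t * ?B p"
    using pd_pd_mean_value[OF f ab t(1)] by blast
  obtain q where q: "dist q x \<le> 2 * t"
    "f (x + t *\<^sub>R b + t *\<^sub>R a) - f (x + t *\<^sub>R b) - f (x + t *\<^sub>R a) + f x = t * t * ?A q"
    using pd_pd_mean_value[OF f ab(2,1) t(1)] by blast
  have sw: "x + t *\<^sub>R b + t *\<^sub>R a = x + t *\<^sub>R a + t *\<^sub>R b" by (simp add: algebra_simps)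
  have "t * t * ?B p = t * t * ?A q"
    using p(2) q(2) unfolding sw by linarith
  then have "?B p = ?A q" using t(1) by simp
  moreover have "dist (?A q) (?A x) < e" "dist (?B p) (?B x) < e"
    using dA dB p(1) q(1) t by auto
  ultimately show False unfolding e_def dist_real_def by argo
qed

lemma pd_zero_open:
  assumes "open S" "x \<in> S" "\<And>y. y \<in> S \<Longrightarrow> f y = 0"
  shows "pd b f x = 0"
proof -
  have "((\<lambda>x. 0) has_derivative (\<lambda>h. 0)) (at x)" by simp
  then have "(f has_derivative (\<lambda>h. 0)) (at x)"
    using has_derivative_transform_within_open[of "\<lambda>x. 0" _ x UNIV S f] assms by auto
  from pd_unique[OF this] show ?thesis .
qed

text \<open>Normalised to the closed unit ball so that the rescaled copy f((y - x)/s) lives on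
  \<open>cball x s\<close>, and so that the class is stable under partial derivatives.\<close>

definition unit_test :: "('a::euclidean_space \<Rightarrow> real) \<Rightarrow> bool" where
  "unit_test f \<longleftrightarrow> smooth f \<and> (\<forall>z. 1 < norm z \<longrightarrow> f z = 0)"

lemma unit_test_smooth: "unit_test f \<Longrightarrow> smooth f"
  by (simp add: unit_test_def)

lemma unit_test_pd: "unit_test f \<Longrightarrow> b \<in> Basis \<Longrightarrow> unit_test (pd b f)"
  unfolding unit_test_def
proof safe
  fix z :: 'a assume "\<forall>z. 1 < norm z \<longrightarrow> f z = 0" "1 < norm z"
  moreover have "open {z::'a. 1 < norm z}"
    by (intro open_Collect_less continuous_intros)
  ultimately show "pd b f z = 0" using pd_zero_open[of "{z. 1 < norm z}"] by auto
qed (simp add: smooth_pd)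

lemma unit_test_cmult: "unit_test f \<Longrightarrow> unit_test (\<lambda>z. c * f z)"
  by (simp add: unit_test_def smooth_cmult)

lemma unit_test_bounded:
  assumes "unit_test f"
  obtains F where "F > 0" "\<And>z. \<bar>f z\<bar> \<le> F"
proof -
  have "compact (f ` cball 0 1)"
    using assms smooth_continuous by (intro compact_continuous_image) (auto simp: unit_test_def)
  then obtain F where F: "F > 0" "\<And>y. y \<in> f ` cball 0 1 \<Longrightarrow> norm y \<le> F"
    using bounded_pos compact_imp_bounded by metis
  have "\<bar>f z\<bar> \<le> F" for z
    using F assms by (cases "norm z \<le> 1") (auto simp: unit_test_def)
  with F show ?thesis using that by blast
qed

lemma unit_test_grad_bounded:
  assumes "unit_test f"
  obtains F where "F > 0" "\<And>z. norm (grad f z) \<le> F"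
proof -
  have "\<forall>b\<in>Basis. \<exists>F. \<forall>z. \<bar>pd b f z\<bar> \<le> F"
    using unit_test_bounded[OF unit_test_pd[OF assms]] by metis
  then obtain F where F: "\<And>b z. b \<in> Basis \<Longrightarrow> \<bar>pd b f z\<bar> \<le> F b" by metis
  have "norm (grad f z) \<le> (\<Sum>b\<in>Basis. F b)" for z
    unfolding grad_pd by (rule sum_norm_le) (simp add: F)
  then have "norm (grad f z) \<le> \<bar>\<Sum>b\<in>Basis. F b\<bar> + 1" for z
    by (smt (verit))
  moreover have "\<bar>\<Sum>b\<in>Basis. F b\<bar> + 1 > 0" by linarith
  ultimately show ?thesis using that by blast
qed

section \<open>Laplacian, Euler operator and their commutation with partial derivatives\<close>

definition lap :: "('a::euclidean_space \<Rightarrow> real) \<Rightarrow> 'a \<Rightarrow> real" where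
  "lap f z = (\<Sum>b\<in>Basis. pd b (pd b f) z)"

text \<open>The generator of dilations, z . grad f: differentiating f(w/s) in s gives -(1/s) times
  this function at w/s.\<close>

definition euler :: "('a::euclidean_space \<Rightarrow> real) \<Rightarrow> 'a \<Rightarrow> real" where
  "euler f z = (\<Sum>b\<in>Basis. (z \<bullet> b) * pd b f z)"

lemma euler_grad: "euler f z = grad f z \<bullet> z"
  unfolding euler_def grad_pd inner_sum_left inner_scaleR_left
  by (simp add: inner_commute mult.commute)

lemma smooth_euler: "smooth f \<Longrightarrow> smooth (euler f)"
  unfolding euler_def[abs_def] by (intro smooth_sum smooth_mult smooth_pd smooth_inner)

lemma pd_sum:
  assumes "\<And>i. i \<in> I \<Longrightarrow> smooth (f i)"
  shows "pd b (\<lambda>x. \<Sum>i\<in>I. f i x) x = (\<Sum>i\<in>I. pd b (f i) x)"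
  using assms
proof (induction I rule: infinite_finite_induct)
  case (insert i I)
  then show ?case
    by (simp add: pd_add smooth_differentiable smooth_sum)
qed (simp_all add: pd_def)

lemma pd_inner: "pd a (\<lambda>x. x \<bullet> b) x = a \<bullet> b"
proof -
  have "((\<lambda>x. x \<bullet> b) has_derivative (\<lambda>h. h \<bullet> b)) (at x)"
    by (auto intro!: derivative_eq_intros)
  from pd_unique[OF this] show ?thesis .
qed

lemma pd_lap:
  assumes "smooth f" "a \<in> Basis"
  shows "pd a (lap f) z = lap (pd a f) z"
proof -
  have "pd a (lap f) z = (\<Sum>b\<in>Basis. pd a (pd b (pd b f)) z)"
    unfolding lap_def[abs_def] using assms by (intro pd_sum smooth_pd)
  moreover have "pd a (pd b (pd b f)) z = pd b (pd b (pd a f)) z" if "b \<in> Basis" for b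
  proof -
    have "pd a (pd b f) = pd b (pd a f)" using pd_commute[OF assms that] by (rule ext)
    then show ?thesis using pd_commute[OF smooth_pd[OF assms(1) that] assms(2) that] by metis
  qed
  ultimately show ?thesis by (simp add: lap_def)
qed

text \<open>The coefficient \<open>z \<bullet> b\<close> is differentiated once, so the commutator
  of a partial derivative with the Euler operator is that derivative itself.\<close>

lemma pd_euler:
  assumes "smooth f" "a \<in> Basis"
  shows "pd a (euler f) z = pd a f z + euler (pd a f) z"
proof -
  have "pd a (euler f) z = (\<Sum>b\<in>Basis. pd a (\<lambda>z. (z \<bullet> b) * pd b f z) z)"
    unfolding euler_def[abs_def] using assms by (intro pd_sum smooth_mult smooth_pd smooth_inner)
  also have "\<dots> = (\<Sum>b\<in>Basis. (a \<bullet> b) * pd b f z + (z \<bullet> b) * pd b (pd a f) z)"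
  proof (rule sum.cong[OF refl])
    fix b :: 'a assume b: "b \<in> Basis"
    show "pd a (\<lambda>z. (z \<bullet> b) * pd b f z) z = (a \<bullet> b) * pd b f z + (z \<bullet> b) * pd b (pd a f) z"
      using pd_mult[of "\<lambda>z. z \<bullet> b" z "pd b f" a] smooth_pd[OF assms(1) b]
      by (simp add: smooth_differentiable pd_inner pd_commute[OF assms b])
  qed
  also have "\<dots> = (\<Sum>b\<in>Basis. (a \<bullet> b) * pd b f z) + euler (pd a f) z"
    by (simp add: sum.distrib euler_def)
  also have "(\<Sum>b\<in>Basis. (a \<bullet> b) * pd b f z) = pd a f z"
    using assms(2) by (simp add: inner_Basis if_distrib[where f="\<lambda>x. x * _"] sum.delta' cong: if_cong)
  finally show ?thesis .
qed

text \<open>The assumption says grad psi = z eta, hence the Laplacian of psi is the divergence of z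
  eta. This is the link between Laplacians and derivatives in the scale.\<close>

lemma lap_radial:
  fixes \<psi> \<eta> :: "'a::euclidean_space \<Rightarrow> real"
  assumes "smooth \<eta>" and "\<And>b z. b \<in> Basis \<Longrightarrow> pd b \<psi> z = (z \<bullet> b) * \<eta> z"
  shows "lap \<psi> z = real DIM('a) * \<eta> z + euler \<eta> z"
proof -
  have "pd b (pd b \<psi>) z = \<eta> z + (z \<bullet> b) * pd b \<eta> z" if b: "b \<in> Basis" for b
  proof -
    have "pd b \<psi> = (\<lambda>z. (z \<bullet> b) * \<eta> z)" using assms(2)[OF b] by (rule ext)
    then show ?thesis
      using pd_mult[of "\<lambda>z. z \<bullet> b" z \<eta> b] assms(1)
      by (simp add: smooth_differentiable pd_inner inner_Basis b)
  qed
  then have "lap \<psi> z = (\<Sum>b\<in>Basis. \<eta> z + (z \<bullet> b) * pd b \<eta> z)"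
    unfolding lap_def by (intro sum.cong) auto
  then show ?thesis by (simp add: sum.distrib euler_def)
qed

text \<open>The commutator in \<open>pd_euler\<close> raises the constant by one. This matches the
  factor 1/s that each spatial derivative of a mollified function produces, so the relation between
  Laplacian and scale persists for derivatives of every order.\<close>

lemma lap_pd_step:
  assumes "smooth f" "smooth g" "a \<in> Basis" and "\<And>z. lap f z = k * g z + euler g z"
  shows "lap (pd a f) z = (k + 1) * pd a g z + euler (pd a g) z"
proof -
  have "lap f = (\<lambda>z. k * g z + euler g z)" using assms(4) by (rule ext)
  then have "pd a (lap f) z = pd a (\<lambda>z. k * g z) z + pd a (euler g) z"
    using assms by (simp add: pd_add smooth_differentiable smooth_cmult smooth_euler)
  also have "\<dots> = k * pd a g z + (pd a g z + euler (pd a g) z)"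
    using assms by (simp add: pd_cmult smooth_differentiable pd_euler)
  finally show ?thesis using assms by (simp add: pd_lap algebra_simps)
qed

text \<open>This family is closed under differentiation, which makes smoothness of the bump functions
  a single induction.\<close>

definition flat_exp :: "real poly \<Rightarrow> real \<Rightarrow> real" where
  "flat_exp p t = (if t \<le> 0 then 0 else poly p (1 / t) * exp (- (1 / t)))"

lemma poly_times_exp_tendsto_0: "((\<lambda>s. poly p s * exp (- s)) \<longlongrightarrow> (0::real)) at_top"
proof -
  have "((\<lambda>s. \<Sum>i\<le>degree p. coeff p i * (s ^ i / exp s)) \<longlongrightarrow> (\<Sum>i\<le>degree p. coeff p i * 0)) at_top"
    by (intro tendsto_sum tendsto_mult tendsto_const tendsto_power_div_exp_0)
  moreover have "(\<Sum>i\<le>degree p. coeff p i * (s ^ i / exp s)) = poly p s * exp (- s)" for s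
    unfolding poly_altdef sum_distrib_right by (intro sum.cong) (auto simp: exp_minus field_simps)
  ultimately show ?thesis by simp
qed

lemma flat_exp_tendsto_0: "(flat_exp p \<longlongrightarrow> 0) (at 0)"
proof -
  have "((\<lambda>t. poly p (inverse t) * exp (- inverse t)) \<longlongrightarrow> 0) (at_right 0)"
    using filterlim_compose[OF poly_times_exp_tendsto_0 filterlim_inverse_at_top_right] .
  then have "(flat_exp p \<longlongrightarrow> 0) (at_right 0)"
    by (rule Lim_transform_eventually)
      (auto simp: eventually_at_filter flat_exp_def inverse_eq_divide)
  moreover have "(flat_exp p \<longlongrightarrow> 0) (at_left 0)"
    by (rule Lim_transform_eventually[OF tendsto_const])
      (auto simp: eventually_at_filter flat_exp_def)
  ultimately show ?thesis by (simp add: filterlim_at_split)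
qed

text \<open>For t > 0 the derivative of p(1/t) exp(-1/t) is (1/t)^2 (p - p')(1/t) exp(-1/t), so
  differentiation acts on the polynomial as p -> X^2 (p - p').\<close>

lemma flat_exp_derivative:
  "(flat_exp p has_real_derivative flat_exp ([:0,0,1:] * (p - pderiv p)) t) (at t)"
proof (cases t "0::real" rule: linorder_cases)
  case less
  have "((\<lambda>t. 0) has_real_derivative 0) (at t)" by simp
  then have "(flat_exp p has_real_derivative 0) (at t)"
    by (rule has_field_derivative_transform_within_open[where S="{..<0}"])
      (use less in \<open>auto simp: flat_exp_def\<close>)
  then show ?thesis using less by (simp add: flat_exp_def)
next
  case equal
  \<comment> \<open>The difference quotient at 0 is again a member of the family, with polynomial X
    p, so its limit is already known.\<close>
  have "((\<lambda>h. (flat_exp p (0 + h) - flat_exp p 0) / h) \<longlongrightarrow> 0) (at 0)"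
  proof (rule Lim_transform_eventually[OF flat_exp_tendsto_0[of "[:0,1:] * p"]])
    show "\<forall>\<^sub>F h in at 0. flat_exp ([:0,1:] * p) h = (flat_exp p (0 + h) - flat_exp p 0) / h"
      by (auto simp: eventually_at_filter flat_exp_def field_simps)
  qed
  then have "(flat_exp p has_real_derivative 0) (at 0)" by (simp add: DERIV_def)
  then show ?thesis using equal by (simp add: flat_exp_def)
next
  case greater
  have 1: "((\<lambda>t. 1 / t) has_real_derivative - (1 / t\<^sup>2)) (at t)"
    using greater by (auto intro!: derivative_eq_intros simp: power2_eq_square)
  have 2: "((\<lambda>t. poly p (1 / t)) has_real_derivative poly (pderiv p) (1 / t) * - (1 / t\<^sup>2)) (at t)"
    using DERIV_chain2[OF poly_DERIV 1] .
  have 3: "((\<lambda>t. exp (- (1 / t))) has_real_derivative exp (- (1 / t)) * (1 / t\<^sup>2)) (at t)"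
    using DERIV_chain2[OF DERIV_exp DERIV_minus[OF 1]] by simp
  have "((\<lambda>t. poly p (1 / t) * exp (- (1 / t))) has_real_derivative
      flat_exp ([:0,0,1:] * (p - pderiv p)) t) (at t)"
    by (rule DERIV_cong[OF DERIV_mult[OF 2 3]])
      (use greater in \<open>simp add: flat_exp_def field_simps power2_eq_square\<close>)
  then show ?thesis
    by (rule has_field_derivative_transform_within_open[where S="{0<..}"])
      (use greater in \<open>auto simp: flat_exp_def\<close>)
qed

lemma smooth_flat_exp: "smooth q \<Longrightarrow> smooth (\<lambda>x. flat_exp p (q x))"
  by (rule smooth_compose_real[where H="range flat_exp"]) (auto intro: flat_exp_derivative)

lemma unit_test_flat_exp: "unit_test (\<lambda>z::'a::euclidean_space. flat_exp p (1 - (norm z)\<^sup>2))"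
proof -
  have "smooth (\<lambda>z::'a. 1 - (norm z)\<^sup>2)" by (intro smooth_diff) auto
  moreover have "1 \<le> (norm z)\<^sup>2" if "1 < norm z" for z :: 'a
    using that by simp
  then have "flat_exp p (1 - (norm z)\<^sup>2) = 0" if "1 < norm z" for z :: 'a
    using that by (simp add: flat_exp_def)
  ultimately show ?thesis
    by (simp add: unit_test_def smooth_flat_exp)
qed

text \<open>For p = 1 the rule p -> X^2 (p - p') gives X^2, and the inner derivative is -2 z. Hence
  the gradient of the standard bump is z times a bump of the same kind with a constant sign.\<close>

lemma pd_flat_exp_radial:
  "b \<in> Basis \<Longrightarrow> pd b (\<lambda>z::'a::euclidean_space. flat_exp 1 (1 - (norm z)\<^sup>2)) z
    = (z \<bullet> b) * (- 2 * flat_exp [:0,0,1:] (1 - (norm z)\<^sup>2))"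
proof -
  assume b: "b \<in> Basis"
  have 1: "((\<lambda>z::'a. 1 - (norm z)\<^sup>2) has_derivative (\<lambda>h. - 2 * (z \<bullet> h))) (at z)"
    unfolding power2_norm_eq_inner
    by (auto intro!: derivative_eq_intros simp: inner_commute)
  have 2: "(flat_exp 1 has_derivative (\<lambda>h. flat_exp [:0,0,1:] (1 - (norm z)\<^sup>2) * h)) (at (1 - (norm z)\<^sup>2))"
    using flat_exp_derivative[of 1] by (simp add: has_field_derivative_def one_pCons)
  from pd_unique[OF has_derivative_compose[OF 1 2], of b]
  show ?thesis by simp
qed

lemma unit_test_has_integral:
  fixes f :: "'a::euclidean_space \<Rightarrow> real"
  assumes "unit_test f"
  shows "f integrable_on UNIV" and "cball 0 1 \<subseteq> cbox a b \<Longrightarrow> integral (cbox a b) f = integral UNIV f"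
proof -
  have *: "(f has_integral integral (cbox a b) f) UNIV" if "cball 0 1 \<subseteq> cbox a b" for a b
  proof (rule has_integral_on_superset)
    show "(f has_integral integral (cbox a b) f) (cbox a b)"
      using assms by (intro integrable_integral integrable_continuous smooth_continuous)
        (simp add: unit_test_def)
    show "f x = 0" if "x \<notin> cbox a b" for x
      using assms that \<open>cball 0 1 \<subseteq> cbox a b\<close> by (force simp: unit_test_def)
  qed auto
  obtain c where c: "cball 0 1 \<subseteq> cbox (-c) (c::'a)"
    using bounded_subset_cbox_symmetric[OF bounded_cball] by blast
  show "f integrable_on UNIV" using *[OF c] by blast
  show "integral (cbox a b) f = integral UNIV f" if "cball 0 1 \<subseteq> cbox a b"
    using *[OF that] by (simp add: integral_unique)
qed

text \<open>Take for \<open>\<psi>\<close> a multiple of the bump exp(-1/(1 - |z|^2)). Its gradient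
  is z times a function of one sign, which after normalisation can itself serve as the mollifier
  \<open>\<eta>\<close>; the last clause is then \<open>lap_radial\<close>.\<close>

lemma radial_mollifier:
  obtains \<psi> \<eta> :: "'a::euclidean_space \<Rightarrow> real"
  where "unit_test \<psi>" "unit_test \<eta>" "\<And>z. \<eta> z \<ge> 0" "integral UNIV \<eta> = 1"
    "\<And>z. \<eta> (- z) = \<eta> z" "\<And>z. lap \<psi> z = real DIM('a) * \<eta> z + euler \<eta> z"
proof -
  define \<psi>0 where "\<psi>0 = (\<lambda>z::'a. flat_exp 1 (1 - (norm z)\<^sup>2))"
  define \<eta>0 where "\<eta>0 = (\<lambda>z::'a. flat_exp [:0,0,1:] (1 - (norm z)\<^sup>2))"
  have u: "unit_test \<psi>0" "unit_test \<eta>0" by (auto simp: \<psi>0_def \<eta>0_def unit_test_flat_exp)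
  have nn: "\<eta>0 z \<ge> 0" for z by (auto simp: \<eta>0_def flat_exp_def)
  obtain c where c: "cball 0 1 \<subseteq> cbox (-c) (c::'a)"
    using bounded_subset_cbox_symmetric[OF bounded_cball] by blast
  have cont: "continuous_on (cbox (-c) c) \<eta>0" using u unit_test_smooth smooth_continuous by blast
  define I where "I = integral UNIV \<eta>0"
  have I: "I = integral (cbox (-c) c) \<eta>0" using unit_test_has_integral(2)[OF u(2) c] by (simp add: I_def)
  have "I \<ge> 0" unfolding I_def using nn unit_test_has_integral(1)[OF u(2)] by (simp add: integral_nonneg)
  moreover have "I \<noteq> 0"
  proof
    assume "I = 0"
    then have "(\<eta>0 has_integral 0) (cbox (-c) c)"
      using I integrable_integral[OF integrable_continuous[OF cont]] by simp
    moreover have "0 \<in> cbox (-c) c" using c by (meson centre_in_cball in_mono zero_le_one)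
    ultimately have "\<eta>0 0 = 0"
      using has_integral_0_cbox_imp_0[of "-c" c \<eta>0 0] cont nn c
      by (metis ball_subset_cball box_eq_empty(1) centre_in_ball empty_iff interior_cbox interior_maximal
          open_ball subset_iff order_trans zero_less_one)
    then show False by (simp add: \<eta>0_def flat_exp_def)
  qed
  ultimately have "I > 0" by simp
  \<comment> \<open>The sign and the 2 undo the factor -2 of the chain rule, and \<open>I\<close>
    normalises the mass, so that grad \<open>\<psi>\<close> = z \<open>\<eta>\<close>.\<close>
  define \<psi> where "\<psi> = (\<lambda>z. (- (1 / (2 * I))) * \<psi>0 z)"
  define \<eta> where "\<eta> = (\<lambda>z. (1 / I) * \<eta>0 z)"
  have "unit_test \<psi>" "unit_test \<eta>" unfolding \<psi>_def \<eta>_def using u unit_test_cmult by blast+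
  moreover have "\<eta> (- z) = \<eta> z" for z by (simp add: \<eta>_def \<eta>0_def)
  moreover have "\<eta> z \<ge> 0" for z using nn \<open>I > 0\<close> by (simp add: \<eta>_def)
  moreover have "integral UNIV \<eta> = 1" using \<open>I > 0\<close> I_def by (simp add: \<eta>_def)
  moreover have rad: "pd b \<psi> z = (z \<bullet> b) * \<eta> z" if "b \<in> Basis" for b z
  proof -
    have "pd b \<psi> z = (- (1 / (2 * I))) * pd b \<psi>0 z"
      unfolding \<psi>_def by (rule pd_cmult) (use u unit_test_smooth smooth_differentiable in blast)
    also have "pd b \<psi>0 z = (z \<bullet> b) * (- 2 * \<eta>0 z)"
      unfolding \<psi>0_def \<eta>0_def by (rule pd_flat_exp_radial[OF that])
    finally show ?thesis using \<open>I > 0\<close> by (simp add: \<eta>_def)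
  qed
  moreover have "lap \<psi> z = real DIM('a) * \<eta> z + euler \<eta> z" for z
    using lap_radial[OF unit_test_smooth[OF \<open>unit_test \<eta>\<close>] rad] .
  ultimately show ?thesis using that by blast
qed

text \<open>Hole filling only needs a positive lower bound on the half ball, so a plateau of height
  1 is not constructed. For |z| <= 1/2 one has 1 - |z|^2 >= 3/4, which gives the constant
  exp(-4/3).\<close>

lemma cutoff:
  obtains \<theta> :: "'a::euclidean_space \<Rightarrow> real" and c
  where "unit_test \<theta>" "c > 0" "\<And>z. 0 \<le> \<theta> z" "\<And>z. \<theta> z \<le> 1" "\<And>z. norm z \<le> 1/2 \<Longrightarrow> c \<le> \<theta> z"
proof
  let ?\<theta> = "\<lambda>z::'a. flat_exp 1 (1 - (norm z)\<^sup>2)"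
  show "unit_test ?\<theta>" by (rule unit_test_flat_exp)
  show "exp (- (4/3)) > (0::real)" by simp
  show "0 \<le> ?\<theta> z" "?\<theta> z \<le> 1" for z by (auto simp: flat_exp_def)
  show "exp (- (4/3)) \<le> ?\<theta> z" if "norm z \<le> 1/2" for z
  proof -
    have "(norm z)\<^sup>2 \<le> (1/2)\<^sup>2" using that by (intro power_mono) auto
    then have "3/4 \<le> 1 - (norm z)\<^sup>2" by (simp add: power2_eq_square)
    then show ?thesis by (auto simp: flat_exp_def field_simps)
  qed
qed

section \<open>Mollification\<close>

lemma grad_continuous: "smooth f \<Longrightarrow> continuous_on S (grad f)"
  unfolding grad_pd[abs_def]
  by (intro continuous_on_sum continuous_on_scaleR smooth_continuous smooth_pd continuous_on_const)

text \<open>Mollification without the factor s^(-n): different powers of \<open>s\<close> are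
  attached later, according to the number of derivatives. Integrating a continuous \<open>u\<close>
  over a fixed box puts all dependence on \<open>x\<close> and \<open>s\<close> into the kernel, so
  one may differentiate under the integral sign.\<close>

definition kernel_int :: "'a \<Rightarrow> 'a \<Rightarrow> ('a \<Rightarrow> real) \<Rightarrow> ('a \<Rightarrow> real) \<Rightarrow> 'a::euclidean_space \<Rightarrow> real \<Rightarrow> real" where
  "kernel_int a b u f x s = integral (cbox a b) (\<lambda>y. u y * f ((1/s) *\<^sub>R (y - x)))"

context
  fixes a b :: "'a::euclidean_space" and u :: "'a \<Rightarrow> real"
  assumes u: "continuous_on (cbox a b) u"
begin

lemma kernel_int_integrable:
  assumes "smooth f"
  shows "(\<lambda>y. u y * f (c *\<^sub>R (y - x))) integrable_on cbox a b"
  by (intro integrable_continuous continuous_on_mult u smooth_continuous'[OF assms]) (auto intro!: continuous_intros)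

lemma kernel_int_add:
  assumes "smooth f" "smooth g"
  shows "kernel_int a b u (\<lambda>z. k * f z + g z) x s = k * kernel_int a b u f x s + kernel_int a b u g x s"
proof -
  have "kernel_int a b u (\<lambda>z. k * f z + g z) x s = integral (cbox a b)
     (\<lambda>y. k * (u y * f ((1/s) *\<^sub>R (y - x))) + u y * g ((1/s) *\<^sub>R (y - x)))"
    unfolding kernel_int_def by (simp add: algebra_simps)
  also have "\<dots> = integral (cbox a b) (\<lambda>y. k * (u y * f ((1/s) *\<^sub>R (y - x)))) +
      integral (cbox a b) (\<lambda>y. u y * g ((1/s) *\<^sub>R (y - x)))"
    by (intro integral_add integrable_on_mult_right kernel_int_integrable assms)
  finally show ?thesis by (simp add: kernel_int_def)
qed

lemma kernel_int_has_derivative: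
  assumes f: "smooth f"
  shows "((\<lambda>x. kernel_int a b u f x s) has_derivative (\<lambda>h. - (1/s) * (\<Sum>i\<in>Basis. (h \<bullet> i) * kernel_int a b u (pd i f) x s))) (at x)"
proof -
  \<comment> \<open>The gradient in \<open>x\<close> of the integrand; the minus sign comes from the
    argument y - x.\<close>
  define V where "V = (\<lambda>x y. (- (1/s) * u y) *\<^sub>R grad f ((1/s) *\<^sub>R (y - x)))"
  have cV: "continuous_on (UNIV \<times> cbox a b) (\<lambda>(x, y). V x y)"
    unfolding V_def split_beta
    by (intro continuous_on_scaleR continuous_on_mult continuous_on_const
        continuous_on_compose2[OF u] continuous_on_compose2[OF grad_continuous[OF f, of UNIV]])
      (auto intro!: continuous_intros)
  have "((\<lambda>x. integral (cbox a b) (\<lambda>y. u y * f ((1/s) *\<^sub>R (y - x)))) has_derivative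
     integral (cbox a b) (\<lambda>y. blinfun_inner_left (V x y))) (at x within UNIV)"
  proof (rule leibniz_rule)
    fix x y :: 'a
    have 1: "((\<lambda>x. (1/s) *\<^sub>R (y - x)) has_derivative (\<lambda>h. - (1/s) *\<^sub>R h)) (at x)"
      by (auto intro!: derivative_eq_intros simp: algebra_simps)
    have "((\<lambda>x. u y * f ((1/s) *\<^sub>R (y - x))) has_derivative
      (\<lambda>h. u y * (grad f ((1/s) *\<^sub>R (y - x)) \<bullet> (- (1/s) *\<^sub>R h)))) (at x)"
      by (intro has_derivative_mult_right smooth_has_derivative'[OF f] 1)
    then show "((\<lambda>x. u y * f ((1/s) *\<^sub>R (y - x))) has_derivative blinfun_apply (blinfun_inner_left (V x y))) (at x within UNIV)"
      by (rule has_derivative_eq_rhs) (simp add: fun_eq_iff V_def inner_commute)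
  next
    show "(\<lambda>y. u y * f ((1/s) *\<^sub>R (y - x))) integrable_on cbox a b" for x
      by (rule kernel_int_integrable[OF f])
    show "continuous_on (UNIV \<times> cbox a b) (\<lambda>(x, y). blinfun_inner_left (V x y))"
      using cV unfolding split_beta
      by (rule bounded_linear.continuous_on[OF bounded_linear_blinfun_inner_left])
  qed auto
  then show ?thesis unfolding kernel_int_def
  proof (rule has_derivative_eq_rhs)
    have cVx: "continuous_on (cbox a b) (V x)"
      unfolding V_def
      by (intro continuous_on_scaleR continuous_on_mult continuous_on_const u
        continuous_on_compose2[OF grad_continuous[OF f, of UNIV]])
      (auto intro!: continuous_intros)
    show "blinfun_apply (integral (cbox a b) (\<lambda>y. blinfun_inner_left (V x y))) =
      (\<lambda>h. - (1/s) * (\<Sum>i\<in>Basis. (h \<bullet> i) * integral (cbox a b) (\<lambda>y. u y * pd i f ((1/s) *\<^sub>R (y - x)))))"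
    proof
      fix h
      have "blinfun_apply (integral (cbox a b) (\<lambda>y. blinfun_inner_left (V x y))) h
        = integral (cbox a b) (\<lambda>y. blinfun_apply (blinfun_inner_left (V x y)) h)"
        by (rule blinfun_apply_integral)
          (intro integrable_continuous bounded_linear.continuous_on[OF bounded_linear_blinfun_inner_left] cVx)
      also have "\<dots> = integral (cbox a b) (\<lambda>y. - (1/s) * (\<Sum>i\<in>Basis. (h \<bullet> i) * (u y * pd i f ((1/s) *\<^sub>R (y - x)))))"
        by (rule integral_cong)
         (simp add: V_def grad_pd inner_sum_left inner_sum_right sum_distrib_left sum_negf[symmetric] mult_ac inner_commute)
      also have "\<dots> = - (1/s) * integral (cbox a b) (\<lambda>y. (\<Sum>i\<in>Basis. (h \<bullet> i) * (u y * pd i f ((1/s) *\<^sub>R (y - x)))))"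
        by simp
      also have "integral (cbox a b) (\<lambda>y. (\<Sum>i\<in>Basis. (h \<bullet> i) * (u y * pd i f ((1/s) *\<^sub>R (y - x)))))
        = (\<Sum>i\<in>Basis. integral (cbox a b) (\<lambda>y. (h \<bullet> i) * (u y * pd i f ((1/s) *\<^sub>R (y - x)))))"
        by (intro integral_sum integrable_on_mult_right kernel_int_integrable smooth_pd f) auto
      finally show "blinfun_apply (integral (cbox a b) (\<lambda>y. blinfun_inner_left (V x y))) h = - (1/s) *
         (\<Sum>i\<in>Basis. (h \<bullet> i) * integral (cbox a b) (\<lambda>y. u y * pd i f ((1/s) *\<^sub>R (y - x))))"
        by simp
    qed
  qed
qed

lemma pd_kernel_int:
  assumes "smooth f" "i \<in> Basis"
  shows "pd i (\<lambda>x. kernel_int a b u f x s) x = - (1/s) * kernel_int a b u (pd i f) x s"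
  using pd_unique[OF kernel_int_has_derivative[OF assms(1)], of i s x] assms(2)
  by (simp add: inner_Basis if_distrib[where f="\<lambda>x. x * _"] sum.delta' cong: if_cong)

lemma smooth_kernel_int:
  assumes "smooth f"
  shows "smooth (\<lambda>x. kernel_int a b u f x s)"
proof (rule smooth_coinduct[where P="\<lambda>g. \<exists>f k. smooth f \<and> g = (\<lambda>x. k * kernel_int a b u f x s)"])
  show "\<exists>fa k. smooth fa \<and> (\<lambda>x. kernel_int a b u f x s) = (\<lambda>x. k * kernel_int a b u fa x s)"
    using assms by (intro exI[of _ f] exI[of _ 1]) auto
next
  fix g assume "\<exists>f k. smooth f \<and> g = (\<lambda>x. k * kernel_int a b u f x s)"
  then obtain f k where f: "smooth f" and g: "g = (\<lambda>x. k * kernel_int a b u f x s)" by blast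
  have d: "(\<lambda>x. kernel_int a b u f x s) differentiable at x" for x
    using kernel_int_has_derivative[OF f] differentiable_def by blast
  have "pd i g = (\<lambda>x. (k * - (1/s)) * kernel_int a b u (pd i f) x s)" if "i \<in> Basis" for i
    unfolding g using that f d by (simp add: fun_eq_iff pd_cmult pd_kernel_int)
  then have "\<forall>i\<in>Basis. \<exists>f k. smooth f \<and> pd i g = (\<lambda>x. k * kernel_int a b u f x s)"
    using smooth_pd[OF f] by blast
  moreover have "g differentiable_on UNIV"
    unfolding g differentiable_on_def using d by auto
  ultimately show "g differentiable_on UNIV \<and> (\<forall>i\<in>Basis. \<exists>f k. smooth f \<and> pd i g = (\<lambda>x. k * kernel_int a b u f x s))"
    by blast
qed

text \<open>Dilating the kernel produces its Euler derivative. Differentiation under the integral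
  takes place on the half line of positive scales, where the integrand and its derivative are
  jointly continuous.\<close>

lemma kernel_int_scale_derivative:
  assumes f: "smooth f" and s: "s > 0"
  shows "((\<lambda>s. kernel_int a b u f x s) has_real_derivative - (1/s) * kernel_int a b u (euler f) x s) (at s)"
proof -
  have "((\<lambda>s. integral (cbox a b) (\<lambda>y. u y * f ((1/s) *\<^sub>R (y - x)))) has_real_derivative
     integral (cbox a b) (\<lambda>y. - (1/s) * (u y * euler f ((1/s) *\<^sub>R (y - x))))) (at s within {0<..})"
  proof (rule leibniz_rule_field_derivative)
    fix s :: real and y assume s: "s \<in> {0<..}"
    have 1: "((\<lambda>s. (1/s) *\<^sub>R (y - x)) has_derivative (\<lambda>h. (- (h / s\<^sup>2)) *\<^sub>R (y - x))) (at s within {0<..})"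
      using s by (auto intro!: derivative_eq_intros simp: power2_eq_square divide_simps)
    have "((\<lambda>s. u y * f ((1/s) *\<^sub>R (y - x))) has_derivative
      (\<lambda>h. u y * (grad f ((1/s) *\<^sub>R (y - x)) \<bullet> ((- (h / s\<^sup>2)) *\<^sub>R (y - x))))) (at s within {0<..})"
      by (intro has_derivative_mult_right smooth_has_derivative'[OF f] 1)
    moreover have "grad f ((1/s) *\<^sub>R w) \<bullet> ((- (h / s\<^sup>2)) *\<^sub>R w) =
        - (1/s) * euler f ((1/s) *\<^sub>R w) * h" for h and w :: 'a
      using s by (simp add: euler_grad power2_eq_square field_simps)
    ultimately show "((\<lambda>s. u y * f ((1/s) *\<^sub>R (y - x))) has_real_derivative
       - (1/s) * (u y * euler f ((1/s) *\<^sub>R (y - x)))) (at s within {0<..})"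
      unfolding has_field_derivative_def
      by (elim has_derivative_eq_rhs) (simp only: fun_eq_iff mult_ac minus_mult_right minus_mult_left, simp)
  next
    show "(\<lambda>y. u y * f ((1/s) *\<^sub>R (y - x))) integrable_on cbox a b" for s
      by (rule kernel_int_integrable[OF f])
    show "continuous_on ({0<..} \<times> cbox a b) (\<lambda>(s, y). - (1/s) * (u y * euler f ((1/s) *\<^sub>R (y - x))))"
      unfolding split_beta
      by (intro continuous_on_mult continuous_on_minus continuous_on_divide continuous_on_const
          continuous_on_compose2[OF u] smooth_continuous'[OF smooth_euler[OF f]] continuous_on_scaleR)
        (auto intro!: continuous_intros)
  qed (use s in auto)
  then have "((\<lambda>s. kernel_int a b u f x s) has_real_derivative - (1/s) * kernel_int a b u (euler f) x s) (at s within {0<..})"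
    unfolding kernel_int_def by simp
  moreover have "at s within {0<..} = at s" using s by (intro at_within_open) auto
  ultimately show ?thesis by simp
qed

text \<open>The combination \<open>N * f z + euler f z\<close> is the one produced by
  \<open>lap_radial\<close> and \<open>lap_pd_step\<close>: for N = n + k it is a Laplacian, so the
  derivative in the scale becomes an integral of \<open>u\<close> against a rescaled
  Laplacian.\<close>

lemma kernel_int_powr_derivative:
  assumes f: "smooth f" and s: "s > 0"
  shows "((\<lambda>s. s powr (- N) * kernel_int a b u f x s) has_real_derivative
     - (s powr (- N - 1) * kernel_int a b u (\<lambda>z. N * f z + euler f z) x s)) (at s)"
proof -
  have "((\<lambda>s. s powr (- N)) has_real_derivative (- N) * s powr (- N - 1)) (at s)"
    using has_real_derivative_powr[OF s, of "- N"] by simp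
  from DERIV_mult[OF this kernel_int_scale_derivative[OF f s, of x]]
  show ?thesis
    by (rule DERIV_cong)
      (use s in \<open>simp add: kernel_int_add[OF f smooth_euler[OF f]] powr_diff, simp add: field_simps\<close>)
qed

end

lemma unit_test_scaled_zero:
  assumes "unit_test f" "s > 0" "y \<notin> cball x s"
  shows "f ((1/s) *\<^sub>R (y - x)) = 0"
proof -
  have "1 < norm (y - x) / s" using assms by (simp add: dist_norm norm_minus_commute)
  then have "1 < norm ((1/s) *\<^sub>R (y - x))" using assms(2) by simp
  then show ?thesis using assms(1) by (simp add: unit_test_def)
qed

lemma kernel_scaling:
  fixes \<eta> :: "'a::euclidean_space \<Rightarrow> real"
  assumes \<eta>: "unit_test \<eta>" and s: "s > 0" and sub: "cball x s \<subseteq> cbox a b"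
  shows "integral (cbox a b) (\<lambda>y. \<eta> ((1/s) *\<^sub>R (y - x))) = s ^ DIM('a) * integral UNIV \<eta>"
proof -
  have "cball 0 1 \<subseteq> cbox ((a - x) /\<^sub>R s) ((b - x) /\<^sub>R s)"
  proof
    fix z :: 'a assume "z \<in> cball 0 1"
    then have "x + s *\<^sub>R z \<in> cball x s" using s by (simp add: dist_norm)
    then have "x + s *\<^sub>R z \<in> cbox a b" using sub by blast
    then show "z \<in> cbox ((a - x) /\<^sub>R s) ((b - x) /\<^sub>R s)"
      using s by (auto simp: mem_box inner_simps field_simps)
  qed
  then have "(\<eta> has_integral integral UNIV \<eta>) (cbox ((a - x) /\<^sub>R s) ((b - x) /\<^sub>R s))"
    using unit_test_has_integral(2)[OF \<eta>] unit_test_smooth[OF \<eta>]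
    by (metis integrable_continuous integrable_integral smooth_continuous)
  from has_integral_affinity'[OF this, of "1/s" "- (1/s) *\<^sub>R x"]
  have "((\<lambda>y. \<eta> ((1/s) *\<^sub>R y + - (1/s) *\<^sub>R x)) has_integral integral UNIV \<eta> /\<^sub>R (1/s) ^ DIM('a))
     (cbox (((a - x) /\<^sub>R s - - (1/s) *\<^sub>R x) /\<^sub>R (1/s)) (((b - x) /\<^sub>R s - - (1/s) *\<^sub>R x) /\<^sub>R (1/s)))"
    using s by simp
  moreover have "((c - x) /\<^sub>R s - - (1/s) *\<^sub>R x) /\<^sub>R (1/s) = c" for c
    using s by (simp add: algebra_simps inverse_eq_divide)
  ultimately have "((\<lambda>y. \<eta> ((1/s) *\<^sub>R (y - x))) has_integral integral UNIV \<eta> /\<^sub>R (1/s) ^ DIM('a)) (cbox a b)"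
    by (simp add: algebra_simps)
  then show ?thesis using s by (simp add: integral_unique field_simps)
qed

lemma mollifier_close:
  fixes \<eta> :: "'a::euclidean_space \<Rightarrow> real"
  assumes u: "continuous_on (cbox a b) u" and \<eta>: "unit_test \<eta>" "\<And>z. \<eta> z \<ge> 0" "integral UNIV \<eta> = 1"
    and s: "s > 0" and sub: "cball x s \<subseteq> cbox a b"
    and e: "\<And>y. y \<in> cball x s \<Longrightarrow> \<bar>u y - c\<bar> \<le> e"
  shows "\<bar>(1 / s ^ DIM('a)) * kernel_int a b u \<eta> x s - c\<bar> \<le> e"
proof -
  let ?k = "\<lambda>y. \<eta> ((1/s) *\<^sub>R (y - x))"
  have sm: "smooth \<eta>" using \<eta>(1) unit_test_smooth by blast
  have i1: "?k integrable_on cbox a b"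
    by (intro integrable_continuous smooth_continuous smooth_affine sm)
  have i2: "(\<lambda>y. u y * ?k y) integrable_on cbox a b" by (rule kernel_int_integrable[OF u sm])
  have kint: "integral (cbox a b) ?k = s ^ DIM('a)" using kernel_scaling[OF \<eta>(1) s sub] \<eta>(3) by simp
  have "kernel_int a b u \<eta> x s - c * s ^ DIM('a) = integral (cbox a b) (\<lambda>y. u y * ?k y - c * ?k y)"
    unfolding kernel_int_def kint[symmetric] integral_mult_right[symmetric]
    by (rule integral_diff[symmetric]) (use i1 i2 in \<open>auto intro: integrable_on_mult_right\<close>)
  moreover have "norm (integral (cbox a b) (\<lambda>y. u y * ?k y - c * ?k y)) \<le> integral (cbox a b) (\<lambda>y. e * ?k y)"
  proof (rule integral_norm_bound_integral)
    show "(\<lambda>y. u y * ?k y - c * ?k y) integrable_on cbox a b"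
      by (rule integrable_diff[OF i2]) (use i1 in \<open>auto intro: integrable_on_mult_right\<close>)
    show "(\<lambda>y. e * ?k y) integrable_on cbox a b" using i1 by (auto intro: integrable_on_mult_right)
    fix y assume "y \<in> cbox a b"
    show "norm (u y * ?k y - c * ?k y) \<le> e * ?k y"
    proof (cases "y \<in> cball x s")
      case True
      have "norm (u y * ?k y - c * ?k y) = \<bar>u y - c\<bar> * ?k y"
        using \<eta>(2) by (simp add: left_diff_distrib[symmetric] abs_mult)
      then show ?thesis using e[OF True] \<eta>(2) by (simp add: mult_right_mono)
    next
      case False
      then show ?thesis using unit_test_scaled_zero[OF \<eta>(1) s] by simp
    qed
  qed
  ultimately have "\<bar>kernel_int a b u \<eta> x s - c * s ^ DIM('a)\<bar> \<le> e * s ^ DIM('a)"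
    by (simp add: kint)
  moreover have "(1 / s ^ DIM('a)) * kernel_int a b u \<eta> x s - c
     = (kernel_int a b u \<eta> x s - c * s ^ DIM('a)) / s ^ DIM('a)"
    using s by (simp add: field_simps)
  ultimately show ?thesis using s by (simp add: field_simps)
qed

section \<open>From decay of mollified Laplacians to Hoelder regularity\<close>

text \<open>The size to be expected of a function with Hoelder exponent \<open>\<mu>\<close> below 2
  (a C^1 function with gradient exponent \<open>\<mu>\<close> - 1 if \<open>\<mu>\<close> > 1),
  because \<open>lap f\<close> integrates to zero against affine functions. The constant may depend
  on the kernel, but not on the centre or the scale.\<close>

definition lap_decay ::
  "'a::euclidean_space \<Rightarrow> 'a \<Rightarrow> ('a \<Rightarrow> real) \<Rightarrow> 'a set \<Rightarrow> real \<Rightarrow> real \<Rightarrow> bool" where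
  "lap_decay a b u S \<rho> \<mu> \<longleftrightarrow> (\<forall>f. unit_test f \<longrightarrow> (\<exists>C. \<forall>x\<in>S. \<forall>s. 0 < s \<and> s \<le> \<rho> \<longrightarrow>
     \<bar>kernel_int a b u (lap f) x s\<bar> \<le> C * s powr (real DIM('a) + \<mu>)))"

lemma smooth_mean_value:
  assumes F: "smooth F" and S: "convex S" "x \<in> S" "y \<in> S"
  obtains z where "z \<in> S" "dist z x \<le> dist y x" "F y - F x = grad F z \<bullet> (y - x)"
proof -
  obtain t where t: "0 < t" "t < 1"
    "F (x + 1 *\<^sub>R (y - x)) - F (x + 0 *\<^sub>R (y - x)) = (1 - 0) * (grad F (x + t *\<^sub>R (y - x)) \<bullet> (y - x))"
    using MVT2[of 0 1, OF _ smooth_line_derivative[OF F]] by (metis zero_less_one)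
  let ?z = "x + t *\<^sub>R (y - x)"
  have "?z = (1 - t) *\<^sub>R x + t *\<^sub>R y" by (simp add: algebra_simps)
  then have "?z \<in> S" using convexD_alt[OF S] t by simp
  moreover have "dist ?z x \<le> dist y x"
    using t by (simp add: dist_norm mult_left_le_one_le)
  ultimately show ?thesis using that t by simp
qed

lemma smooth_lipschitz:
  fixes F :: "'a::euclidean_space \<Rightarrow> real"
  assumes F: "smooth F" and S: "convex S" "x \<in> S" "y \<in> S"
    and B: "\<And>i z. i \<in> Basis \<Longrightarrow> z \<in> S \<Longrightarrow> \<bar>pd i F z\<bar> \<le> B"
  shows "\<bar>F x - F y\<bar> \<le> real DIM('a) * B * dist x y"
proof -
  obtain z where z: "z \<in> S" "F x - F y = grad F z \<bullet> (x - y)"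
    using smooth_mean_value[OF F S(1,3,2)] by metis
  have "norm (grad F z) \<le> (\<Sum>i\<in>(Basis::'a set). B)"
    unfolding grad_pd by (rule sum_norm_le) (simp add: B z)
  then have "norm (grad F z) * norm (x - y) \<le> real DIM('a) * B * norm (x - y)"
    by (intro mult_right_mono) auto
  then show ?thesis
    unfolding z(2) dist_norm using Cauchy_Schwarz_ineq2[of "grad F z" "x - y"] by linarith
qed

context
  fixes a b :: "'a::euclidean_space" and u :: "'a \<Rightarrow> real"
    and S :: "'a set" and \<rho> \<mu> :: real
  assumes u: "continuous_on (cbox a b) u"
    and \<rho>: "\<rho> > 0" and sub: "\<And>x. x \<in> S \<Longrightarrow> cball x \<rho> \<subseteq> cbox a b"
    and decay: "lap_decay a b u S \<rho> \<mu>"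
begin

text \<open>A crude bound, used only to control the value at the largest scale
  \<open>\<rho>\<close>.\<close>

lemma kernel_int_bounded:
  assumes "unit_test f"
  shows "\<exists>B\<ge>0. \<forall>x s. \<bar>kernel_int a b u f x s\<bar> \<le> B"
proof -
  obtain F where F: "F > 0" "\<And>z. \<bar>f z\<bar> \<le> F" using unit_test_bounded[OF assms] by blast
  have "compact (u ` cbox a b)" using u by (intro compact_continuous_image) auto
  then obtain M where M: "M > 0" "\<And>y. y \<in> u ` cbox a b \<Longrightarrow> norm y \<le> M"
    using bounded_pos compact_imp_bounded by metis
  have "\<bar>kernel_int a b u f x s\<bar> \<le> M * F * measure lborel (cbox a b)" for x s
  proof -
    have "norm (integral (cbox a b) (\<lambda>y. u y * f ((1/s) *\<^sub>R (y - x)))) \<le> M * F * measure lborel (cbox a b)"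
    proof (rule integrable_bound)
      show "0 \<le> M * F" using M F by simp
      show "(\<lambda>y. u y * f ((1/s) *\<^sub>R (y - x))) integrable_on cbox a b"
        by (rule kernel_int_integrable[OF u unit_test_smooth[OF assms]])
      show "norm (u y * f ((1/s) *\<^sub>R (y - x))) \<le> M * F" if "y \<in> cbox a b" for y
        unfolding norm_mult using M F that by (intro mult_mono) auto
    qed
    then show ?thesis by (simp add: kernel_int_def)
  qed
  moreover have "0 \<le> M * F * measure lborel (cbox a b)" using M F by simp
  ultimately show ?thesis by blast
qed

text \<open>By the equation between \<open>f\<close> and \<open>h\<close>, the derivative of the scaled integral in \<open>s\<close> is an integral
  against a rescaled Laplacian.\<close>

lemma scaled_increment:
  assumes f: "unit_test f" and h: "unit_test h"
    and eq: "\<And>z. lap f z = (real DIM('a) + k) * h z + euler h z" and k: "k \<noteq> \<mu>"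
  shows "\<exists>C\<ge>0. \<forall>x\<in>S. \<forall>s t. 0 < t \<and> t < s \<and> s \<le> \<rho> \<longrightarrow>
    \<bar>s powr (- (real DIM('a) + k)) * kernel_int a b u h x s - t powr (- (real DIM('a) + k)) * kernel_int a b u h x t\<bar>
      \<le> C / (\<mu> - k) * (s powr (\<mu> - k) - t powr (\<mu> - k))"
proof -
  obtain C where C: "\<And>x s. x \<in> S \<Longrightarrow> 0 < s \<Longrightarrow> s \<le> \<rho> \<Longrightarrow> \<bar>kernel_int a b u (lap f) x s\<bar> \<le> C * s powr (real DIM('a) + \<mu>)"
    using decay f unfolding lap_decay_def by blast
  have C': "\<bar>kernel_int a b u (lap f) x s\<bar> \<le> \<bar>C\<bar> * s powr (real DIM('a) + \<mu>)" if "x \<in> S" "0 < s" "s \<le> \<rho>" for x s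
    using C[OF that] by (meson abs_ge_self mult_right_mono order_trans powr_ge_zero)
  have lf: "lap f = (\<lambda>z. (real DIM('a) + k) * h z + euler h z)" using eq by (rule ext)
  have sh: "smooth h" using h unit_test_smooth by blast
  have "\<bar>s powr (- (real DIM('a) + k)) * kernel_int a b u h x s - t powr (- (real DIM('a) + k)) * kernel_int a b u h x t\<bar>
      \<le> \<bar>C\<bar> / (\<mu> - k) * (s powr (\<mu> - k) - t powr (\<mu> - k))" if x: "x \<in> S" and t: "0 < t" "t < s" "s \<le> \<rho>" for x s t
  proof -
    let ?g = "\<lambda>r. r powr (- (real DIM('a) + k)) * kernel_int a b u h x r"
    let ?\<phi> = "\<lambda>r. \<bar>C\<bar> / (\<mu> - k) * r powr (\<mu> - k)"
    have d1: "(?g has_vector_derivative - (r powr (- (real DIM('a) + k) - 1) * kernel_int a b u (lap f) x r)) (at r)" if "0 < r" for r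
      using kernel_int_powr_derivative[OF u sh that, of "real DIM('a) + k" x] lf
      by (simp add: has_real_derivative_iff_has_vector_derivative)
    have d2: "(?\<phi> has_vector_derivative \<bar>C\<bar> * r powr (\<mu> - k - 1)) (at r)" if "0 < r" for r
    proof -
      have "(?\<phi> has_real_derivative \<bar>C\<bar> / (\<mu> - k) * ((\<mu> - k) * r powr (\<mu> - k - 1))) (at r)"
        by (intro DERIV_cmult has_real_derivative_powr that)
      then show ?thesis using k by (simp add: has_real_derivative_iff_has_vector_derivative)
    qed
    have "norm (?g s - ?g t) \<le> ?\<phi> s - ?\<phi> t"
    proof (rule differentiable_bound_general[OF t(2)])
      show "continuous_on {t..s} ?g"
        by (intro continuous_at_imp_continuous_on ballI has_vector_derivative_continuous[OF d1]) (use t in auto)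
      show "continuous_on {t..s} ?\<phi>"
        by (intro continuous_at_imp_continuous_on ballI has_vector_derivative_continuous[OF d2]) (use t in auto)
      fix r assume r: "t < r" "r < s"
      show "(?g has_vector_derivative - (r powr (- (real DIM('a) + k) - 1) * kernel_int a b u (lap f) x r)) (at r)"
        "(?\<phi> has_vector_derivative \<bar>C\<bar> * r powr (\<mu> - k - 1)) (at r)" using d1 d2 r t by auto
      have "norm (- (r powr (- (real DIM('a) + k) - 1) * kernel_int a b u (lap f) x r)) = r powr (- (real DIM('a) + k) - 1) * \<bar>kernel_int a b u (lap f) x r\<bar>"
        by (simp add: abs_mult)
      also have "\<dots> \<le> r powr (- (real DIM('a) + k) - 1) * (\<bar>C\<bar> * r powr (real DIM('a) + \<mu>))"
        using r t x by (intro mult_left_mono C') auto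
      also have "\<dots> = \<bar>C\<bar> * (r powr (- (real DIM('a) + k) - 1) * r powr (real DIM('a) + \<mu>))" by simp
      also have "r powr (- (real DIM('a) + k) - 1) * r powr (real DIM('a) + \<mu>) = r powr (\<mu> - k - 1)"
        unfolding powr_add[symmetric] by (rule arg_cong[where f="\<lambda>q. r powr q"]) simp
      finally show "norm (- (r powr (- (real DIM('a) + k) - 1) * kernel_int a b u (lap f) x r)) \<le> \<bar>C\<bar> * r powr (\<mu> - k - 1)" .
    qed
    then show ?thesis by (simp add: right_diff_distrib)
  qed
  then show ?thesis by (intro exI[of _ "\<bar>C\<bar>"]) auto
qed

text \<open>More derivatives than the decay pays for: integrate the increments from \<open>s\<close>
  up to \<open>\<rho>\<close>. They are dominated by the small end, which allows a blow-up of order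
  s^(mu-k). The bounded value at \<open>\<rho>\<close> is absorbed, since s^(mu-k) is decreasing in
  s.\<close>

lemma scaled_growth:
  assumes f: "unit_test f" and h: "unit_test h"
    and eq: "\<And>z. lap f z = (real DIM('a) + k) * h z + euler h z" and k: "\<mu> < k"
  shows "\<exists>C\<ge>0. \<forall>x\<in>S. \<forall>s. 0 < s \<and> s \<le> \<rho> \<longrightarrow>
    \<bar>s powr (- (real DIM('a) + k)) * kernel_int a b u h x s\<bar> \<le> C * s powr (\<mu> - k)"
proof -
  obtain C where C: "C \<ge> 0" "\<And>x s t. x \<in> S \<Longrightarrow> 0 < t \<Longrightarrow> t < s \<Longrightarrow> s \<le> \<rho> \<Longrightarrow>
    \<bar>s powr (- (real DIM('a) + k)) * kernel_int a b u h x s - t powr (- (real DIM('a) + k)) * kernel_int a b u h x t\<bar>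
      \<le> C / (\<mu> - k) * (s powr (\<mu> - k) - t powr (\<mu> - k))"
    using scaled_increment[OF f h eq] k by blast
  obtain B where B: "B \<ge> 0" "\<And>x s. \<bar>kernel_int a b u h x s\<bar> \<le> B" using kernel_int_bounded[OF h] by blast
  define D where "D = \<rho> powr (- (real DIM('a) + k)) * B"
  define E where "E = D / \<rho> powr (\<mu> - k) + C / (k - \<mu>)"
  have "\<bar>s powr (- (real DIM('a) + k)) * kernel_int a b u h x s\<bar> \<le> E * s powr (\<mu> - k)" if x: "x \<in> S" and s: "0 < s" "s \<le> \<rho>" for x s
  proof -
    have D: "\<bar>\<rho> powr (- (real DIM('a) + k)) * kernel_int a b u h x \<rho>\<bar> \<le> D"
      unfolding D_def abs_mult using B by (intro mult_mono) auto
    have D': "D \<le> D / \<rho> powr (\<mu> - k) * s powr (\<mu> - k)"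
    proof -
      have "\<rho> powr (\<mu> - k) \<le> s powr (\<mu> - k)" using s k by (intro powr_mono2') auto
      then have "1 \<le> s powr (\<mu> - k) / \<rho> powr (\<mu> - k)" using \<rho> by simp
      moreover have "D \<ge> 0" using B(1) by (simp add: D_def)
      ultimately have "D * 1 \<le> D * (s powr (\<mu> - k) / \<rho> powr (\<mu> - k))" by (intro mult_left_mono)
      then show ?thesis by simp
    qed
    show ?thesis
    proof (cases "s = \<rho>")
      case True
      have "0 \<le> C / (k - \<mu>) * s powr (\<mu> - k)" using C(1) k by simp
      then show ?thesis using D D' unfolding True E_def distrib_right by linarith
    next
      case False
      then have "s < \<rho>" using s by simp
      have "C / (\<mu> - k) = - (C / (k - \<mu>))" by (metis divide_minus_right minus_diff_eq)
      then have "C / (\<mu> - k) * (\<rho> powr (\<mu> - k) - s powr (\<mu> - k))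
          = C / (k - \<mu>) * s powr (\<mu> - k) - C / (k - \<mu>) * \<rho> powr (\<mu> - k)"
        by (simp add: right_diff_distrib)
      moreover have "0 \<le> C / (k - \<mu>) * \<rho> powr (\<mu> - k)" using C(1) k by simp
      ultimately have "\<bar>s powr (- (real DIM('a) + k)) * kernel_int a b u h x s\<bar> \<le> D + C / (k - \<mu>) * s powr (\<mu> - k)"
        using C(2)[OF x s(1) \<open>s < \<rho>\<close>] D by linarith
      then show ?thesis using D' unfolding E_def distrib_right by linarith
    qed
  qed
  moreover have "E \<ge> 0" unfolding E_def D_def using B(1) C(1) k by simp
  ultimately show ?thesis by blast
qed

text \<open>Fewer derivatives than the decay pays for: the increments are integrable down to scale
  0, so the scaled integrals are Cauchy and converge with rate s^(mu-k).\<close>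

lemma scaled_limit:
  assumes f: "unit_test f" and h: "unit_test h"
    and eq: "\<And>z. lap f z = (real DIM('a) + k) * h z + euler h z" and k: "k < \<mu>"
  shows "\<exists>C G. C \<ge> 0 \<and> (\<forall>x\<in>S. \<forall>s. 0 < s \<and> s \<le> \<rho> \<longrightarrow>
    \<bar>s powr (- (real DIM('a) + k)) * kernel_int a b u h x s - G x\<bar> \<le> C * s powr (\<mu> - k))"
proof -
  obtain C where C: "C \<ge> 0" "\<And>x s t. x \<in> S \<Longrightarrow> 0 < t \<Longrightarrow> t < s \<Longrightarrow> s \<le> \<rho> \<Longrightarrow>
    \<bar>s powr (- (real DIM('a) + k)) * kernel_int a b u h x s - t powr (- (real DIM('a) + k)) * kernel_int a b u h x t\<bar>
      \<le> C / (\<mu> - k) * (s powr (\<mu> - k) - t powr (\<mu> - k))"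
    using scaled_increment[OF f h eq] k by blast
  define E where "E = C / (\<mu> - k)"
  have E: "E \<ge> 0" using C k by (simp add: E_def)
  let ?g = "\<lambda>x s. s powr (- (real DIM('a) + k)) * kernel_int a b u h x s"
  have inc: "\<bar>?g x s - ?g x t\<bar> \<le> E * s powr (\<mu> - k)" if "x \<in> S" "0 < t" "t \<le> s" "s \<le> \<rho>" for x s t
  proof (cases "t = s")
    case True
    then show ?thesis using E by simp
  next
    case False
    have "E * (s powr (\<mu> - k) - t powr (\<mu> - k)) \<le> E * s powr (\<mu> - k)"
      using E by (intro mult_left_mono) auto
    then show ?thesis using C(2)[of x t s] that False unfolding E_def by linarith
  qed
  have "\<exists>L. \<forall>s. 0 < s \<and> s \<le> \<rho> \<longrightarrow> \<bar>?g x s - L\<bar> \<le> E * s powr (\<mu> - k)" if x: "x \<in> S" for x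
  proof -
    \<comment> \<open>Any null sequence of admissible scales serves; the limit is then compared with
      every \<open>s\<close> by letting \<open>j\<close> tend to infinity in
      \<open>inc\<close>.\<close>
    define t where "t = (\<lambda>j. \<rho> / real (Suc j))"
    have t: "0 < t j" "t j \<le> \<rho>" for j
      using \<rho> by (auto simp: t_def field_simps)
    have t0: "t \<longlonglongrightarrow> 0"
      unfolding t_def using LIMSEQ_inverse_real_of_nat tendsto_mult_right_zero
      by (metis (no_types, lifting) divide_inverse tendsto_mult_right_zero ext)
    have p0: "(\<lambda>j. E * t j powr (\<mu> - k)) \<longlonglongrightarrow> 0"
      using tendsto_mult_right_zero[OF tendsto_zero_powrI[OF t0 tendsto_const, of "\<mu> - k"]] k t
      by (simp add: less_imp_le)
    have mono: "t j \<le> t i" if "i \<le> j" for i j using that \<rho> by (auto simp: t_def field_simps)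
    have "Cauchy (\<lambda>j. ?g x (t j))"
    proof (rule metric_CauchyI)
      fix e :: real assume "e > 0"
      then obtain N where N: "\<And>j. j \<ge> N \<Longrightarrow> \<bar>E * t j powr (\<mu> - k)\<bar> < e / 2"
        using LIMSEQ_D[OF p0, of "e/2"] by auto
      have "dist (?g x (t i)) (?g x (t j)) < e" if "i \<ge> N" "j \<ge> N" for i j
        using inc[OF x t(1) mono[OF that(1)] t(2)] inc[OF x t(1) mono[OF that(2)] t(2)] N[of N]
        unfolding dist_real_def by (simp add: abs_real_def split: if_splits)
      then show "\<exists>N. \<forall>i\<ge>N. \<forall>j\<ge>N. dist (?g x (t i)) (?g x (t j)) < e" by blast
    qed
    then obtain L where L: "(\<lambda>j. ?g x (t j)) \<longlonglongrightarrow> L" using Cauchy_convergent convergent_def by blast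
    have "\<bar>?g x s - L\<bar> \<le> E * s powr (\<mu> - k)" if s: "0 < s" "s \<le> \<rho>" for s
    proof (rule tendsto_upperbound)
      show "(\<lambda>j. \<bar>?g x s - ?g x (t j)\<bar>) \<longlonglongrightarrow> \<bar>?g x s - L\<bar>"
        by (intro tendsto_intros L)
      have "\<forall>\<^sub>F j in sequentially. t j < s" using order_tendstoD(2)[OF t0 s(1)] .
      then show "\<forall>\<^sub>F j in sequentially. \<bar>?g x s - ?g x (t j)\<bar> \<le> E * s powr (\<mu> - k)"
        by eventually_elim (use inc[OF x t(1)] s in auto)
    qed auto
    then show ?thesis by blast
  qed
  then obtain G where "\<And>x s. x \<in> S \<Longrightarrow> 0 < s \<and> s \<le> \<rho> \<Longrightarrow> \<bar>?g x s - G x\<bar> \<le> E * s powr (\<mu> - k)"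
    by metis
  then show ?thesis using E by (intro exI[of _ E] exI[of _ G]) auto
qed

text \<open>The case k = 0 of \<open>scaled_limit\<close>. The limit must be \<open>u x\<close>,
  because mollifications of a continuous function converge to it; what is gained is the
  rate.\<close>

lemma mollifier_approx:
  assumes \<mu>: "0 < \<mu>" and \<psi>: "unit_test \<psi>" and \<eta>: "unit_test \<eta>" "\<And>z. \<eta> z \<ge> 0" "integral UNIV \<eta> = 1"
    and eq: "\<And>z. lap \<psi> z = real DIM('a) * \<eta> z + euler \<eta> z"
  shows "\<exists>C\<ge>0. \<forall>x\<in>S. \<forall>s. 0 < s \<and> s \<le> \<rho> \<longrightarrow>
    \<bar>s powr (- real DIM('a)) * kernel_int a b u \<eta> x s - u x\<bar> \<le> C * s powr \<mu>"
proof -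
  have eq0: "\<And>z. lap \<psi> z = (real DIM('a) + 0) * \<eta> z + euler \<eta> z" using eq by simp
  obtain C G where C: "C \<ge> 0" "\<And>x s. x \<in> S \<Longrightarrow> 0 < s \<Longrightarrow> s \<le> \<rho> \<Longrightarrow>
     \<bar>s powr (- real DIM('a)) * kernel_int a b u \<eta> x s - G x\<bar> \<le> C * s powr \<mu>"
    using scaled_limit[OF \<psi> \<eta>(1) eq0 \<mu>] by auto
  have "G x = u x" if x: "x \<in> S" for x
  proof (rule ccontr)
    assume "G x \<noteq> u x"
    define e where "e = \<bar>G x - u x\<bar> / 3"
    have e: "e > 0" using \<open>G x \<noteq> u x\<close> by (simp add: e_def)
    have xin: "x \<in> cbox a b" using sub[OF x] \<rho> by (meson centre_in_cball less_imp_le subsetD)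
    obtain d where d: "d > 0" "\<And>y. y \<in> cbox a b \<Longrightarrow> dist y x < d \<Longrightarrow> dist (u y) (u x) < e"
      using u xin e unfolding continuous_on_iff by metis
    have "((\<lambda>s. C * s powr \<mu>) \<longlongrightarrow> C * 0) (at_right 0)"
      using \<mu> by (intro tendsto_mult tendsto_const tendsto_zero_powrI[where b=\<mu>])
        (auto simp: eventually_at_filter intro!: tendsto_intros)
    then have "\<forall>\<^sub>F s in at_right 0. C * s powr \<mu> < e"
      using order_tendstoD(2) e by fastforce
    moreover have "\<forall>\<^sub>F s in at_right 0. s < min d \<rho>"
      using d \<rho> by (intro order_tendstoD(2)[OF tendsto_ident_at]) auto
    moreover have "\<forall>\<^sub>F s in at_right (0::real). 0 < s" by (simp add: eventually_at_filter)
    ultimately have "\<forall>\<^sub>F s in at_right 0. C * s powr \<mu> < e \<and> s < min d \<rho> \<and> 0 < s"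
      by eventually_elim auto
    then have "\<exists>s. C * s powr \<mu> < e \<and> s < min d \<rho> \<and> 0 < s"
      by (rule eventually_happens'[rotated]) simp
    then obtain s where s: "C * s powr \<mu> < e" "s < d" "s \<le> \<rho>" "0 < s"
      by auto
    have "\<bar>(1 / s ^ DIM('a)) * kernel_int a b u \<eta> x s - u x\<bar> \<le> e"
    proof (rule mollifier_close[OF u \<eta> s(4)])
      show "cball x s \<subseteq> cbox a b" using sub[OF x] s by (meson order_trans subset_cball)
      then show "\<bar>u y - u x\<bar> \<le> e" if "y \<in> cball x s" for y
        using d(2)[of y] that s unfolding dist_real_def by (force simp: dist_commute)
    qed
    moreover have "1 / s ^ DIM('a) = s powr (- real DIM('a))"
      using s by (simp add: powr_minus powr_realpow divide_inverse)
    ultimately have "\<bar>s powr (- real DIM('a)) * kernel_int a b u \<eta> x s - u x\<bar> \<le> e" by simp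
    moreover have "\<bar>s powr (- real DIM('a)) * kernel_int a b u \<eta> x s - G x\<bar> < e"
      using C(2)[OF x s(4,3)] s(1) by linarith
    ultimately show False unfolding e_def using e by (simp add: e_def abs_real_def split: if_splits)
  qed
  with C show ?thesis by (intro exI[of _ C]) auto
qed

text \<open>One derivative in \<open>x\<close> raises the normalising power by exactly one, in step
  with \<open>lap_pd_step\<close>.\<close>

lemma pd_scaled_kernel_int:
  assumes "smooth h" "i \<in> Basis" "s > 0"
  shows "pd i (\<lambda>x. s powr (- k) * kernel_int a b u h x s) x = - (s powr (- (k + 1)) * kernel_int a b u (pd i h) x s)"
proof -
  have "pd i (\<lambda>x. s powr (- k) * kernel_int a b u h x s) x = s powr (- k) * pd i (\<lambda>x. kernel_int a b u h x s) x"
    by (rule pd_cmult) (rule smooth_differentiable[OF smooth_kernel_int[OF u assms(1)]])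
  then show ?thesis
    using assms by (simp add: pd_kernel_int[OF u] powr_diff)
qed

text \<open>Compare \<open>u\<close> with its mollification at the scale of the distance: the
  approximation error is s^mu at both points, and the mollified function has slope at most s^(mu-1)
  by \<open>scaled_growth\<close> with k = 1.\<close>

lemma lap_decay_Holder:
  assumes \<mu>: "0 < \<mu>" "\<mu> < 1" and S: "convex S"
  shows "\<exists>C. \<forall>x\<in>S. \<forall>y\<in>S. dist x y \<le> \<rho> \<longrightarrow> \<bar>u x - u y\<bar> \<le> C * dist x y powr \<mu>"
proof -
  obtain \<psi> \<eta> :: "'a \<Rightarrow> real" where \<psi>: "unit_test \<psi>" and \<eta>: "unit_test \<eta>" "\<And>z. \<eta> z \<ge> 0" "integral UNIV \<eta> = 1"
    and eq: "\<And>z. lap \<psi> z = real DIM('a) * \<eta> z + euler \<eta> z"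
    using radial_mollifier by metis
  have sm: "smooth \<eta>" "smooth \<psi>" using \<eta>(1) \<psi> unit_test_smooth by blast+
  obtain C where C: "C \<ge> 0" "\<And>x s. x \<in> S \<Longrightarrow> 0 < s \<Longrightarrow> s \<le> \<rho> \<Longrightarrow>
    \<bar>s powr (- real DIM('a)) * kernel_int a b u \<eta> x s - u x\<bar> \<le> C * s powr \<mu>"
    using mollifier_approx[OF \<mu>(1) \<psi> \<eta> eq] by blast
  have "\<forall>i\<in>Basis. \<exists>D. D \<ge> 0 \<and> (\<forall>x\<in>S. \<forall>s. 0 < s \<and> s \<le> \<rho> \<longrightarrow>
    \<bar>s powr (- (real DIM('a) + 1)) * kernel_int a b u (pd i \<eta>) x s\<bar> \<le> D * s powr (\<mu> - 1))"
  proof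
    fix i :: 'a assume i: "i \<in> Basis"
    show "\<exists>D. D \<ge> 0 \<and> (\<forall>x\<in>S. \<forall>s. 0 < s \<and> s \<le> \<rho> \<longrightarrow>
        \<bar>s powr (- (real DIM('a) + 1)) * kernel_int a b u (pd i \<eta>) x s\<bar> \<le> D * s powr (\<mu> - 1))"
      by (rule scaled_growth[OF unit_test_pd[OF \<psi> i] unit_test_pd[OF \<eta>(1) i] lap_pd_step[OF sm(2,1) i eq] \<mu>(2)])
  qed
  then obtain D where D: "\<And>i. i \<in> Basis \<Longrightarrow> D i \<ge> 0" "\<And>i x s. i \<in> Basis \<Longrightarrow> x \<in> S \<Longrightarrow> 0 < s \<Longrightarrow> s \<le> \<rho> \<Longrightarrow>
    \<bar>s powr (- (real DIM('a) + 1)) * kernel_int a b u (pd i \<eta>) x s\<bar> \<le> D i * s powr (\<mu> - 1)"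
    by metis
  define E where "E = (\<Sum>i\<in>Basis. D i)"
  have DE: "D i \<le> E" if "i \<in> Basis" for i
    unfolding E_def using that D(1) by (intro member_le_sum) auto
  have "\<bar>u x - u y\<bar> \<le> (2 * C + real DIM('a) * E) * dist x y powr \<mu>"
    if xy: "x \<in> S" "y \<in> S" "dist x y \<le> \<rho>" for x y
  proof (cases "x = y")
    case False
    \<comment> \<open>The scale at which the approximation error and slope times distance have the
      same order.\<close>
    define s where "s = dist x y"
    have s: "0 < s" "s \<le> \<rho>" using False xy by (auto simp: s_def)
    let ?m = "\<lambda>x. s powr (- real DIM('a)) * kernel_int a b u \<eta> x s"
    have "\<bar>?m x - ?m y\<bar> \<le> real DIM('a) * (E * s powr (\<mu> - 1)) * dist x y"
    proof (rule smooth_lipschitz[OF smooth_cmult[OF smooth_kernel_int[OF u sm(1)]] S xy(1,2)])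
      fix i z assume iz: "i \<in> (Basis::'a set)" "z \<in> S"
      have "\<bar>pd i ?m z\<bar> \<le> D i * s powr (\<mu> - 1)"
        using D(2)[OF iz s] by (simp add: pd_scaled_kernel_int[OF sm(1) iz(1) s(1)])
      also have "\<dots> \<le> E * s powr (\<mu> - 1)" using DE[OF iz(1)] by (simp add: mult_right_mono)
      finally show "\<bar>pd i ?m z\<bar> \<le> E * s powr (\<mu> - 1)" .
    qed
    also have "\<dots> = real DIM('a) * E * s powr \<mu>"
      using s(1) unfolding s_def[symmetric] by (simp add: powr_diff)
    finally have "\<bar>?m x - ?m y\<bar> \<le> real DIM('a) * E * s powr \<mu>" .
    then show ?thesis
      using C(2)[OF xy(1) s] C(2)[OF xy(2) s] unfolding s_def[symmetric] distrib_right by linarith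
  qed simp
  then show ?thesis by blast
qed

text \<open>The same interpolation one derivative higher: first derivatives of the mollifications
  converge with rate s^(mu-1) (k = 1 lies below \<open>\<mu>\<close>), second derivatives grow at
  most like s^(mu-2) (k = 2 lies above it). A first-order Taylor estimate then identifies the limit
  as the gradient of \<open>u\<close>.\<close>

lemma lap_decay_C1_Holder:
  assumes \<mu>: "1 < \<mu>" "\<mu> < 2" and S: "convex S" "open S"
  shows "\<exists>G C. (\<forall>x\<in>S. GDERIV u x :> G x) \<and>
    (\<forall>x\<in>S. \<forall>y\<in>S. dist x y \<le> \<rho> \<longrightarrow> norm (G x - G y) \<le> C * dist x y powr (\<mu> - 1))"
proof -
  obtain \<psi> \<eta> :: "'a \<Rightarrow> real" where \<psi>: "unit_test \<psi>" and \<eta>: "unit_test \<eta>" "\<And>z. \<eta> z \<ge> 0" "integral UNIV \<eta> = 1"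
    and eq: "\<And>z. lap \<psi> z = real DIM('a) * \<eta> z + euler \<eta> z"
    using radial_mollifier by metis
  have sm: "smooth \<eta>" "smooth \<psi>" using \<eta>(1) \<psi> unit_test_smooth by blast+
  have eq1: "\<And>z. lap (pd i \<psi>) z = (real DIM('a) + 1) * pd i \<eta> z + euler (pd i \<eta>) z" if "i \<in> Basis" for i
    using lap_pd_step[OF sm(2,1) that eq] .
  have eq2: "\<And>z. lap (pd j (pd i \<psi>)) z = (real DIM('a) + 2) * pd j (pd i \<eta>) z + euler (pd j (pd i \<eta>)) z"
    if "i \<in> Basis" "j \<in> Basis" for i j
    using lap_pd_step[OF smooth_pd[OF sm(2) that(1)] smooth_pd[OF sm(1) that(1)] that(2) eq1[OF that(1)]] by simp
  let ?n = "real DIM('a)"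
  let ?D = "\<lambda>i s x. s powr (- (?n + 1)) * kernel_int a b u (pd i \<eta>) x s"
  let ?m = "\<lambda>s x. s powr (- ?n) * kernel_int a b u \<eta> x s"
  have "0 < \<mu>" using \<mu> by simp
  obtain C0 where C0: "C0 \<ge> 0" "\<And>x s. x \<in> S \<Longrightarrow> 0 < s \<Longrightarrow> s \<le> \<rho> \<Longrightarrow>
    \<bar>?m s x - u x\<bar> \<le> C0 * s powr \<mu>"
    using mollifier_approx[OF \<open>0 < \<mu>\<close> \<psi> \<eta> eq] by blast
  have "\<forall>i\<in>Basis. \<exists>C G. C \<ge> 0 \<and> (\<forall>x\<in>S. \<forall>s. 0 < s \<and> s \<le> \<rho> \<longrightarrow>
    \<bar>?D i s x - G x\<bar> \<le> C * s powr (\<mu> - 1))"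
    using scaled_limit[OF unit_test_pd[OF \<psi>] unit_test_pd[OF \<eta>(1)] eq1 \<mu>(1)] by blast
  then obtain C1 g where C1: "\<And>i. i \<in> Basis \<Longrightarrow> C1 i \<ge> 0" "\<And>i x s. i \<in> Basis \<Longrightarrow> x \<in> S \<Longrightarrow> 0 < s \<Longrightarrow> s \<le> \<rho> \<Longrightarrow>
    \<bar>?D i s x - g i x\<bar> \<le> C1 i * s powr (\<mu> - 1)"
    by metis
  have "\<forall>i\<in>Basis. \<forall>j\<in>Basis. \<exists>C. C \<ge> 0 \<and> (\<forall>x\<in>S. \<forall>s. 0 < s \<and> s \<le> \<rho> \<longrightarrow>
    \<bar>s powr (- (?n + 2)) * kernel_int a b u (pd j (pd i \<eta>)) x s\<bar> \<le> C * s powr (\<mu> - 2))"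
    using scaled_growth[OF unit_test_pd[OF unit_test_pd[OF \<psi>]] unit_test_pd[OF unit_test_pd[OF \<eta>(1)]] eq2 \<mu>(2)]
    by blast
  then obtain C2 where C2: "\<And>i j. i \<in> Basis \<Longrightarrow> j \<in> Basis \<Longrightarrow> C2 i j \<ge> 0"
    "\<And>i j x s. i \<in> Basis \<Longrightarrow> j \<in> Basis \<Longrightarrow> x \<in> S \<Longrightarrow> 0 < s \<Longrightarrow> s \<le> \<rho> \<Longrightarrow>
    \<bar>s powr (- (?n + 2)) * kernel_int a b u (pd j (pd i \<eta>)) x s\<bar> \<le> C2 i j * s powr (\<mu> - 2)"
    by metis
  define E where "E = (\<lambda>i. 2 * C1 i + ?n * (\<Sum>j\<in>Basis. C2 i j))"
  have gH: "\<bar>g i x - g i y\<bar> \<le> E i * dist x y powr (\<mu> - 1)"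
    if i: "i \<in> Basis" and xy: "x \<in> S" "y \<in> S" "dist x y \<le> \<rho>" for i x y
  proof (cases "x = y")
    case False
    define s where "s = dist x y"
    have s: "0 < s" "s \<le> \<rho>" using False xy by (auto simp: s_def)
    let ?B = "(\<Sum>j\<in>Basis. C2 i j)"
    have "\<bar>?D i s x - ?D i s y\<bar> \<le> ?n * (?B * s powr (\<mu> - 2)) * dist x y"
    proof (rule smooth_lipschitz[OF smooth_cmult[OF smooth_kernel_int[OF u smooth_pd[OF sm(1) i]]] S(1) xy(1,2)])
      fix j z assume jz: "j \<in> (Basis::'a set)" "z \<in> S"
      have "?n + 1 + 1 = ?n + 2" by simp
      then have "pd j (?D i s) z = - (s powr (- (?n + 2)) * kernel_int a b u (pd j (pd i \<eta>)) z s)"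
        using pd_scaled_kernel_int[OF smooth_pd[OF sm(1) i] jz(1) s(1), of "?n + 1" z] by (simp only:)
      then have "\<bar>pd j (?D i s) z\<bar> \<le> C2 i j * s powr (\<mu> - 2)"
        using C2(2)[OF i jz s] by (simp only: abs_minus)
      also have "\<dots> \<le> ?B * s powr (\<mu> - 2)"
        using C2(1)[OF i] jz(1) by (intro mult_right_mono member_le_sum) auto
      finally show "\<bar>pd j (?D i s) z\<bar> \<le> ?B * s powr (\<mu> - 2)" .
    qed
    also have "\<dots> = ?n * ?B * (s powr (\<mu> - 2) * s powr 1)"
      using s(1) unfolding s_def[symmetric] by simp
    also have "s powr (\<mu> - 2) * s powr 1 = s powr (\<mu> - 1)" by (simp only: powr_add[symmetric]) simp
    finally have "\<bar>?D i s x - ?D i s y\<bar> \<le> ?n * ?B * s powr (\<mu> - 1)" .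
    then show ?thesis
      using C1(2)[OF i xy(1) s] C1(2)[OF i xy(2) s] unfolding E_def s_def[symmetric] distrib_right by linarith
  qed simp
  \<comment> \<open>The minus sign is that of \<open>pd_scaled_kernel_int\<close>:
    \<open>g i\<close> is the limit of the negative of a partial derivative.\<close>
  define G where "G = (\<lambda>x. \<Sum>i\<in>Basis. (- g i x) *\<^sub>R i)"
  define EE where "EE = (\<Sum>i\<in>(Basis::'a set). E i)"
  define CC where "CC = (\<Sum>i\<in>(Basis::'a set). C1 i)"
  have CC: "CC \<ge> 0" unfolding CC_def using C1(1) by (simp add: sum_nonneg)
  have EE: "EE \<ge> 0" unfolding EE_def E_def using C1(1) C2(1)
    by (intro sum_nonneg add_nonneg_nonneg mult_nonneg_nonneg) auto
  have GH: "norm (G x - G y) \<le> EE * dist x y powr (\<mu> - 1)"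
    if xy: "x \<in> S" "y \<in> S" "dist x y \<le> \<rho>" for x y
  proof -
    have "G x - G y = (\<Sum>i\<in>Basis. (g i y - g i x) *\<^sub>R i)"
      unfolding G_def sum_subtractf[symmetric] by (intro sum.cong) (auto simp: algebra_simps)
    also have "norm \<dots> \<le> (\<Sum>i\<in>(Basis::'a set). E i * dist x y powr (\<mu> - 1))"
      by (rule sum_norm_le) (use gH[OF _ xy] in \<open>simp add: abs_minus_commute\<close>)
    finally show ?thesis by (simp add: EE_def sum_distrib_right)
  qed
  have gradm: "norm (grad (?m s) z - G z) \<le> CC * s powr (\<mu> - 1)" if z: "z \<in> S" and s: "0 < s" "s \<le> \<rho>" for z s
  proof -
    have "grad (?m s) z = (\<Sum>i\<in>Basis. (- ?D i s z) *\<^sub>R i)"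
      unfolding grad_pd by (intro sum.cong) (simp_all add: pd_scaled_kernel_int[OF sm(1) _ s(1)])
    then have "grad (?m s) z - G z = (\<Sum>i\<in>Basis. (g i z - ?D i s z) *\<^sub>R i)"
      unfolding G_def by (simp only: sum_subtractf[symmetric] scaleR_diff_left[symmetric]) simp
    also have "norm \<dots> \<le> (\<Sum>i\<in>(Basis::'a set). C1 i * s powr (\<mu> - 1))"
      by (rule sum_norm_le) (use C1(2)[OF _ z s] in \<open>simp add: abs_minus_commute\<close>)
    finally show ?thesis by (simp add: CC_def sum_distrib_right)
  qed
  define K where "K = 2 * C0 + CC + EE + 1"
  have K: "K > 0" unfolding K_def using C0 CC EE by linarith
  \<comment> \<open>Replace \<open>u\<close> by its mollification at scale |y - x|, apply the mean
    value theorem to it at some z on the segment, and pass from its gradient at z to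
    \<open>G z\<close> and then to \<open>G x\<close>; each exchange costs s^mu.\<close>
  have taylor: "\<bar>u y - u x - G x \<bullet> (y - x)\<bar> \<le> K * dist y x powr \<mu>"
    if xy: "x \<in> S" "y \<in> S" "dist y x \<le> \<rho>" for x y
  proof (cases "x = y")
    case False
    define s where "s = dist y x"
    have s: "0 < s" "s \<le> \<rho>" using False xy by (auto simp: s_def)
    obtain z where z: "z \<in> S" "dist z x \<le> dist y x" "?m s y - ?m s x = grad (?m s) z \<bullet> (y - x)"
      using smooth_mean_value[OF smooth_cmult[OF smooth_kernel_int[OF u sm(1)]] S(1) xy(1,2)] by metis
    have "norm (G z - G x) \<le> EE * dist z x powr (\<mu> - 1)" using GH[OF z(1) xy(1)] z(2) xy(3) by simp
    also have "\<dots> \<le> EE * s powr (\<mu> - 1)"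
      using z(2) \<mu> EE unfolding s_def by (intro mult_left_mono powr_mono2) auto
    finally have "norm (grad (?m s) z - G x) \<le> (CC + EE) * s powr (\<mu> - 1)"
      using gradm[OF z(1) s] norm_triangle_ineq[of "grad (?m s) z - G z" "G z - G x"] by (simp add: distrib_right)
    then have "norm (grad (?m s) z - G x) * norm (y - x) \<le> (CC + EE) * s powr (\<mu> - 1) * s"
      unfolding s_def dist_norm by (intro mult_right_mono) auto
    then have "\<bar>(grad (?m s) z - G x) \<bullet> (y - x)\<bar> \<le> (CC + EE) * s powr (\<mu> - 1) * s"
      using Cauchy_Schwarz_ineq2[of "grad (?m s) z - G x" "y - x"] by linarith
    also have "\<dots> = (CC + EE) * s powr \<mu>" using s by (simp add: powr_diff)
    finally have "\<bar>?m s y - ?m s x - G x \<bullet> (y - x)\<bar> \<le> (CC + EE) * s powr \<mu>"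
      unfolding z(3) inner_diff_left .
    moreover have "0 \<le> s powr \<mu>" by simp
    ultimately show ?thesis
      using C0(2)[OF xy(1) s] C0(2)[OF xy(2) s] unfolding K_def s_def[symmetric] distrib_right by linarith
  qed simp
  have "GDERIV u x :> G x" if x: "x \<in> S" for x
    unfolding gderiv_def has_derivative_at_alt
  proof (intro conjI allI impI)
    show "bounded_linear (\<lambda>h. h \<bullet> G x)" by (rule bounded_linear_inner_left)
    fix e :: real assume e: "e > 0"
    obtain r where r: "r > 0" "ball x r \<subseteq> S" using S(2) x open_contains_ball by blast
    \<comment> \<open>Below the last radius, K times the distance to the power mu - 1 is at most
      \<open>e\<close>, so the Taylor remainder is at most \<open>e\<close> times the
      distance.\<close>
    define d where "d = min (min r \<rho>) ((e / K) powr (1 / (\<mu> - 1)))"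
    have d: "d > 0" using r \<rho> e K by (simp add: d_def)
    have "norm (u y - u x - (y - x) \<bullet> G x) \<le> e * norm (y - x)" if y: "norm (y - x) < d" for y
    proof -
      have yS: "y \<in> S" "dist y x \<le> \<rho>" using y r(2) by (auto simp: d_def dist_norm norm_minus_commute subset_iff)
      have "dist y x powr (\<mu> - 1) \<le> ((e / K) powr (1 / (\<mu> - 1))) powr (\<mu> - 1)"
        using y \<mu> by (intro powr_mono2) (auto simp: d_def dist_norm)
      also have "\<dots> = e / K" using \<mu> e K by (simp add: powr_powr)
      finally have "K * dist y x powr (\<mu> - 1) * dist y x \<le> e * dist y x"
        using K by (intro mult_right_mono) (auto simp: field_simps)
      moreover have "dist y x powr (\<mu> - 1) * dist y x = dist y x powr \<mu>"
        by (cases "y = x") (auto simp: powr_diff)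
      ultimately show ?thesis using taylor[OF x yS] by (simp add: dist_norm inner_commute mult.assoc)
    qed
    then show "\<exists>d>0. \<forall>y. norm (y - x) < d \<longrightarrow> norm (u y - u x - (y - x) \<bullet> G x) \<le> e * norm (y - x)"
      using d by blast
  qed
  with GH show ?thesis by blast
qed

end

section \<open>Calculus of weak gradients\<close>

lemma continuous_lebesgue_measurable:
  fixes f :: "'a::euclidean_space \<Rightarrow> 'b::euclidean_space"
  shows "continuous_on UNIV f \<Longrightarrow> f \<in> borel_measurable lebesgue"
  by (intro measurable_completion) (simp add: borel_measurable_continuous_onI)

lemma continuous_compact_support_bounded:
  fixes f :: "'a::euclidean_space \<Rightarrow> real"
  assumes "continuous_on K f" "compact K"
  obtains B where "B > 0" "\<And>x. x \<in> K \<Longrightarrow> \<bar>f x\<bar> \<le> B"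
proof -
  have "compact (f ` K)" using assms by (rule compact_continuous_image)
  then obtain B where "B > 0" "\<And>y. y \<in> f ` K \<Longrightarrow> norm y \<le> B"
    using bounded_pos compact_imp_bounded by metis
  then show ?thesis using that by auto
qed

lemma lebesgue_integral_eq_cbox:
  fixes h :: "'a::euclidean_space \<Rightarrow> real"
  assumes "continuous_on (cbox a b) h" "\<And>x. x \<notin> cbox a b \<Longrightarrow> h x = 0"
  shows "integrable lebesgue h" "(LINT x|lebesgue. h x) = integral (cbox a b) h"
proof -
  have h: "(\<lambda>x. indicat_real (cbox a b) x *\<^sub>R h x) = h"
    using assms(2) by (auto simp: fun_eq_iff indicator_def)
  have s: "set_integrable lebesgue (cbox a b) h"
    by (rule absolutely_integrable_continuous[OF assms(1)])
  then show "integrable lebesgue h" unfolding set_integrable_def h .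
  show "(LINT x|lebesgue. h x) = integral (cbox a b) h"
    using set_lebesgue_integral_eq_integral(2)[OF s] unfolding set_lebesgue_integral_def h .
qed

lemma L1_loc_continuous:
  fixes f :: "'a::euclidean_space \<Rightarrow> 'b::euclidean_space"
  assumes "continuous_on U f"
  shows "L1_loc U f"
  unfolding L1_loc_def
proof (intro allI impI)
  fix K assume K: "compact K \<and> K \<subseteq> U"
  then have c: "continuous_on K f" using assms continuous_on_subset by blast
  have i: "integrable lborel (\<lambda>x. indicat_real K x *\<^sub>R f x)"
    by (rule borel_integrable_compact) (use K c in auto)
  show "set_integrable lebesgue K f"
    unfolding set_integrable_def integrable_completion[OF borel_measurable_integrable[OF i]] by (rule i)
qed

lemma L1_loc_scaleR:
  fixes f :: "'a::euclidean_space \<Rightarrow> 'b::euclidean_space"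
  assumes f: "L1_loc U f" and \<eta>: "continuous_on UNIV \<eta>"
  shows "L1_loc U (\<lambda>x. \<eta> x *\<^sub>R f x)"
  unfolding L1_loc_def
proof (intro allI impI)
  fix K assume K: "compact K \<and> K \<subseteq> U"
  then have i: "integrable lebesgue (\<lambda>x. indicat_real K x *\<^sub>R f x)"
    using f unfolding L1_loc_def set_integrable_def by blast
  obtain B where B: "B > 0" "\<And>x. x \<in> K \<Longrightarrow> \<bar>\<eta> x\<bar> \<le> B"
    using continuous_compact_support_bounded[of K \<eta>] \<eta> K continuous_on_subset by blast
  show "set_integrable lebesgue K (\<lambda>x. \<eta> x *\<^sub>R f x)"
    unfolding set_integrable_def
  proof (rule Bochner_Integration.integrable_bound)
    show "integrable lebesgue (\<lambda>x. B *\<^sub>R (indicat_real K x *\<^sub>R f x))"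
      using i by (intro integrable_scaleR_right)
    have "(\<lambda>x. indicat_real K x *\<^sub>R \<eta> x *\<^sub>R f x) = (\<lambda>x. \<eta> x *\<^sub>R (indicat_real K x *\<^sub>R f x))"
      by (auto simp: indicator_def)
    then show "(\<lambda>x. indicat_real K x *\<^sub>R \<eta> x *\<^sub>R f x) \<in> borel_measurable lebesgue"
      using borel_measurable_scaleR[OF continuous_lebesgue_measurable[OF \<eta>] borel_measurable_integrable[OF i]] by simp
    show "AE x in lebesgue. norm (indicat_real K x *\<^sub>R \<eta> x *\<^sub>R f x) \<le> norm (B *\<^sub>R (indicat_real K x *\<^sub>R f x))"
      using B by (intro AE_I2) (auto simp: indicator_def intro!: mult_right_mono)
  qed
qed

lemma L1_loc_scaleR_compact:
  fixes f :: "'a::euclidean_space \<Rightarrow> 'b::euclidean_space"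
  assumes "L1_loc U f" "continuous_on UNIV \<psi>" "compact K" "K \<subseteq> U" "\<And>x. x \<notin> K \<Longrightarrow> \<psi> x = 0"
  shows "integrable lebesgue (\<lambda>x. \<psi> x *\<^sub>R f x)"
proof -
  have "(\<lambda>x. indicat_real K x *\<^sub>R \<psi> x *\<^sub>R f x) = (\<lambda>x. \<psi> x *\<^sub>R f x)"
    using assms(5) by (auto simp: fun_eq_iff indicator_def)
  then show ?thesis
    using L1_loc_scaleR[OF assms(1,2)] assms(3,4) unfolding L1_loc_def set_integrable_def by metis
qed

lemma L1_loc_add:
  "L1_loc U f \<Longrightarrow> L1_loc U g \<Longrightarrow> L1_loc U (\<lambda>x. f x + g x)"
  unfolding L1_loc_def set_integrable_def by (simp add: scaleR_add_right)

lemma L1_loc_subset: "L1_loc U f \<Longrightarrow> V \<subseteq> U \<Longrightarrow> L1_loc V f"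
  unfolding L1_loc_def by blast

lemma test_function_zero:
  assumes "test_function_on U \<phi>" and "x \<notin> closure {x. \<phi> x \<noteq> 0}"
  shows "\<phi> x = 0" "pd i \<phi> x = 0"
proof -
  show "\<phi> x = 0" using assms closure_subset[of "{x. \<phi> x \<noteq> 0}"] by blast
  show "pd i \<phi> x = 0"
    by (rule pd_zero_open[where S="- closure {x. \<phi> x \<noteq> 0}"])
      (use assms closure_subset[of "{x. \<phi> x \<noteq> 0}"] in auto)
qed

lemma test_function_integrable:
  assumes \<phi>: "test_function_on U \<phi>" and f: "L1_loc U f" and i: "i \<in> Basis"
  shows "integrable lebesgue (\<lambda>x. \<phi> x *\<^sub>R f x)" "integrable lebesgue (\<lambda>x. pd i \<phi> x *\<^sub>R f x)"
proof -
  have s: "smooth \<phi>" and K: "compact (closure {x. \<phi> x \<noteq> 0})" "closure {x. \<phi> x \<noteq> 0} \<subseteq> U"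
    using \<phi> by (auto simp: test_function_on_def)
  show "integrable lebesgue (\<lambda>x. \<phi> x *\<^sub>R f x)"
    by (rule L1_loc_scaleR_compact[OF f smooth_continuous[OF s] K]) (rule test_function_zero[OF \<phi>])
  show "integrable lebesgue (\<lambda>x. pd i \<phi> x *\<^sub>R f x)"
    by (rule L1_loc_scaleR_compact[OF f smooth_continuous[OF smooth_pd[OF s i]] K]) (rule test_function_zero[OF \<phi>])
qed

text \<open>Coordinates replace the vector-valued integrals, and the whole space replaces
  \<open>U\<close>, since test functions and their derivatives vanish outside \<open>U\<close>. All
  later integrations by parts use this form.\<close>

lemma has_weak_gradient_on_iff:
  "has_weak_gradient_on U u g \<longleftrightarrow> L1_loc U u \<and> L1_loc U g \<and>
     (\<forall>\<phi>. test_function_on U \<phi> \<longrightarrow> (\<forall>i\<in>Basis.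
        (LINT x|lebesgue. u x * pd i \<phi> x) = - (LINT x|lebesgue. \<phi> x * (g x \<bullet> i))))"
proof -
  have "(LINT x:U|lebesgue. u x *\<^sub>R grad \<phi> x) = - (LINT x:U|lebesgue. \<phi> x *\<^sub>R g x) \<longleftrightarrow>
     (\<forall>i\<in>Basis. (LINT x|lebesgue. u x * pd i \<phi> x) = - (LINT x|lebesgue. \<phi> x * (g x \<bullet> i)))"
    if u: "L1_loc U u" and g: "L1_loc U g" and \<phi>: "test_function_on U \<phi>" for \<phi>
  proof -
    have K: "closure {x. \<phi> x \<noteq> 0} \<subseteq> U" using \<phi> by (simp add: test_function_on_def)
    have z: "\<phi> x = 0" "pd i \<phi> x = 0" if "x \<notin> U" for x i
      using test_function_zero[OF \<phi>, of x] K that by auto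
    have z': "grad \<phi> x = 0" if "x \<notin> U" for x
      unfolding grad_pd using z(2)[OF that] by simp
    have e1: "(LINT x:U|lebesgue. u x *\<^sub>R grad \<phi> x) = (LINT x|lebesgue. u x *\<^sub>R grad \<phi> x)"
      unfolding set_lebesgue_integral_def
      by (rule Bochner_Integration.integral_cong) (use z' in \<open>auto simp: indicator_def\<close>)
    have e2: "(LINT x:U|lebesgue. \<phi> x *\<^sub>R g x) = (LINT x|lebesgue. \<phi> x *\<^sub>R g x)"
      unfolding set_lebesgue_integral_def
      by (rule Bochner_Integration.integral_cong) (use z in \<open>auto simp: indicator_def\<close>)
    have "integrable lebesgue (\<lambda>x. \<Sum>i\<in>Basis. (pd i \<phi> x *\<^sub>R u x) *\<^sub>R i)"
      using test_function_integrable(2)[OF \<phi> u] by (intro Bochner_Integration.integrable_sum) auto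
    then have i1: "integrable lebesgue (\<lambda>x. u x *\<^sub>R grad \<phi> x)"
      by (simp add: grad_pd scaleR_sum_right mult.commute)
    have i2: "integrable lebesgue (\<lambda>x. \<phi> x *\<^sub>R g x)"
      using test_function_integrable(1)[OF \<phi> g] nonempty_Basis by blast
    have "(LINT x|lebesgue. u x *\<^sub>R grad \<phi> x) \<bullet> i = (LINT x|lebesgue. u x * pd i \<phi> x)" if "i \<in> Basis" for i
      using integral_inner_left[OF i1, of i] that by (simp add: grad_inner_Basis)
    moreover have "(LINT x|lebesgue. \<phi> x *\<^sub>R g x) \<bullet> i = (LINT x|lebesgue. \<phi> x * (g x \<bullet> i))" for i
      using integral_inner_left[OF i2, of i] by simp
    ultimately show ?thesis
      unfolding e1 e2 euclidean_eq_iff[where 'a='a] inner_minus_left by auto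
  qed
  then show ?thesis unfolding has_weak_gradient_on_def by blast
qed

lemma test_function_subset:
  "test_function_on V \<phi> \<Longrightarrow> V \<subseteq> U \<Longrightarrow> test_function_on U \<phi>"
  unfolding test_function_on_def by blast

lemma has_weak_gradient_on_subset:
  "has_weak_gradient_on U u g \<Longrightarrow> V \<subseteq> U \<Longrightarrow> has_weak_gradient_on V u g"
  unfolding has_weak_gradient_on_iff
  by (auto dest: L1_loc_subset test_function_subset)

lemma test_function_mult:
  assumes "test_function_on U \<phi>" "smooth \<eta>"
  shows "test_function_on U (\<lambda>x. \<eta> x * \<phi> x)"
proof -
  have "closure {x. \<eta> x * \<phi> x \<noteq> 0} \<subseteq> closure {x. \<phi> x \<noteq> 0}" by (rule closure_mono) auto
  then show ?thesis
    using assms bounded_subset[of "closure {x. \<phi> x \<noteq> 0}"] unfolding test_function_on_def compact_eq_bounded_closed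
    by (auto simp: smooth_mult)
qed

lemma has_weak_gradient_on_add:
  assumes "has_weak_gradient_on U u g" "has_weak_gradient_on U v h"
  shows "has_weak_gradient_on U (\<lambda>x. u x + v x) (\<lambda>x. g x + h x)"
  unfolding has_weak_gradient_on_iff
proof (intro conjI allI impI ballI)
  have L: "L1_loc U u" "L1_loc U g" "L1_loc U v" "L1_loc U h"
    using assms by (auto simp: has_weak_gradient_on_iff)
  show "L1_loc U (\<lambda>x. u x + v x)" "L1_loc U (\<lambda>x. g x + h x)" using L L1_loc_add by blast+
  fix \<phi> and i :: 'a assume \<phi>: "test_function_on U \<phi>" and i: "i \<in> Basis"
  have "integrable lebesgue (\<lambda>x. u x * pd i \<phi> x)" "integrable lebesgue (\<lambda>x. v x * pd i \<phi> x)"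
    using test_function_integrable(2)[OF \<phi> L(1) i] test_function_integrable(2)[OF \<phi> L(3) i] by (simp_all add: mult.commute)
  moreover have "integrable lebesgue (\<lambda>x. \<phi> x * (g x \<bullet> i))" "integrable lebesgue (\<lambda>x. \<phi> x * (h x \<bullet> i))"
    using integrable_inner_left[OF test_function_integrable(1)[OF \<phi> L(2) i], of i]
     integrable_inner_left[OF test_function_integrable(1)[OF \<phi> L(4) i], of i] by simp_all
  ultimately show "(LINT x|lebesgue. (u x + v x) * pd i \<phi> x) = - (LINT x|lebesgue. \<phi> x * ((g x + h x) \<bullet> i))"
    using assms \<phi> i by (simp add: has_weak_gradient_on_iff distrib_left distrib_right inner_add_left)
qed

text \<open>Test the weak gradient of \<open>u\<close> with \<open>\<eta> x * \<phi> x\<close>,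
  which is again a test function; the Leibniz rule moves the term containing the derivative of
  \<open>\<eta>\<close> to the other side.\<close>

lemma has_weak_gradient_on_mult:
  assumes u: "has_weak_gradient_on U u g" and \<eta>: "smooth \<eta>"
  shows "has_weak_gradient_on U (\<lambda>x. \<eta> x * u x) (\<lambda>x. \<eta> x *\<^sub>R g x + u x *\<^sub>R grad \<eta> x)"
  unfolding has_weak_gradient_on_iff
proof (intro conjI allI impI ballI)
  have L: "L1_loc U u" "L1_loc U g" using u by (auto simp: has_weak_gradient_on_iff)
  have c: "continuous_on UNIV \<eta>" using \<eta> smooth_continuous by blast
  show "L1_loc U (\<lambda>x. \<eta> x * u x)" using L1_loc_scaleR[OF L(1) c] by simp
  have "L1_loc U (\<lambda>x. pd i \<eta> x *\<^sub>R u x *\<^sub>R i)" if i: "i \<in> Basis" for i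
    by (rule L1_loc_scaleR[OF _ smooth_continuous[OF smooth_pd[OF \<eta> i]]])
      (use L(1) in \<open>auto simp only: L1_loc_def set_integrable_def scaleR_scaleR real_scaleR_def intro!: integrable_scaleR_left\<close>)
  then have "set_integrable lebesgue K (\<lambda>x. \<Sum>i\<in>Basis. pd i \<eta> x *\<^sub>R u x *\<^sub>R i)" if "compact K" "K \<subseteq> U" for K
    unfolding set_integrable_def scaleR_sum_right using that
    by (intro Bochner_Integration.integrable_sum) (simp add: L1_loc_def set_integrable_def)
  then have "L1_loc U (\<lambda>x. u x *\<^sub>R grad \<eta> x)"
    unfolding L1_loc_def grad_pd by (simp add: scaleR_sum_right mult.commute)
  then show "L1_loc U (\<lambda>x. \<eta> x *\<^sub>R g x + u x *\<^sub>R grad \<eta> x)"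
    by (intro L1_loc_add L1_loc_scaleR[OF L(2) c])
  fix \<phi> and i :: 'a assume \<phi>: "test_function_on U \<phi>" and i: "i \<in> Basis"
  have s: "smooth \<phi>" using \<phi> by (simp add: test_function_on_def)
  have t: "test_function_on U (\<lambda>x. \<eta> x * \<phi> x)" by (rule test_function_mult[OF \<phi> \<eta>])
  have t2: "test_function_on U (\<lambda>x. pd i \<eta> x * \<phi> x)" by (rule test_function_mult[OF \<phi> smooth_pd[OF \<eta> i]])
  have p: "pd i (\<lambda>x. \<eta> x * \<phi> x) x = \<eta> x * pd i \<phi> x + pd i \<eta> x * \<phi> x" for x
    by (rule pd_mult) (simp_all add: smooth_differentiable \<eta> s)
  have i1: "integrable lebesgue (\<lambda>x. u x * pd i (\<lambda>x. \<eta> x * \<phi> x) x)"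
    using test_function_integrable(2)[OF t L(1) i] by (simp add: mult.commute)
  have i2: "integrable lebesgue (\<lambda>x. u x * (pd i \<eta> x * \<phi> x))"
    using test_function_integrable(1)[OF t2 L(1) i] by (simp add: mult.commute)
  have i3: "integrable lebesgue (\<lambda>x. (\<eta> x * \<phi> x) * (g x \<bullet> i))"
    using integrable_inner_left[OF test_function_integrable(1)[OF t L(2) i], of i] by simp
  have "(LINT x|lebesgue. (\<eta> x * u x) * pd i \<phi> x)
      = (LINT x|lebesgue. u x * pd i (\<lambda>x. \<eta> x * \<phi> x) x - u x * (pd i \<eta> x * \<phi> x))"
    by (rule Bochner_Integration.integral_cong) (auto simp: p algebra_simps)
  also have "\<dots> = (LINT x|lebesgue. u x * pd i (\<lambda>x. \<eta> x * \<phi> x) x) - (LINT x|lebesgue. u x * (pd i \<eta> x * \<phi> x))"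
    using i1 i2 by simp
  also have "(LINT x|lebesgue. u x * pd i (\<lambda>x. \<eta> x * \<phi> x) x) = - (LINT x|lebesgue. (\<eta> x * \<phi> x) * (g x \<bullet> i))"
    using u t i by (simp add: has_weak_gradient_on_iff)
  also have "- (LINT x|lebesgue. (\<eta> x * \<phi> x) * (g x \<bullet> i)) - (LINT x|lebesgue. u x * (pd i \<eta> x * \<phi> x))
     = - (LINT x|lebesgue. (\<eta> x * \<phi> x) * (g x \<bullet> i) + u x * (pd i \<eta> x * \<phi> x))"
    using i2 i3 by simp
  also have "(LINT x|lebesgue. (\<eta> x * \<phi> x) * (g x \<bullet> i) + u x * (pd i \<eta> x * \<phi> x))
     = (LINT x|lebesgue. \<phi> x * ((\<eta> x *\<^sub>R g x + u x *\<^sub>R grad \<eta> x) \<bullet> i))"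
    by (rule Bochner_Integration.integral_cong) (auto simp: inner_add_left grad_inner_Basis i algebra_simps)
  finally show "(LINT x|lebesgue. (\<eta> x * u x) * pd i \<phi> x) =
     - (LINT x|lebesgue. \<phi> x * ((\<eta> x *\<^sub>R g x + u x *\<^sub>R grad \<eta> x) \<bullet> i))" .
qed

text \<open>The integral of the translates of \<open>f\<close> does not depend on the translation.
  Its derivative, computed under the integral sign by \<open>pd_kernel_int\<close> with the constant
  density 1, therefore vanishes.\<close>

lemma integral_pd_eq_0:
  fixes f :: "'a::euclidean_space \<Rightarrow> real"
  assumes f: "smooth f" and R: "R > 0" "\<And>z. R < norm z \<Longrightarrow> f z = 0" and i: "i \<in> Basis"
  shows "(LINT x|lebesgue. pd i f x) = 0"
proof -
  \<comment> \<open>Rescaling by the radius of the support makes \<open>f\<close> a unit test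
    function, so that \<open>kernel_int\<close> with scale \<open>R\<close> gives the translates of
    \<open>f\<close>.\<close>
  define g where "g = (\<lambda>z. f (R *\<^sub>R (z - 0)))"
  have g: "unit_test g"
    using smooth_affine[OF f, of R 0] R by (auto simp: unit_test_def g_def)
  obtain c where c: "cball 0 (R + 1) \<subseteq> cbox (-c) (c::'a)"
    using bounded_subset_cbox_symmetric[OF bounded_cball] by blast
  let ?F = "\<lambda>x. kernel_int (-c) c (\<lambda>_. 1) g x R"
  have const: "?F x = R ^ DIM('a) * integral UNIV g" if "x \<in> ball 0 1" for x
  proof -
    have "cball x R \<subseteq> cball 0 (R + 1)"
    proof
      fix y assume "y \<in> cball x R"
      then have "norm (y - x) \<le> R" by (simp add: dist_norm norm_minus_commute)
      then show "y \<in> cball 0 (R + 1)" using that norm_triangle_sub[of y x] by simp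
    qed
    then show ?thesis
      using kernel_scaling[OF g R(1), of x "-c" c] c by (simp add: kernel_int_def order_trans)
  qed
  have "pd i ?F 0 = 0"
  proof -
    have "(?F has_derivative (\<lambda>h. 0)) (at 0)"
      by (rule has_derivative_transform_within_open[of "\<lambda>_. R ^ DIM('a) * integral UNIV g" _ 0 UNIV "ball 0 1"])
        (auto simp: const)
    from pd_unique[OF this] show ?thesis .
  qed
  then have "kernel_int (-c) c (\<lambda>_. 1) (pd i g) 0 R = 0"
    using pd_kernel_int[OF continuous_on_const unit_test_smooth[OF g] i, of "-c" c 1 R 0] R(1) by simp
  moreover have "pd i g ((1/R) *\<^sub>R (y - 0)) = R * pd i f y" for y
    unfolding g_def using pd_affine[OF f i, of R 0 "(1/R) *\<^sub>R (y - 0)"] R(1) by simp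
  ultimately have "integral (cbox (-c) c) (\<lambda>y. R * pd i f y) = 0"
    by (simp add: kernel_int_def)
  then have "integral (cbox (-c) c) (pd i f) = 0" using R(1) by simp
  moreover have "pd i f x = 0" if "x \<notin> cbox (-c) c" for x
  proof (rule pd_zero_open[where S="{x. R < norm x}"])
    show "open {x::'a. R < norm x}" by (intro open_Collect_less continuous_intros)
    show "x \<in> {x. R < norm x}" using that c R(1) by force
  qed (use R in auto)
  ultimately show ?thesis
    using lebesgue_integral_eq_cbox(2)[of "-c" c "pd i f"] smooth_continuous[OF smooth_pd[OF f i]] by simp
qed

text \<open>Integration by parts: the derivative of the compactly supported product of
  \<open>w\<close> and the test function has integral zero.\<close>

lemma has_weak_gradient_on_smooth:
  assumes w: "smooth w"
  shows "has_weak_gradient_on U w (grad w)"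
  unfolding has_weak_gradient_on_iff
proof (intro conjI allI impI ballI)
  show L: "L1_loc U w" "L1_loc U (grad w)"
    by (auto intro!: L1_loc_continuous smooth_continuous w grad_continuous)
  fix \<phi> and i :: 'a assume \<phi>: "test_function_on U \<phi>" and i: "i \<in> Basis"
  have s: "smooth \<phi>" using \<phi> by (simp add: test_function_on_def)
  obtain R where R: "R > 0" "\<And>x. x \<in> closure {x. \<phi> x \<noteq> 0} \<Longrightarrow> norm x \<le> R"
    using \<phi> bounded_pos compact_imp_bounded unfolding test_function_on_def by metis
  have z: "\<phi> x = 0" if "R < norm x" for x
    using test_function_zero(1)[OF \<phi>, of x] R(2)[of x] that by auto
  have p: "pd i (\<lambda>x. w x * \<phi> x) x = w x * pd i \<phi> x + pd i w x * \<phi> x" for x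
    by (rule pd_mult) (simp_all add: smooth_differentiable w s)
  have i1: "integrable lebesgue (\<lambda>x. w x * pd i \<phi> x)"
    using test_function_integrable(2)[OF \<phi> L(1) i] by (simp add: mult.commute)
  have i2: "integrable lebesgue (\<lambda>x. \<phi> x * (grad w x \<bullet> i))"
    using integrable_inner_left[OF test_function_integrable(1)[OF \<phi> L(2) i], of i] by simp
  have "0 = (LINT x|lebesgue. pd i (\<lambda>x. w x * \<phi> x) x)"
    using integral_pd_eq_0[OF smooth_mult[OF w s] R(1) _ i] z by simp
  also have "\<dots> = (LINT x|lebesgue. w x * pd i \<phi> x + \<phi> x * (grad w x \<bullet> i))"
    by (rule Bochner_Integration.integral_cong) (auto simp: p grad_inner_Basis i)
  also have "\<dots> = (LINT x|lebesgue. w x * pd i \<phi> x) + (LINT x|lebesgue. \<phi> x * (grad w x \<bullet> i))"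
    using i1 i2 by simp
  finally show "(LINT x|lebesgue. w x * pd i \<phi> x) = - (LINT x|lebesgue. \<phi> x * (grad w x \<bullet> i))" by simp
qed

section \<open>Mollification in the mean\<close>

lemma integrable_truncate:
  fixes f :: "'a::euclidean_space \<Rightarrow> real"
  assumes f: "integrable lebesgue f" and e: "e > 0"
  obtains B where "B > 0" "(LINT x|lebesgue. \<bar>max (- B) (min B (f x)) - f x\<bar>) < e"
proof -
  have m: "f \<in> borel_measurable lebesgue" using f by simp
  let ?t = "\<lambda>j x. max (- real j) (min (real j) (f x))"
  have "(\<lambda>j. LINT x|lebesgue. \<bar>?t j x - f x\<bar>) \<longlonglongrightarrow> (LINT x::'a|lebesgue. (0::real))"
  proof (rule integral_dominated_convergence[where w="\<lambda>x. \<bar>f x\<bar>"])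
    show "AE x in lebesgue. (\<lambda>j. \<bar>?t j x - f x\<bar>) \<longlonglongrightarrow> 0"
    proof (rule AE_I2)
      fix x
      obtain N where N: "\<bar>f x\<bar> \<le> real N" using real_arch_simple by blast
      have "\<bar>?t j x - f x\<bar> = 0" if "j \<ge> N" for j
      proof -
        have "real N \<le> real j" using that by simp
        then show ?thesis using N by (simp add: max_def min_def abs_if split: if_splits)
      qed
      then show "(\<lambda>j. \<bar>?t j x - f x\<bar>) \<longlonglongrightarrow> 0"
        by (intro tendsto_eventually) (auto simp: eventually_sequentially)
    qed
    show "AE x in lebesgue. norm \<bar>?t j x - f x\<bar> \<le> \<bar>f x\<bar>" for j
      by (intro AE_I2) (auto simp: max_def min_def abs_if)
  qed (use f m in auto)
  then have "\<forall>\<^sub>F j in sequentially. (LINT x|lebesgue. \<bar>?t j x - f x\<bar>) < e"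
    using order_tendstoD(2) e by fastforce
  then obtain N where N: "\<And>j. j \<ge> N \<Longrightarrow> (LINT x|lebesgue. \<bar>?t j x - f x\<bar>) < e"
    by (auto simp: eventually_sequentially)
  show ?thesis using N[of "Suc N"] by (intro that[of "real (Suc N)"]) auto
qed

text \<open>A measurable function is an almost everywhere limit of continuous ones. Clamping the
  truncated function and the approximants to the same interval supplies the majorant
  \<open>2 * B\<close> on the compact set, and dominated convergence applies.\<close>

lemma L1_dense_continuous:
  fixes f :: "'a::euclidean_space \<Rightarrow> real"
  assumes f: "integrable lebesgue f" and K: "compact K" and e: "e > 0"
  obtains g where "continuous_on UNIV g" "(LINT x|lebesgue. indicator K x * \<bar>f x - g x\<bar>) < e"
proof -
  obtain B where B: "B > 0" "(LINT x|lebesgue. \<bar>max (- B) (min B (f x)) - f x\<bar>) < e / 2"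
    using integrable_truncate[OF f, of "e/2"] e by auto
  let ?f = "\<lambda>x. max (- B) (min B (f x))"
  have m: "f \<in> borel_measurable lebesgue" using f by simp
  have "f measurable_on UNIV" using lebesgue_measurable_imp_measurable_on[OF m] by simp
  then obtain N g where g: "negligible N" "\<And>n. continuous_on UNIV (g n)" "\<And>x. x \<notin> N \<Longrightarrow> (\<lambda>n::nat. g n x) \<longlonglongrightarrow> f x"
    unfolding measurable_on_def by auto
  let ?g = "\<lambda>n x. max (- B) (min B (g n x))"
  have clamp: "- B \<le> max (- B) (min B t)" "max (- B) (min B t) \<le> B" for t
    using B(1) by auto
  have gap: "- B \<le> p \<Longrightarrow> p \<le> B \<Longrightarrow> - B \<le> q \<Longrightarrow> q \<le> B \<Longrightarrow> \<bar>p - q\<bar> \<le> 2 * B" for p q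
    by linarith
  have gc: "continuous_on UNIV (?g n)" for n by (intro continuous_intros g(2))
  have gm: "g n \<in> borel_measurable lebesgue" for n by (rule continuous_lebesgue_measurable[OF g(2)])
  have Ki: "integrable lebesgue (indicat_real K)"
    using lmeasurable_compact[OF K] by (simp add: lmeasurable_iff_integrable)
  have Km: "indicat_real K \<in> borel_measurable lebesgue" using Ki by simp
  have AEN: "AE x in lebesgue. x \<notin> N" using g(1) by (simp add: AE_not_in negligible_iff_null_sets)
  have "(\<lambda>n. LINT x|lebesgue. indicat_real K x * \<bar>?f x - ?g n x\<bar>) \<longlonglongrightarrow> (LINT x::'a|lebesgue. (0::real))"
  proof (rule integral_dominated_convergence[where w="\<lambda>x. 2 * B * indicat_real K x"])
    show "AE x in lebesgue. (\<lambda>n. indicat_real K x * \<bar>?f x - ?g n x\<bar>) \<longlonglongrightarrow> 0"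
      using AEN
    proof eventually_elim
      case (elim x)
      have "(\<lambda>n. indicat_real K x * \<bar>?f x - ?g n x\<bar>) \<longlonglongrightarrow> indicat_real K x * \<bar>?f x - ?f x\<bar>"
        by (intro tendsto_intros tendsto_max tendsto_min g(3)[OF elim])
      then show ?case by simp
    qed
    have "\<bar>?f x - ?g n x\<bar> \<le> 2 * B" for n x
      by (rule gap[OF clamp clamp])
    then show "AE x in lebesgue. norm (indicat_real K x * \<bar>?f x - ?g n x\<bar>) \<le> 2 * B * indicat_real K x" for n
      by (intro AE_I2) (simp add: indicator_def)
    show "(\<lambda>x. indicat_real K x * \<bar>?f x - ?g n x\<bar>) \<in> borel_measurable lebesgue" for n
      using gm m Km by (intro borel_measurable_times borel_measurable_abs borel_measurable_diff borel_measurable_max borel_measurable_min) auto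
  qed (use Ki in auto)
  then have "\<forall>\<^sub>F n in sequentially. (LINT x|lebesgue. indicat_real K x * \<bar>?f x - ?g n x\<bar>) < e / 2"
    using order_tendstoD(2)[of _ "0::real" sequentially "e/2"] e by simp
  then obtain n where n: "(LINT x|lebesgue. indicat_real K x * \<bar>?f x - ?g n x\<bar>) < e / 2"
    using eventually_happens'[OF sequentially_bot] by blast
  have i1: "integrable lebesgue (\<lambda>x. indicat_real K x * \<bar>?f x - ?g n x\<bar>)"
  proof (rule Bochner_Integration.integrable_bound[where f="\<lambda>x. 2 * B * indicat_real K x"])
    show "(\<lambda>x. indicat_real K x * \<bar>?f x - ?g n x\<bar>) \<in> borel_measurable lebesgue"
      using gm m Km by (intro borel_measurable_times borel_measurable_abs borel_measurable_diff borel_measurable_max borel_measurable_min) auto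
    have "\<bar>?f x - ?g n x\<bar> \<le> 2 * B" for x
      by (rule gap[OF clamp clamp])
    moreover have "norm (indicat_real K x * D) \<le> norm (2 * B * indicat_real K x)" if "0 \<le> D" "D \<le> 2 * B" for D x
      using B(1) that by (simp add: indicator_def)
    ultimately have "norm (indicat_real K x * \<bar>?f x - ?g n x\<bar>) \<le> norm (2 * B * indicat_real K x)" for x
      using abs_ge_zero by blast
    then show "AE x in lebesgue. norm (indicat_real K x * \<bar>?f x - ?g n x\<bar>) \<le> norm (2 * B * indicat_real K x)"
      by (intro AE_I2)
  qed (use Ki in auto)
  have i2: "integrable lebesgue (\<lambda>x. \<bar>?f x - f x\<bar>)"
  proof (rule Bochner_Integration.integrable_bound[OF f])
    show "AE x in lebesgue. norm \<bar>?f x - f x\<bar> \<le> norm (f x)"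
      using B(1) by (intro AE_I2) (auto simp: max_def min_def abs_if)
  qed (use m in auto)
  have "(LINT x|lebesgue. indicat_real K x * \<bar>f x - ?g n x\<bar>)
      \<le> (LINT x|lebesgue. indicat_real K x * \<bar>?f x - ?g n x\<bar> + \<bar>?f x - f x\<bar>)"
  proof (rule integral_mono')
    show "integrable lebesgue (\<lambda>x. indicat_real K x * \<bar>?f x - ?g n x\<bar> + \<bar>?f x - f x\<bar>)" using i1 i2 by simp
    show "indicat_real K x * \<bar>f x - ?g n x\<bar> \<le> indicat_real K x * \<bar>?f x - ?g n x\<bar> + \<bar>?f x - f x\<bar>" for x
    proof -
      have "\<bar>p - q\<bar> \<le> \<bar>r - q\<bar> + \<bar>r - p\<bar>" for p q r :: real by linarith
      then show ?thesis by (simp add: indicator_def)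
    qed
  qed simp
  also have "\<dots> = (LINT x|lebesgue. indicat_real K x * \<bar>?f x - ?g n x\<bar>) + (LINT x|lebesgue. \<bar>?f x - f x\<bar>)"
    using i1 i2 by simp
  also have "\<dots> < e" using n B(2) by simp
  finally show ?thesis using that[OF gc] by blast
qed

section \<open>Averages of integrable functions and their convergence in the mean\<close>

text \<open>The normalised mollification once more, now as a Lebesgue integral, because the
  components of a weak gradient are only integrable and not continuous.\<close>

definition average :: "('a::euclidean_space \<Rightarrow> real) \<Rightarrow> real \<Rightarrow> ('a \<Rightarrow> real) \<Rightarrow> 'a \<Rightarrow> real" where
  "average \<eta> s h y = (LINT z|lebesgue. (1 / s ^ DIM('a)) * \<eta> ((1/s) *\<^sub>R (z - y)) * h z)"

text \<open>Here the centre varies and the point \<open>z\<close> is fixed; evenness of the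
  mollifier exchanges the two roles and reduces the claim to \<open>kernel_scaling\<close>.\<close>

lemma kernel_nn_integral:
  fixes \<eta> :: "'a::euclidean_space \<Rightarrow> real"
  assumes \<eta>: "unit_test \<eta>" "\<And>z. \<eta> z \<ge> 0" "integral UNIV \<eta> = 1" "\<And>z. \<eta> (- z) = \<eta> z" and s: "s > 0"
  shows "(\<integral>\<^sup>+y. ennreal ((1 / s ^ DIM('a)) * \<eta> ((1/s) *\<^sub>R (z - y))) \<partial>lborel) = 1"
proof -
  let ?k = "\<lambda>y. (1 / s ^ DIM('a)) * \<eta> ((1/s) *\<^sub>R (y - z))"
  have sm: "smooth \<eta>" using \<eta>(1) unit_test_smooth by blast
  have sym: "\<eta> ((1/s) *\<^sub>R (z - y)) = \<eta> ((1/s) *\<^sub>R (y - z))" for y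
    using \<eta>(4)[of "(1/s) *\<^sub>R (y - z)"] by (simp add: algebra_simps)
  obtain c where c: "cball z s \<subseteq> cbox (-c) (c::'a)"
    using bounded_subset_cbox_symmetric[OF bounded_cball] by blast
  have cont: "continuous_on UNIV ?k"
    by (intro smooth_continuous smooth_cmult smooth_affine sm)
  have zero: "?k y = 0" if "y \<notin> cbox (-c) c" for y
  proof -
    have "y \<notin> cball z s" using that c by blast
    then show ?thesis using unit_test_scaled_zero[OF \<eta>(1) s] by simp
  qed
  have i: "integrable lebesgue ?k" "(LINT y|lebesgue. ?k y) = integral (cbox (-c) c) ?k"
    using lebesgue_integral_eq_cbox[of "-c" c ?k] cont zero continuous_on_subset by blast+
  have "integral (cbox (-c) c) ?k = (1 / s ^ DIM('a)) * integral (cbox (-c) c) (\<lambda>y. \<eta> ((1/s) *\<^sub>R (y - z)))"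
    by (rule integral_mult_right)
  also have "\<dots> = (1 / s ^ DIM('a)) * (s ^ DIM('a) * 1)"
    by (simp only: kernel_scaling[OF \<eta>(1) s c] \<eta>(3))
  also have "\<dots> = 1" using s by simp
  finally have "integral (cbox (-c) c) ?k = 1" .
  then have "ennreal (LINT y|lebesgue. ?k y) = 1" unfolding i(2) by (simp only: ennreal_1)
  moreover have "AE y in lebesgue. 0 \<le> ?k y" using \<eta>(2) s by simp
  ultimately have "(\<integral>\<^sup>+y. ennreal (?k y) \<partial>lebesgue) = 1"
    using nn_integral_eq_integral[OF i(1)] by (simp only:)
  then show ?thesis unfolding sym nn_integral_completion .
qed

text \<open>Averaging does not increase the L1 norm, by Tonelli and
  \<open>kernel_nn_integral\<close>. The statement provides a measurable majorant \<open>G\<close>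
  of the averages, so that measurability of the averages themselves need not be established.\<close>

lemma average_L1:
  fixes \<eta> h :: "'a::euclidean_space \<Rightarrow> real"
  assumes \<eta>: "unit_test \<eta>" "\<And>z. \<eta> z \<ge> 0" "integral UNIV \<eta> = 1" "\<And>z. \<eta> (- z) = \<eta> z" and s: "s > 0"
    and h: "h \<in> borel_measurable lebesgue"
  obtains G where "G \<in> borel_measurable lebesgue" "\<And>y. ennreal \<bar>average \<eta> s h y\<bar> \<le> G y"
    "(\<integral>\<^sup>+y. G y \<partial>lebesgue) = (\<integral>\<^sup>+z. ennreal \<bar>h z\<bar> \<partial>lebesgue)"
proof -
  let ?k = "\<lambda>z y. (1 / s ^ DIM('a)) * \<eta> ((1/s) *\<^sub>R (z - y))"
  have k0: "?k z y \<ge> 0" for z y using \<eta>(2) s by simp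
  have sm: "smooth \<eta>" using \<eta>(1) unit_test_smooth by blast
  have "(\<lambda>z. ennreal \<bar>h z\<bar>) \<in> borel_measurable lebesgue" using h by measurable
  \<comment> \<open>Tonelli is applied on the product of two Borel measures, so the Lebesgue
    measurable |h| is replaced by a Borel function equal to it almost everywhere.\<close>
  then obtain H where H: "H \<in> borel_measurable lborel" "AE z in lborel. ennreal \<bar>h z\<bar> = H z"
    using completion_ex_borel_measurable by blast
  have kc: "continuous_on UNIV (\<lambda>p::'a \<times> 'a. ?k (fst p) (snd p))"
    by (intro continuous_on_mult continuous_on_const smooth_continuous'[OF sm] continuous_intros)
  then have km: "(\<lambda>p::'a \<times> 'a. ?k (fst p) (snd p)) \<in> borel_measurable (lborel \<Otimes>\<^sub>M lborel)"
    using borel_measurable_continuous_onI[OF kc] by (simp add: lborel_prod measurable_lborel1 borel_prod)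
  have pt: "ennreal \<bar>average \<eta> s h y\<bar> \<le> (\<integral>\<^sup>+z. ennreal (?k z y) * H z \<partial>lborel)" for y
  proof -
    have "ennreal \<bar>average \<eta> s h y\<bar> \<le> (\<integral>\<^sup>+z. ennreal \<bar>?k z y * h z\<bar> \<partial>lebesgue)"
    proof (cases "integrable lebesgue (\<lambda>z. ?k z y * h z)")
      case True
      then show ?thesis unfolding average_def using integral_norm_bound_ennreal[OF True] by simp
    next
      case False
      then have "average \<eta> s h y = 0" unfolding average_def by (rule not_integrable_integral_eq)
      then show ?thesis by simp
    qed
    also have "\<dots> = (\<integral>\<^sup>+z. ennreal \<bar>?k z y * h z\<bar> \<partial>lborel)" by (rule nn_integral_completion)
    also have "\<dots> = (\<integral>\<^sup>+z. ennreal (?k z y) * H z \<partial>lborel)"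
    proof (rule nn_integral_cong_AE)
      show "AE z in lborel. ennreal \<bar>?k z y * h z\<bar> = ennreal (?k z y) * H z"
        using H(2)
      proof eventually_elim
        case (elim z)
        have "\<bar>?k z y * h z\<bar> = ?k z y * \<bar>h z\<bar>" using k0[of z y] by (metis abs_mult abs_of_nonneg)
        then show ?case using k0[of z y] elim[symmetric] by (simp only: ennreal_mult'')
      qed
    qed
    finally show ?thesis .
  qed
  let ?G = "\<lambda>y. \<integral>\<^sup>+z. ennreal (?k z y) * H z \<partial>lborel"
  have Gm: "?G \<in> borel_measurable lborel"
  proof (rule lborel.borel_measurable_nn_integral)
    have "(\<lambda>p::'a\<times>'a. H (snd p)) \<in> borel_measurable (lborel \<Otimes>\<^sub>M lborel)"
      using measurable_compose[OF measurable_snd H(1)] .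
    moreover have "(\<lambda>p::'a \<times> 'a. ?k (snd p) (fst p)) \<in> borel_measurable (lborel \<Otimes>\<^sub>M lborel)"
      using measurable_compose[OF measurable_pair_swap' km] by (simp add: split_beta)
    ultimately show "(\<lambda>(y, z). ennreal (?k z y) * H z) \<in> borel_measurable (lborel \<Otimes>\<^sub>M lborel)"
      using measurable_compose[OF _ measurable_ennreal] unfolding split_beta by (intro borel_measurable_times_ennreal)
  qed
  have "(\<integral>\<^sup>+y. ?G y \<partial>lebesgue) = (\<integral>\<^sup>+y. ?G y \<partial>lborel)"
    by (rule nn_integral_completion)
  also have "\<dots> = (\<integral>\<^sup>+z. (\<integral>\<^sup>+y. ennreal (?k z y) * H z \<partial>lborel) \<partial>lborel)"
  proof (rule lborel_pair.Fubini')
    have "(\<lambda>p::'a\<times>'a. H (fst p)) \<in> borel_measurable (lborel \<Otimes>\<^sub>M lborel)"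
      using measurable_compose[OF measurable_fst H(1)] .
    then show "(\<lambda>(z, y). ennreal (?k z y) * H z) \<in> borel_measurable (lborel \<Otimes>\<^sub>M lborel)"
      using measurable_compose[OF km measurable_ennreal] unfolding split_beta by (intro borel_measurable_times_ennreal)
  qed
  also have "\<dots> = (\<integral>\<^sup>+z. H z \<partial>lborel)"
  proof (rule nn_integral_cong)
    fix z
    have "continuous_on UNIV (\<lambda>y. ?k z y)"
      by (intro continuous_on_mult continuous_on_const smooth_continuous'[OF sm] continuous_intros)
    then have "(\<lambda>y. ?k z y) \<in> borel_measurable lborel"
      using borel_measurable_continuous_onI by simp
    then have "(\<lambda>y. ennreal (?k z y)) \<in> borel_measurable lborel"
      by (rule measurable_compose[OF _ measurable_ennreal])
    then have "(\<integral>\<^sup>+y. ennreal (?k z y) * H z \<partial>lborel) = (\<integral>\<^sup>+y. ennreal (?k z y) \<partial>lborel) * H z"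
      by (rule nn_integral_multc)
    then show "(\<integral>\<^sup>+y. ennreal (?k z y) * H z \<partial>lborel) = H z"
      using kernel_nn_integral[OF \<eta> s, of z] by simp
  qed
  also have "\<dots> = (\<integral>\<^sup>+z. ennreal \<bar>h z\<bar> \<partial>lborel)"
    using H(2) by (intro nn_integral_cong_AE) auto
  also have "\<dots> = (\<integral>\<^sup>+z. ennreal \<bar>h z\<bar> \<partial>lebesgue)"
    by (rule nn_integral_completion[symmetric])
  finally have "(\<integral>\<^sup>+y. ?G y \<partial>lebesgue) = (\<integral>\<^sup>+z. ennreal \<bar>h z\<bar> \<partial>lebesgue)" .
  with that[OF measurable_completion[OF Gm] pt] show ?thesis by blast
qed

text \<open>Split off a continuous \<open>g\<close> that is close to \<open>F\<close> in the mean on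
  \<open>K\<close>. The averages of the difference stay small by \<open>average_L1\<close>, the
  averages of \<open>g\<close> are uniformly close to \<open>g\<close> by uniform continuity, and
  the difference itself is small: three terms of size e/3.\<close>

lemma mollify_L1:
  fixes \<eta> F :: "'a::euclidean_space \<Rightarrow> real"
  assumes \<eta>: "unit_test \<eta>" "\<And>z. \<eta> z \<ge> 0" "integral UNIV \<eta> = 1" "\<And>z. \<eta> (- z) = \<eta> z"
    and F: "integrable lebesgue (\<lambda>z. indicat_real K z * F z)" and K: "compact K"
    and s0: "s0 > 0" and V: "\<And>y. y \<in> V \<Longrightarrow> cball y s0 \<subseteq> K" and e: "e > 0"
  shows "\<exists>s1>0. \<forall>s. 0 < s \<and> s < s1 \<longrightarrow>
    (LINT y|lebesgue. indicator V y * \<bar>average \<eta> s (\<lambda>z. indicat_real K z * F z) y - F y\<bar>) \<le> e"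
proof -
  let ?f = "\<lambda>z. indicat_real K z * F z"
  have sm: "smooth \<eta>" using \<eta>(1) unit_test_smooth by blast
  obtain c where c: "K \<subseteq> cbox (-c) (c::'a)"
    using bounded_subset_cbox_symmetric compact_imp_bounded[OF K] by blast
  obtain g where g: "continuous_on UNIV g" "(LINT z|lebesgue. indicator K z * \<bar>?f z - g z\<bar>) < e / 3"
    using L1_dense_continuous[OF F K, of "e/3"] e by auto
  let ?g = "\<lambda>z. indicat_real K z * g z"
  have Km: "K \<in> sets lebesgue" "K \<in> lmeasurable" using lmeasurable_compact[OF K] by auto
  have gi: "integrable lebesgue ?g"
    using L1_loc_continuous[of UNIV g] g(1) K unfolding L1_loc_def set_integrable_def by simp
  have hi: "integrable lebesgue (\<lambda>z. ?f z - ?g z)" using F gi by simp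
  have habs: "\<bar>?f z - ?g z\<bar> = indicator K z * \<bar>?f z - g z\<bar>" for z by (simp add: indicator_def)
  have h: "(\<integral>\<^sup>+z. ennreal \<bar>?f z - ?g z\<bar> \<partial>lebesgue) \<le> ennreal (e / 3)"
  proof -
    have "(\<integral>\<^sup>+z. ennreal \<bar>?f z - ?g z\<bar> \<partial>lebesgue) = ennreal (LINT z|lebesgue. \<bar>?f z - ?g z\<bar>)"
      by (rule nn_integral_eq_integral) (use hi in auto)
    also have "\<dots> \<le> ennreal (e / 3)" using g(2) unfolding habs by (intro ennreal_leI) simp
    finally show ?thesis .
  qed
  \<comment> \<open>Chosen so that a uniform error \<open>d\<close> on \<open>K\<close> costs at
    most e/3; the 1 guards against a null set \<open>K\<close>.\<close>
  define d where "d = e / (3 * (measure lebesgue K + 1))"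
  have d: "d > 0" using e by (simp add: d_def add_nonneg_pos)
  have dm: "d * measure lebesgue K \<le> e / 3"
  proof -
    have "m / (m + 1) \<le> 1" if "0 \<le> m" for m :: real
      using that by (simp add: field_simps)
    from this[OF measure_nonneg]
    have "measure lebesgue K / (measure lebesgue K + 1) \<le> 1" .
    then have "(e / 3) * (measure lebesgue K / (measure lebesgue K + 1)) \<le> (e / 3) * 1"
      using e by (intro mult_left_mono) auto
    then show ?thesis by (simp add: d_def)
  qed
  have "uniformly_continuous_on K g"
    using compact_uniformly_continuous K g(1) continuous_on_subset by blast
  then obtain s2 where s2: "s2 > 0" "\<And>y z. y \<in> K \<Longrightarrow> z \<in> K \<Longrightarrow> dist z y < s2 \<Longrightarrow> dist (g z) (g y) < d"
    unfolding uniformly_continuous_on_def using d by metis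
  have main: "(LINT y|lebesgue. indicator V y * \<bar>average \<eta> s ?f y - F y\<bar>) \<le> e" if s: "0 < s" "s < min s0 s2" for s
  proof -
    let ?k = "\<lambda>z y. (1 / s ^ DIM('a)) * \<eta> ((1/s) *\<^sub>R (z - y))"
    have kbound: "integrable lebesgue (\<lambda>z. ?k z y * h z)" if hi: "integrable lebesgue h" for y h
    proof -
      obtain B where B: "B > 0" "\<And>z. \<bar>\<eta> z\<bar> \<le> B" using unit_test_bounded[OF \<eta>(1)] by blast
      have km: "(\<lambda>z. ?k z y) \<in> borel_measurable lebesgue"
        by (intro continuous_lebesgue_measurable smooth_continuous smooth_cmult smooth_affine sm)
      show ?thesis
      proof (rule Bochner_Integration.integrable_bound[where f="\<lambda>z. (1 / s ^ DIM('a)) * B * h z"])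
        show "integrable lebesgue (\<lambda>z. (1 / s ^ DIM('a)) * B * h z)" using hi by simp
        show "(\<lambda>z. ?k z y * h z) \<in> borel_measurable lebesgue"
          by (rule borel_measurable_times[OF km]) (use hi in simp)
        have "\<bar>?k z y * h z\<bar> \<le> \<bar>(1 / s ^ DIM('a)) * B * h z\<bar>" for z
          unfolding abs_mult using B by (intro mult_right_mono mult_left_mono) auto
        then show "AE z in lebesgue. norm (?k z y * h z) \<le> norm ((1 / s ^ DIM('a)) * B * h z)"
          by simp
      qed
    qed
    have avg: "average \<eta> s ?f y = average \<eta> s (\<lambda>z. ?f z - ?g z) y + average \<eta> s ?g y" for y
    proof -
      have "average \<eta> s ?f y = (LINT z|lebesgue. ?k z y * (?f z - ?g z) + ?k z y * ?g z)"
        unfolding average_def by (simp only: distrib_left[symmetric] diff_add_cancel)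
      also have "\<dots> = average \<eta> s (\<lambda>z. ?f z - ?g z) y + average \<eta> s ?g y"
        unfolding average_def by (rule Bochner_Integration.integral_add[OF kbound[OF hi] kbound[OF gi]])
      finally show ?thesis .
    qed
    have gavg: "\<bar>average \<eta> s ?g y - g y\<bar> \<le> d" if y: "y \<in> V" for y
    proof -
      have sub: "cball y s \<subseteq> K" using V[OF y] s by (meson less_imp_le min_less_iff_conj order_trans subset_cball)
      have yK: "y \<in> K" using sub s by auto
      note out = unit_test_scaled_zero[OF \<eta>(1) s(1)]
      have "average \<eta> s ?g y = (LINT z|lebesgue. (1 / s ^ DIM('a)) * (g z * \<eta> ((1/s) *\<^sub>R (z - y))))"
        unfolding average_def
      proof (rule Bochner_Integration.integral_cong[OF refl])
        fix z
        show "?k z y * ?g z = (1 / s ^ DIM('a)) * (g z * \<eta> ((1/s) *\<^sub>R (z - y)))"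
        proof (cases "z \<in> K")
          case False
          then have "\<eta> ((1/s) *\<^sub>R (z - y)) = 0" using out sub by blast
          then show ?thesis by simp
        qed simp
      qed
      also have "\<dots> = (1 / s ^ DIM('a)) * (LINT z|lebesgue. g z * \<eta> ((1/s) *\<^sub>R (z - y)))"
        by (rule integral_mult_right_zero)
      also have "(LINT z|lebesgue. g z * \<eta> ((1/s) *\<^sub>R (z - y))) = kernel_int (-c) c g \<eta> y s"
        unfolding kernel_int_def
      proof (rule lebesgue_integral_eq_cbox(2))
        show "continuous_on (cbox (-c) c) (\<lambda>z. g z * \<eta> ((1/s) *\<^sub>R (z - y)))"
          by (intro continuous_on_mult continuous_on_subset[OF g(1)] smooth_continuous smooth_affine sm) auto
        show "g z * \<eta> ((1/s) *\<^sub>R (z - y)) = 0" if "z \<notin> cbox (-c) c" for z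
        proof -
          have "z \<notin> cball y s" using that sub c by blast
          then show ?thesis using out by simp
        qed
      qed
      finally have eq: "average \<eta> s ?g y = (1 / s ^ DIM('a)) * kernel_int (-c) c g \<eta> y s" .
      show ?thesis unfolding eq
      proof (rule mollifier_close[OF continuous_on_subset[OF g(1)] \<eta>(1-3) s(1)])
        show "cball y s \<subseteq> cbox (-c) c" using sub c by blast
        show "\<bar>g z - g y\<bar> \<le> d" if "z \<in> cball y s" for z
          using s2(2)[OF yK, of z] sub that s by (force simp: dist_real_def dist_commute)
      qed simp
    qed
    have pt: "indicator V y * \<bar>average \<eta> s ?f y - F y\<bar> \<le>
       \<bar>average \<eta> s (\<lambda>z. ?f z - ?g z) y\<bar> + d * indicat_real K y + \<bar>?f y - ?g y\<bar>" for y
    proof (cases "y \<in> V")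
      case True
      have yK: "y \<in> K" using V[OF True] s0 by auto
      then show ?thesis using gavg[OF True] avg[of y] True by (simp add: indicator_def)
    qed (use d in simp)
    obtain G where G: "G \<in> borel_measurable lebesgue" "\<And>y. ennreal \<bar>average \<eta> s (\<lambda>z. ?f z - ?g z) y\<bar> \<le> G y"
      "(\<integral>\<^sup>+y. G y \<partial>lebesgue) = (\<integral>\<^sup>+z. ennreal \<bar>?f z - ?g z\<bar> \<partial>lebesgue)"
      using average_L1[OF \<eta> s(1) borel_measurable_integrable[OF hi]] by blast
    have m1: "(\<lambda>y. ennreal (d * indicat_real K y)) \<in> borel_measurable lebesgue"
      using Km(1) by measurable
    have m2: "(\<lambda>y. ennreal \<bar>?f y - ?g y\<bar>) \<in> borel_measurable lebesgue"
      using borel_measurable_integrable[OF hi] by measurable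
    have "(\<integral>\<^sup>+y. ennreal (indicator V y * \<bar>average \<eta> s ?f y - F y\<bar>) \<partial>lebesgue)
       \<le> (\<integral>\<^sup>+y. (ennreal (d * indicat_real K y) + ennreal \<bar>?f y - ?g y\<bar>) + G y \<partial>lebesgue)"
    proof (rule nn_integral_mono)
      fix y
      have "ennreal (indicator V y * \<bar>average \<eta> s ?f y - F y\<bar>) \<le>
        ennreal ((d * indicat_real K y + \<bar>?f y - ?g y\<bar>) + \<bar>average \<eta> s (\<lambda>z. ?f z - ?g z) y\<bar>)"
        using pt[of y] by (intro ennreal_leI) linarith
      also have "\<dots> = (ennreal (d * indicat_real K y) + ennreal \<bar>?f y - ?g y\<bar>) + ennreal \<bar>average \<eta> s (\<lambda>z. ?f z - ?g z) y\<bar>"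
        using d by (simp add: ennreal_plus)
      also have "\<dots> \<le> (ennreal (d * indicat_real K y) + ennreal \<bar>?f y - ?g y\<bar>) + G y"
        by (intro add_left_mono G)
      finally show "ennreal (indicator V y * \<bar>average \<eta> s ?f y - F y\<bar>) \<le>
        (ennreal (d * indicat_real K y) + ennreal \<bar>?f y - ?g y\<bar>) + G y" .
    qed
    also have "\<dots> = (\<integral>\<^sup>+y. ennreal (d * indicat_real K y) + ennreal \<bar>?f y - ?g y\<bar> \<partial>lebesgue) + (\<integral>\<^sup>+y. G y \<partial>lebesgue)"
      by (rule nn_integral_add[OF borel_measurable_add[OF m1 m2] G(1)])
    also have "\<dots> \<le> ennreal (e / 3) + ennreal (e / 3) + ennreal (e / 3)"
    proof (intro add_mono)
      have "(\<integral>\<^sup>+y. ennreal (d * indicat_real K y) + ennreal \<bar>?f y - ?g y\<bar> \<partial>lebesgue)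
        = (\<integral>\<^sup>+y. ennreal (d * indicat_real K y) \<partial>lebesgue) + (\<integral>\<^sup>+y. ennreal \<bar>?f y - ?g y\<bar> \<partial>lebesgue)"
        by (rule nn_integral_add[OF m1 m2])
      also have "(\<integral>\<^sup>+y. ennreal (d * indicat_real K y) \<partial>lebesgue) = ennreal (LINT y|lebesgue. d * indicat_real K y)"
        by (rule nn_integral_eq_integral) (use d Km in \<open>auto simp: lmeasurable_iff_integrable\<close>)
      also have "(LINT y|lebesgue. d * indicat_real K y) = d * measure lebesgue K"
        using Km by simp
      also have "ennreal (d * measure lebesgue K) + (\<integral>\<^sup>+y. ennreal \<bar>?f y - ?g y\<bar> \<partial>lebesgue) \<le> ennreal (e/3) + ennreal (e/3)"
        using dm h by (intro add_mono ennreal_leI)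
      finally show "(\<integral>\<^sup>+y. ennreal (d * indicat_real K y) + ennreal \<bar>?f y - ?g y\<bar> \<partial>lebesgue) \<le> ennreal (e/3) + ennreal (e/3)" .
      show "(\<integral>\<^sup>+y. G y \<partial>lebesgue) \<le> ennreal (e / 3)" unfolding G(3) by (rule h)
    qed
    also have "ennreal (e / 3) + ennreal (e / 3) + ennreal (e / 3) = ennreal e"
      using e by (simp add: ennreal_plus[symmetric] del: ennreal_plus)
    \<comment> \<open>The bound on the nonnegative integral passes to the Bochner integral without
      knowing that the integrand is integrable.\<close>
    finally show ?thesis using e by (intro integral_real_bounded) auto
  qed
  show ?thesis by (rule exI[of _ "min s0 s2"]) (use main s0 s2 in auto)
qed

section \<open>Smooth approximation of a function with weak gradient\<close>

text \<open>Integrability is asked of the majorant alone: a non-integrable left side has Bochner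
  integral 0, which lies below a nonnegative integral.\<close>

lemma set_integral_mono_nonneg:
  fixes f g :: "'a \<Rightarrow> real"
  assumes "set_integrable M A g" "\<And>y. y \<in> A \<Longrightarrow> f y \<le> g y" "\<And>y. y \<in> A \<Longrightarrow> 0 \<le> g y"
  shows "(LINT y:A|M. f y) \<le> (LINT y:A|M. g y)"
  unfolding set_lebesgue_integral_def
  by (rule integral_mono') (use assms in \<open>auto simp: set_integrable_def indicator_def\<close>)

lemma set_integrable_const_ball: "set_integrable lebesgue (ball x r) (\<lambda>_. c::real)"
  using lmeasurable_ball[of x r] by (simp add: set_integrable_def lmeasurable_iff_integrable)

lemma set_integral_const_ball: "(LINT y:ball x r|lebesgue. c) = c * measure lebesgue (ball x r)"
  by (simp add: set_lebesgue_integral_def)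

lemma set_integral_le_const:
  fixes g :: "'a \<Rightarrow> real"
  assumes A: "A \<in> sets M" "emeasure M A < \<infinity>" and e: "e \<ge> 0" "\<And>y. y \<in> A \<Longrightarrow> g y \<le> e"
  shows "(LINT y:A|M. g y) \<le> e * measure M A"
proof -
  have "(LINT y:A|M. g y) \<le> (LINT y:A|M. e)"
    by (rule set_integral_mono_nonneg) (use A e in \<open>auto simp: set_integrable_def integrable_indicator_iff\<close>)
  then show ?thesis using A by (simp add: set_lebesgue_integral_def mult.commute)
qed

lemma L1_loc_ball_integrable:
  fixes f :: "'a::euclidean_space \<Rightarrow> 'b::euclidean_space"
  assumes "L1_loc U f" "cball x r \<subseteq> U"
  shows "set_integrable lebesgue (ball x r) f"
proof (rule set_integrable_subset)
  show "set_integrable lebesgue (cball x r) f" using assms by (simp add: L1_loc_def)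
qed auto

lemma test_function_scaled:
  assumes f: "unit_test f" and s: "s > 0" and sub: "cball y s \<subseteq> U"
  shows "test_function_on U (\<lambda>z. f ((1/s) *\<^sub>R (z - y)))"
proof -
  have "{z. f ((1/s) *\<^sub>R (z - y)) \<noteq> 0} \<subseteq> cball y s"
    using unit_test_scaled_zero[OF f s] by blast
  then have c: "closure {z. f ((1/s) *\<^sub>R (z - y)) \<noteq> 0} \<subseteq> cball y s"
    by (rule closure_minimal) simp
  then have "compact (closure {z. f ((1/s) *\<^sub>R (z - y)) \<noteq> 0})"
    unfolding compact_eq_bounded_closed using bounded_subset[OF bounded_cball c] by simp
  then show ?thesis
    using c sub smooth_affine[OF unit_test_smooth[OF f]] unfolding test_function_on_def by auto
qed

text \<open>The rescaled mollifier is itself a test function, so the derivative falls on the weak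
  gradient. Two signs cancel, one from differentiating the kernel in its centre and one from
  integration by parts.\<close>

lemma weak_gradient_average:
  fixes u :: "'a::euclidean_space \<Rightarrow> real"
  assumes u: "continuous_on (cbox a b) u" and wg: "has_weak_gradient_on (box a b) u Du"
    and \<eta>: "unit_test \<eta>" and s: "s > 0" and K: "cball y s \<subseteq> K" "K \<subseteq> box a b" and i: "i \<in> Basis"
  shows "pd i (\<lambda>y. (1 / s ^ DIM('a)) * kernel_int a b u \<eta> y s) y
     = average \<eta> s (\<lambda>z. indicat_real K z * (Du z \<bullet> i)) y"
proof -
  have sm: "smooth \<eta>" using \<eta> unit_test_smooth by blast
  let ?\<tau> = "\<lambda>z. \<eta> ((1/s) *\<^sub>R (z - y))"
  have \<tau>: "test_function_on (box a b) ?\<tau>" using test_function_scaled[OF \<eta> s] K by blast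
  have pd\<tau>: "pd i ?\<tau> z = (1/s) * pd i \<eta> ((1/s) *\<^sub>R (z - y))" for z by (rule pd_affine[OF sm i])
  have out: "h ((1/s) *\<^sub>R (z - y)) = 0" if "unit_test h" "z \<notin> K" for z h
    using unit_test_scaled_zero[OF that(1) s] that(2) K by blast
  have kc: "K \<subseteq> cbox a b" using K(2) box_subset_cbox by blast
  have "pd i (\<lambda>y. (1 / s ^ DIM('a)) * kernel_int a b u \<eta> y s) y
     = (1 / s ^ DIM('a)) * (- (1/s) * kernel_int a b u (pd i \<eta>) y s)"
    unfolding pd_kernel_int[OF u sm i, symmetric]
    by (rule pd_cmult[OF smooth_differentiable[OF smooth_kernel_int[OF u sm]]])
  also have "kernel_int a b u (pd i \<eta>) y s = (LINT z|lebesgue. u z * pd i \<eta> ((1/s) *\<^sub>R (z - y)))"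
    unfolding kernel_int_def
  proof (rule lebesgue_integral_eq_cbox(2)[symmetric])
    show "continuous_on (cbox a b) (\<lambda>z. u z * pd i \<eta> ((1/s) *\<^sub>R (z - y)))"
      by (intro continuous_on_mult u smooth_continuous smooth_affine smooth_pd sm i)
    show "u z * pd i \<eta> ((1/s) *\<^sub>R (z - y)) = 0" if "z \<notin> cbox a b" for z
    proof -
      have "z \<notin> K" using that kc by blast
      then show ?thesis using out[OF unit_test_pd[OF \<eta> i]] by simp
    qed
  qed
  also have "- (1/s) * (LINT z|lebesgue. u z * pd i \<eta> ((1/s) *\<^sub>R (z - y)))
     = - (LINT z|lebesgue. (1/s) * (u z * pd i \<eta> ((1/s) *\<^sub>R (z - y))))"
    by simp
  also have "(LINT z|lebesgue. (1/s) * (u z * pd i \<eta> ((1/s) *\<^sub>R (z - y)))) = (LINT z|lebesgue. u z * pd i ?\<tau> z)"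
    unfolding pd\<tau> by (simp only: mult.left_commute)
  also have "(LINT z|lebesgue. u z * pd i ?\<tau> z) = - (LINT z|lebesgue. ?\<tau> z * (Du z \<bullet> i))"
    using wg \<tau> i unfolding has_weak_gradient_on_iff by blast
  also have "- (- (LINT z|lebesgue. ?\<tau> z * (Du z \<bullet> i))) = (LINT z|lebesgue. ?\<tau> z * (Du z \<bullet> i))" by simp
  also have "(1 / s ^ DIM('a)) * (LINT z|lebesgue. ?\<tau> z * (Du z \<bullet> i))
     = (LINT z|lebesgue. (1 / s ^ DIM('a)) * (?\<tau> z * (Du z \<bullet> i)))"
    by (rule integral_mult_right_zero[symmetric])
  also have "\<dots> = average \<eta> s (\<lambda>z. indicat_real K z * (Du z \<bullet> i)) y"
    unfolding average_def
  proof (rule Bochner_Integration.integral_cong[OF refl])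
    fix z
    show "(1 / s ^ DIM('a)) * (?\<tau> z * (Du z \<bullet> i)) = (1 / s ^ DIM('a)) * ?\<tau> z * (indicat_real K z * (Du z \<bullet> i))"
    proof (cases "z \<in> K")
      case False
      then have "?\<tau> z = 0" using out[OF \<eta>] by blast
      then show ?thesis by simp
    qed simp
  qed
  finally show ?thesis .
qed

text \<open>Exactly what \<open>has_traceI\<close> consumes: uniform closeness up to the sphere,
  available because \<open>u\<close> is continuous, and closeness of the gradients in the mean. One
  mollification at a small scale does both.\<close>

lemma smooth_approximation:
  fixes u :: "'a::euclidean_space \<Rightarrow> real"
  assumes u: "continuous_on (cbox a b) u" and wg: "has_weak_gradient_on (box a b) u Du"
    and sub: "cball x r \<subseteq> box a b" and e: "e > 0"
  obtains \<phi> where "smooth \<phi>" "\<And>y. y \<in> cball x r \<Longrightarrow> \<bar>\<phi> y - u y\<bar> \<le> e"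
    "(LINT y:ball x r|lebesgue. norm (grad \<phi> y - Du y)) \<le> e"
proof -
  obtain \<psi> \<eta> :: "'a \<Rightarrow> real" where \<eta>: "unit_test \<eta>" "\<And>z. \<eta> z \<ge> 0" "integral UNIV \<eta> = 1" "\<And>z. \<eta> (- z) = \<eta> z"
    using radial_mollifier by metis
  have sm: "smooth \<eta>" using \<eta>(1) unit_test_smooth by blast
  obtain \<epsilon> where \<epsilon>: "\<epsilon> > 0" "(\<Union>y\<in>cball x r. ball y \<epsilon>) \<subseteq> box a b"
    using compact_subset_open_imp_ball_epsilon_subset[OF compact_cball open_box sub] by blast
  define s0 where "s0 = \<epsilon> / 2"
  have s0: "s0 > 0" "s0 < \<epsilon>" using \<epsilon> by (auto simp: s0_def)
  \<comment> \<open>The closed \<open>s0\<close>-neighbourhood of the ball. Cutting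
    \<open>Du\<close> off outside it gives a function integrable on the whole space and leaves the
    averages at points of the ball unchanged.\<close>
  define K where "K = {p + q |p q. p \<in> cball x r \<and> q \<in> cball (0::'a) s0}"
  have Kc: "compact K" unfolding K_def by (intro compact_sums compact_cball)
  have Kb: "K \<subseteq> box a b"
  proof
    fix z assume "z \<in> K"
    then obtain p q where pq: "z = p + q" "p \<in> cball x r" "q \<in> cball 0 s0" by (auto simp: K_def)
    then have "z \<in> ball p \<epsilon>" using s0 by (simp add: dist_norm)
    then show "z \<in> box a b" using pq(2) \<epsilon>(2) by blast
  qed
  have KV: "cball y s0 \<subseteq> K" if "y \<in> cball x r" for y
  proof
    fix z assume "z \<in> cball y s0"
    then have "z = y + (z - y)" "z - y \<in> cball 0 s0" by (auto simp: dist_norm norm_minus_commute)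
    then show "z \<in> K" unfolding K_def using that by blast
  qed
  have L: "L1_loc (box a b) u" "L1_loc (box a b) Du" using wg by (auto simp: has_weak_gradient_on_iff)
  have Di: "integrable lebesgue (\<lambda>z. indicat_real K z * (Du z \<bullet> i))" for i
  proof -
    have "integrable lebesgue (\<lambda>z. indicat_real K z *\<^sub>R Du z)"
      using L(2) Kc Kb unfolding L1_loc_def set_integrable_def by blast
    from integrable_inner_left[OF this, of i] show ?thesis by simp
  qed
  define e' where "e' = e / real DIM('a)"
  have e': "e' > 0" using e by (simp add: e'_def)
  have "\<forall>i. \<exists>s1>0. \<forall>s. 0 < s \<and> s < s1 \<longrightarrow>
    (LINT y|lebesgue. indicator (ball x r) y * \<bar>average \<eta> s (\<lambda>z. indicat_real K z * (Du z \<bullet> i)) y - Du y \<bullet> i\<bar>) \<le> e'"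
    by (intro allI, rule mollify_L1[OF \<eta> Di Kc s0(1) _ e']) (use KV ball_subset_cball in blast)
  from choice[OF this] obtain s1 where s1: "\<And>i. s1 i > 0" "\<And>i s. 0 < s \<Longrightarrow> s < s1 i \<Longrightarrow>
    (LINT y|lebesgue. indicator (ball x r) y * \<bar>average \<eta> s (\<lambda>z. indicat_real K z * (Du z \<bullet> i)) y - Du y \<bullet> i\<bar>) \<le> e'"
    by blast
  have "uniformly_continuous_on (cbox a b) u" by (rule compact_uniformly_continuous[OF u compact_cbox])
  then obtain s2 where s2: "s2 > 0" "\<And>y z. y \<in> cbox a b \<Longrightarrow> z \<in> cbox a b \<Longrightarrow> dist z y < s2 \<Longrightarrow> dist (u z) (u y) < e"
    unfolding uniformly_continuous_on_def using e by metis
  define s where "s = min (min s0 s2) (Min (s1 ` Basis)) / 2"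
  have m1: "Min (s1 ` Basis) > 0" using s1(1) by (simp add: nonempty_Basis)
  have gen: "0 < min (min p q) t / 2 \<and> min (min p q) t / 2 < p \<and> min (min p q) t / 2 < q \<and> min (min p q) t / 2 < t"
    if "0 < p" "0 < q" "0 < t" for p q t :: real using that by (simp add: min_def)
  have s: "s > 0" "s < s0" "s < s2" "s < Min (s1 ` Basis)"
    using gen[OF s0(1) s2(1) m1] unfolding s_def by blast+
  have ss1: "s < s1 i" if "i \<in> Basis" for i
  proof -
    have "Min (s1 ` Basis) \<le> s1 i" using that by simp
    then show ?thesis using s(4) by linarith
  qed
  define \<phi> where "\<phi> = (\<lambda>y. (1 / s ^ DIM('a)) * kernel_int a b u \<eta> y s)"
  have sm\<phi>: "smooth \<phi>" unfolding \<phi>_def by (intro smooth_cmult smooth_kernel_int[OF u sm])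
  have subs: "cball y s \<subseteq> K" if "y \<in> cball x r" for y
    using KV[OF that] s(2) subset_cball[of s s0 y] by auto
  have 1: "\<bar>\<phi> y - u y\<bar> \<le> e" if y: "y \<in> cball x r" for y
    unfolding \<phi>_def
  proof (rule mollifier_close[OF u \<eta>(1-3) s(1)])
    have sc: "cball y s \<subseteq> cbox a b" using subs[OF y] Kb box_subset_cbox by blast
    then show "cball y s \<subseteq> cbox a b" .
    show "\<bar>u z - u y\<bar> \<le> e" if z: "z \<in> cball y s" for z
    proof -
      have "y \<in> cball y s" using s(1) by simp
      then have "y \<in> cbox a b" "z \<in> cbox a b" using sc z by blast+
      moreover have "dist z y < s2" using z s(3) by (simp add: dist_commute)
      ultimately have "dist (u z) (u y) < e" by (rule s2(2))
      then show ?thesis by (simp add: dist_real_def)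
    qed
  qed
  let ?h = "\<lambda>i y. indicat_real (ball x r) y * \<bar>pd i \<phi> y - Du y \<bullet> i\<bar>"
  have hi: "integrable lebesgue (?h i)" if i: "i \<in> Basis" for i
  proof -
    have "set_integrable lebesgue (ball x r) (pd i \<phi>)"
      by (rule L1_loc_ball_integrable[OF L1_loc_continuous sub]) (intro smooth_continuous smooth_pd sm\<phi> i)
    moreover have "set_integrable lebesgue (ball x r) (\<lambda>y. Du y \<bullet> i)"
      using integrable_inner_left[OF L1_loc_ball_integrable[OF L(2) sub, unfolded set_integrable_def], of i]
      unfolding set_integrable_def by simp
    ultimately have "set_integrable lebesgue (ball x r) (\<lambda>y. \<bar>pd i \<phi> y - Du y \<bullet> i\<bar>)"
      by (intro set_integrable_abs set_integral_diff)
    then show ?thesis by (simp add: set_integrable_def)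
  qed
  have "(LINT y:ball x r|lebesgue. norm (grad \<phi> y - Du y)) \<le> (LINT y|lebesgue. (\<Sum>i\<in>Basis. ?h i y))"
    unfolding set_lebesgue_integral_def
  proof (rule integral_mono')
    show "integrable lebesgue (\<lambda>y. \<Sum>i\<in>Basis. ?h i y)" using hi by (intro Bochner_Integration.integrable_sum)
    show "indicat_real (ball x r) y *\<^sub>R norm (grad \<phi> y - Du y) \<le> (\<Sum>i\<in>Basis. ?h i y)" for y
    proof -
      have "norm (grad \<phi> y - Du y) \<le> (\<Sum>i\<in>Basis. \<bar>(grad \<phi> y - Du y) \<bullet> i\<bar>)" by (rule norm_le_l1)
      also have "\<dots> = (\<Sum>i\<in>Basis. \<bar>pd i \<phi> y - Du y \<bullet> i\<bar>)"
        by (intro sum.cong) (auto simp: inner_diff_left grad_inner_Basis)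
      finally show ?thesis by (simp add: sum_distrib_left[symmetric] indicator_def)
    qed
  qed (simp add: sum_nonneg)
  also have "\<dots> = (\<Sum>i\<in>Basis. LINT y|lebesgue. ?h i y)"
    using hi by (intro Bochner_Integration.integral_sum)
  also have "\<dots> \<le> (\<Sum>i\<in>(Basis::'a set). e')"
  proof (rule sum_mono)
    fix i :: 'a assume i: "i \<in> Basis"
    have "(LINT y|lebesgue. ?h i y) =
       (LINT y|lebesgue. indicator (ball x r) y * \<bar>average \<eta> s (\<lambda>z. indicat_real K z * (Du z \<bullet> i)) y - Du y \<bullet> i\<bar>)"
    proof (rule Bochner_Integration.integral_cong[OF refl])
      fix y
      show "?h i y = indicator (ball x r) y * \<bar>average \<eta> s (\<lambda>z. indicat_real K z * (Du z \<bullet> i)) y - Du y \<bullet> i\<bar>"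
      proof (cases "y \<in> ball x r")
        case True
        then have "y \<in> cball x r" by simp
        then show ?thesis
          unfolding \<phi>_def using weak_gradient_average[OF u wg \<eta>(1) s(1) subs Kb i] by simp
      qed simp
    qed
    then show "(LINT y|lebesgue. ?h i y) \<le> e'" using s1(2)[OF s(1) ss1[OF i]] by simp
  qed
  also have "\<dots> = e" by (simp add: e'_def)
  finally have 2: "(LINT y:ball x r|lebesgue. norm (grad \<phi> y - Du y)) \<le> e" .
  show ?thesis using that[OF sm\<phi> 1 2] .
qed

section \<open>Traces and competitors\<close>

text \<open>The measure is a multiple of the image of Lebesgue measure on the punctured ball under
  radial projection: its mass comes from the volume of the ball, and projected points lie on the
  sphere.\<close>

lemma sphere_measure_finite:
  assumes r: "r > 0"
  shows "emeasure (sphere_measure x r) (space (sphere_measure x r)) < \<infinity>"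
    and "sets (sphere_measure x r) = sets borel"
    and "AE y in sphere_measure (x::'a::euclidean_space) r. y \<in> sphere x r"
proof -
  let ?f = "\<lambda>y. x + (r / norm (y - x)) *\<^sub>R (y - x)"
  let ?R = "restrict_space lborel (ball x r - {x})"
  have fm: "?f \<in> ?R \<rightarrow>\<^sub>M borel"
  proof -
    have "continuous_on (ball x r - {x}) ?f"
      by (intro continuous_intros) auto
    then have "?f \<in> borel_measurable (restrict_space borel (ball x r - {x}))"
      by (rule borel_measurable_continuous_on_restrict)
    then show ?thesis
      by (simp add: measurable_def space_restrict_space sets_restrict_space)
  qed
  show s: "sets (sphere_measure x r) = sets borel" by (simp add: sphere_measure_def)
  have em: "emeasure (sphere_measure x r) A = ennreal (real DIM('a) / r) * emeasure lborel (?f -` A \<inter> (ball x r - {x}))"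
    if "A \<in> sets borel" for A
  proof -
    have "emeasure (sphere_measure x r) A = ennreal (real DIM('a) / r) * emeasure ?R (?f -` A \<inter> space ?R)"
      unfolding sphere_measure_def using that fm by (simp add: emeasure_distr)
    also have "emeasure ?R (?f -` A \<inter> space ?R) = emeasure lborel (?f -` A \<inter> space ?R)"
      by (rule emeasure_restrict_space) (auto simp: space_restrict_space)
    finally show ?thesis by (simp add: space_restrict_space)
  qed
  have "space (sphere_measure x r) = UNIV" using s sets_eq_imp_space_eq[OF s] by simp
  then have "emeasure (sphere_measure x r) (space (sphere_measure x r))
     = ennreal (real DIM('a) / r) * emeasure lborel (ball x r - {x})"
    using em[of UNIV] by simp
  also have "\<dots> < \<infinity>"
  proof -
    have "emeasure lborel (ball x r - {x}) \<le> emeasure lborel (ball x r)" by (intro emeasure_mono) auto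
    also have "\<dots> < \<infinity>" by (rule emeasure_lborel_ball_finite)
    finally show ?thesis by (simp add: ennreal_mult_less_top)
  qed
  finally show "emeasure (sphere_measure x r) (space (sphere_measure x r)) < \<infinity>" .
  have "?f y \<in> sphere x r" if "y \<in> ball x r - {x}" for y
    using that r by (simp add: dist_norm)
  then have "?f -` (- sphere x r) \<inter> (ball x r - {x}) = {}" by blast
  then have "emeasure (sphere_measure x r) (- sphere x r) = 0"
    using em[of "- sphere x r"] by (simp only: emeasure_empty) simp
  then show "AE y in sphere_measure x r. y \<in> sphere x r"
    by (intro AE_I[where N="- sphere x r"]) (auto simp: s)
qed

text \<open>The trace is cut off outside the sphere only to make it Borel measurable on the whole space.\<close>

lemma has_traceI:
  fixes v :: "'a::euclidean_space \<Rightarrow> real"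
  assumes r: "r > 0" and v: "continuous_on (cball x r) v"
    and wg: "has_weak_gradient_on (ball x r) v Dv" and Dv: "L1_on (ball x r) Dv"
    and approx: "\<And>e. e > 0 \<Longrightarrow> \<exists>\<phi>. smooth \<phi> \<and> (\<forall>y\<in>cball x r. \<bar>\<phi> y - v y\<bar> \<le> e) \<and>
      (LINT y:ball x r|lebesgue. norm (grad \<phi> y - Dv y)) \<le> e"
  shows "has_trace x r v (\<lambda>y. indicator (sphere x r) y * v y)"
  unfolding has_trace_def
proof (intro conjI)
  let ?t = "\<lambda>y. indicat_real (sphere x r) y * v y"
  note sph = sphere_measure_finite[OF r, of x]
  interpret finite_measure "sphere_measure x r" by (rule finite_measureI) (use sph(1) in auto)
  obtain B where B: "B > 0" "\<And>y. y \<in> cball x r \<Longrightarrow> \<bar>v y\<bar> \<le> B"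
    using continuous_compact_support_bounded[OF v compact_cball] by blast
  show "integrable (sphere_measure x r) ?t"
  proof (rule integrable_const_bound[where B=B])
    show "AE y in sphere_measure x r. norm (?t y) \<le> B"
      using B by (intro AE_I2) (auto simp: indicator_def)
    have "?t \<in> borel_measurable borel"
      using borel_measurable_continuous_on_indicator[of "sphere x r" v] continuous_on_subset[OF v, of "sphere x r"]
      by (auto simp: sphere_cball)
    then show "?t \<in> borel_measurable (sphere_measure x r)" using sph(2) measurable_cong_sets by blast
  qed
  show "L1_on (ball x r) v"
    unfolding L1_on_def
    by (rule L1_loc_ball_integrable[OF L1_loc_continuous[OF v]]) simp
  define e where "e = (\<lambda>k. 1 / real (Suc k))"
  have e0: "e k > 0" for k by (simp add: e_def)
  have elim: "e \<longlonglongrightarrow> 0" unfolding e_def using LIMSEQ_inverse_real_of_nat by (simp add: divide_inverse)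
  obtain \<phi> where \<phi>: "\<And>k. smooth (\<phi> k)" "\<And>k y. y \<in> cball x r \<Longrightarrow> \<bar>\<phi> k y - v y\<bar> \<le> e k"
    "\<And>k. (LINT y:ball x r|lebesgue. norm (grad (\<phi> k) y - Dv y)) \<le> e k"
    using approx[OF e0] by metis
  show "\<exists>Dv \<phi>. has_weak_gradient_on (ball x r) v Dv \<and> L1_on (ball x r) Dv \<and> (\<forall>k. smooth (\<phi> k)) \<and>
      (\<lambda>k::nat. LINT y:ball x r|lebesgue. \<bar>\<phi> k y - v y\<bar>) \<longlonglongrightarrow> 0 \<and>
      (\<lambda>k. LINT y:ball x r|lebesgue. norm (grad (\<phi> k) y - Dv y)) \<longlonglongrightarrow> 0 \<and>
      (\<lambda>k. LINT y|sphere_measure x r. \<bar>\<phi> k y - ?t y\<bar>) \<longlonglongrightarrow> 0"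
  proof (intro exI conjI allI)
    show "has_weak_gradient_on (ball x r) v Dv" "L1_on (ball x r) Dv" "smooth (\<phi> k)" for k by fact+
    show "(\<lambda>k. LINT y:ball x r|lebesgue. norm (grad (\<phi> k) y - Dv y)) \<longlonglongrightarrow> 0"
      by (rule tendsto_sandwich[OF _ _ tendsto_const elim])
        (use \<phi>(3) in \<open>auto simp: set_lebesgue_integral_def intro!: always_eventually Bochner_Integration.integral_nonneg\<close>)
    show "(\<lambda>k. LINT y:ball x r|lebesgue. \<bar>\<phi> k y - v y\<bar>) \<longlonglongrightarrow> 0"
    proof (rule tendsto_sandwich[OF _ _ tendsto_const])
      show "(\<lambda>k. e k * measure lebesgue (ball x r)) \<longlonglongrightarrow> 0" using tendsto_mult_left_zero[OF elim] .
      have "(LINT y:ball x r|lebesgue. \<bar>\<phi> k y - v y\<bar>) \<le> e k * measure lebesgue (ball x r)" for k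
        by (rule set_integral_le_const) (use \<phi>(2) e0[of k] lmeasurable_ball in \<open>auto simp: fmeasurable_def less_imp_le\<close>)
      then show "\<forall>\<^sub>F k in sequentially. (LINT y:ball x r|lebesgue. \<bar>\<phi> k y - v y\<bar>) \<le> e k * measure lebesgue (ball x r)"
        by simp
    qed (auto simp: set_lebesgue_integral_def intro!: always_eventually Bochner_Integration.integral_nonneg)
    show "(\<lambda>k. LINT y|sphere_measure x r. \<bar>\<phi> k y - ?t y\<bar>) \<longlonglongrightarrow> 0"
    proof (rule tendsto_sandwich[OF _ _ tendsto_const])
      let ?m = "measure (sphere_measure x r) (space (sphere_measure x r))"
      show "(\<lambda>k. e k * ?m) \<longlonglongrightarrow> 0" using tendsto_mult_left_zero[OF elim] .
      have "(LINT y|sphere_measure x r. \<bar>\<phi> k y - ?t y\<bar>) \<le> e k * ?m" for k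
      proof (cases "integrable (sphere_measure x r) (\<lambda>y. \<bar>\<phi> k y - ?t y\<bar>)")
        case True
        have "(LINT y|sphere_measure x r. \<bar>\<phi> k y - ?t y\<bar>) \<le> (LINT y|sphere_measure x r. e k)"
        proof (rule integral_mono_AE[OF True])
          show "AE y in sphere_measure x r. \<bar>\<phi> k y - ?t y\<bar> \<le> e k"
            using sph(3) by eventually_elim (use \<phi>(2)[of _ k] in \<open>auto simp: indicator_def\<close>)
        qed simp
        then show ?thesis by (simp add: mult.commute)
      next
        case False
        then have "(LINT y|sphere_measure x r. \<bar>\<phi> k y - ?t y\<bar>) = 0" by (rule not_integrable_integral_eq)
        then show ?thesis using e0[of k] by simp
      qed
      then show "\<forall>\<^sub>F k in sequentially. (LINT y|sphere_measure x r. \<bar>\<phi> k y - ?t y\<bar>) \<le> e k * ?m" by simp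
    qed (auto intro!: always_eventually Bochner_Integration.integral_nonneg)
  qed
qed

lemma test_function_sphere:
  assumes "test_function_on (ball x r) \<phi>" "y \<in> sphere x r"
  shows "\<phi> y = 0"
proof (rule test_function_zero(1)[OF assms(1)])
  have "y \<notin> ball x r" using assms(2) by simp
  then show "y \<notin> closure {x. \<phi> x \<noteq> 0}" using assms(1) unfolding test_function_on_def by blast
qed

lemma grad_one_minus:
  assumes "smooth \<eta>"
  shows "grad (\<lambda>y. 1 - \<eta> y) y = - grad \<eta> y"
proof (rule grad_unique)
  have "((\<lambda>y. 1 - \<eta> y) has_derivative (\<lambda>h. 0 - grad \<eta> y \<bullet> h)) (at y)"
    by (intro has_derivative_diff has_derivative_const smooth_has_derivative assms)
  then show "((\<lambda>y. 1 - \<eta> y) has_derivative (\<lambda>h. (- grad \<eta> y) \<bullet> h)) (at y)" by simp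
qed

context
  fixes a b :: "'a::euclidean_space" and u :: "'a \<Rightarrow> real" and Du :: "'a \<Rightarrow> 'a" and x :: 'a and r :: real
  assumes u: "continuous_on (cbox a b) u" and wg: "has_weak_gradient_on (box a b) u Du"
    and sub: "cball x r \<subseteq> box a b" and r: "r > 0"
begin

lemma has_trace_self: "has_trace x r u (\<lambda>y. indicator (sphere x r) y * u y)"
proof (rule has_traceI[OF r])
  show "continuous_on (cball x r) u"
    using continuous_on_subset[OF u] sub box_subset_cbox by blast
  show "has_weak_gradient_on (ball x r) u Du"
    using has_weak_gradient_on_subset[OF wg] sub ball_subset_cball by blast
  have "L1_loc (box a b) Du" using wg by (simp add: has_weak_gradient_on_iff)
  then show "L1_on (ball x r) Du" unfolding L1_on_def using sub by (rule L1_loc_ball_integrable)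
  show "\<exists>\<phi>. smooth \<phi> \<and> (\<forall>y\<in>cball x r. \<bar>\<phi> y - u y\<bar> \<le> e) \<and>
      (LINT y:ball x r|lebesgue. norm (grad \<phi> y - Du y)) \<le> e" if "e > 0" for e
    by (rule smooth_approximation[OF u wg sub that]) (intro exI conjI ballI)
qed

text \<open>One family for both uses: \<open>w\<close> equal to the central value of
  \<open>u\<close> times \<open>\<eta>\<close> gives the hole filling competitor, and
  \<open>\<eta>\<close> = 0 gives the additive variation. If phi approximates \<open>u\<close>, then
  (1 - \<open>\<eta>\<close>) phi + \<open>w\<close> approximates the competitor, and it has the
  values of phi on the sphere.\<close>

lemma competitor_perturb:
  assumes L2: "L2_on (ball x r) Du" and \<eta>: "test_function_on (ball x r) \<eta>" and w: "test_function_on (ball x r) w"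
  shows "competitor x r u (\<lambda>y. (1 - \<eta> y) * u y + w y)
     (\<lambda>y. (1 - \<eta> y) *\<^sub>R Du y - u y *\<^sub>R grad \<eta> y + grad w y)" (is "competitor x r u ?v ?Dv")
proof -
  have s: "smooth \<eta>" "smooth w" using \<eta> w by (auto simp: test_function_on_def)
  have s1: "smooth (\<lambda>y. 1 - \<eta> y)" by (intro smooth_diff smooth_const s)
  have ucont: "continuous_on (cball x r) u"
    using continuous_on_subset[OF u] sub box_subset_cbox by blast
  have vcont: "continuous_on (cball x r) ?v"
    by (intro continuous_on_add continuous_on_mult smooth_continuous s s1 ucont)
  have "has_weak_gradient_on (box a b) ?v (\<lambda>y. ((1 - \<eta> y) *\<^sub>R Du y + u y *\<^sub>R grad (\<lambda>y. 1 - \<eta> y) y) + grad w y)"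
    by (rule has_weak_gradient_on_add[OF has_weak_gradient_on_mult[OF wg s1] has_weak_gradient_on_smooth[OF s(2)]])
  then have wgv: "has_weak_gradient_on (box a b) ?v ?Dv" by (simp add: grad_one_minus s)
  have wgb: "has_weak_gradient_on (ball x r) ?v ?Dv"
    using has_weak_gradient_on_subset[OF wgv] sub ball_subset_cball by blast
  have LD: "set_integrable lebesgue (ball x r) Du" "set_integrable lebesgue (ball x r) ?Dv"
    using wg wgv sub by (auto simp: has_weak_gradient_on_iff intro!: L1_loc_ball_integrable[of "box a b"])
  have LDv: "L1_on (ball x r) ?Dv" using LD by (simp add: L1_on_def)
  have L1v: "L1_on (ball x r) ?v"
    unfolding L1_on_def by (rule L1_loc_ball_integrable[OF L1_loc_continuous[OF vcont]]) simp
  obtain B where B: "B > 0" "\<And>y. y \<in> cball x r \<Longrightarrow> \<bar>1 - \<eta> y\<bar> \<le> B"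
    using continuous_compact_support_bounded[OF smooth_continuous[OF s1] compact_cball] by blast
  have "continuous_on (cball x r) (\<lambda>y. norm (grad \<eta> y))"
    by (intro continuous_on_norm grad_continuous s)
  then obtain E where E: "E > 0" "\<And>y. y \<in> cball x r \<Longrightarrow> \<bar>norm (grad \<eta> y)\<bar> \<le> E"
    using continuous_compact_support_bounded[OF _ compact_cball] by blast
  have "continuous_on (cball x r) (\<lambda>y. norm (- (u y *\<^sub>R grad \<eta> y) + grad w y))"
    by (intro continuous_on_norm continuous_on_add continuous_on_minus continuous_on_scaleR grad_continuous s ucont)
  then obtain C where C: "C > 0" "\<And>y. y \<in> cball x r \<Longrightarrow> \<bar>norm (- (u y *\<^sub>R grad \<eta> y) + grad w y)\<bar> \<le> C"
    using continuous_compact_support_bounded[OF _ compact_cball] by blast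
  have bi: "integrable lebesgue (indicat_real (ball x r))"
    using lmeasurable_ball[of x r] by (simp add: lmeasurable_iff_integrable)
  have L2v: "L2_on (ball x r) ?Dv"
    unfolding L2_on_def
  proof
    have m: "(\<lambda>y. indicat_real (ball x r) y *\<^sub>R ?Dv y) \<in> borel_measurable lebesgue"
      using borel_measurable_integrable[OF LD(2)[unfolded set_integrable_def]] .
    then show "set_borel_measurable lebesgue (ball x r) ?Dv" by (simp add: set_borel_measurable_def)
    have D2: "integrable lebesgue (\<lambda>y. indicat_real (ball x r) y * (norm (Du y))\<^sup>2)"
      using L2 by (simp add: L2_on_def set_integrable_def)
    show "set_integrable lebesgue (ball x r) (\<lambda>y. (norm (?Dv y))\<^sup>2)"
      unfolding set_integrable_def
    proof (rule Bochner_Integration.integrable_bound)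
      let ?g = "\<lambda>y. 2 * B\<^sup>2 * (indicat_real (ball x r) y * (norm (Du y))\<^sup>2) + 2 * C\<^sup>2 * indicat_real (ball x r) y"
      show "integrable lebesgue ?g" using D2 bi by simp
      have "(\<lambda>y. indicat_real (ball x r) y *\<^sub>R (norm (?Dv y))\<^sup>2) = (\<lambda>y. (norm (indicat_real (ball x r) y *\<^sub>R ?Dv y))\<^sup>2)"
        by (auto simp: indicator_def fun_eq_iff)
      then show "(\<lambda>y. indicat_real (ball x r) y *\<^sub>R (norm (?Dv y))\<^sup>2) \<in> borel_measurable lebesgue"
        using borel_measurable_power[OF measurable_compose[OF m borel_measurable_norm], of 2] by simp
      have "(norm (?Dv y))\<^sup>2 \<le> 2 * B\<^sup>2 * (norm (Du y))\<^sup>2 + 2 * C\<^sup>2" if "y \<in> ball x r" for y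
      proof -
        have y: "y \<in> cball x r" using that by simp
        have "?Dv y = (1 - \<eta> y) *\<^sub>R Du y + (- (u y *\<^sub>R grad \<eta> y) + grad w y)" by simp
        then have "norm (?Dv y) \<le> norm ((1 - \<eta> y) *\<^sub>R Du y) + norm (- (u y *\<^sub>R grad \<eta> y) + grad w y)"
          by (simp only: norm_triangle_ineq)
        also have "\<dots> \<le> B * norm (Du y) + C"
          using B(2)[OF y] C(2)[OF y] by (intro add_mono) (auto intro: mult_right_mono)
        finally have "(norm (?Dv y))\<^sup>2 \<le> (B * norm (Du y) + C)\<^sup>2" by (intro power_mono) auto
        also have "\<dots> \<le> 2 * B\<^sup>2 * (norm (Du y))\<^sup>2 + 2 * C\<^sup>2"
          using sum_squares_bound[of "B * norm (Du y)" C] by (simp add: power2_sum power_mult_distrib)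
        finally show ?thesis .
      qed
      then show "AE y in lebesgue. norm (indicat_real (ball x r) y *\<^sub>R (norm (?Dv y))\<^sup>2) \<le> norm (?g y)"
        by (intro AE_I2) (simp add: indicator_def)
    qed
  qed
  have "has_trace x r ?v (\<lambda>y. indicator (sphere x r) y * ?v y)"
  proof (rule has_traceI[OF r vcont wgb LDv])
    fix e :: real assume e: "e > 0"
    let ?V = "measure lebesgue (ball x r)"
    \<comment> \<open>The approximation error of \<open>u\<close> enters the gradient of the product
      twice, through the factor 1 - \<open>\<eta>\<close> (bounded by \<open>B\<close>) and through
      grad \<open>\<eta>\<close> (bounded by \<open>E\<close>, over the whole volume). The
      denominator accounts for both and stays positive.\<close>
    define e' where "e' = e / (B + E * ?V + 1)"
    have pos: "B + E * ?V + 1 > 0" using B(1) E(1) by (simp add: add_pos_nonneg)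
    have e': "e' > 0" using e pos by (simp add: e'_def)
    have ee: "e' * (B + E * ?V + 1) = e" using pos by (simp add: e'_def)
    have eB: "B * e' + E * e' * ?V \<le> e" using ee e' by (simp add: algebra_simps)
    have eB': "B * e' \<le> e"
    proof -
      have "0 \<le> E * e' * ?V" using E(1) e' by simp
      then show ?thesis using eB by linarith
    qed
    obtain \<phi> where \<phi>: "smooth \<phi>" "\<And>y. y \<in> cball x r \<Longrightarrow> \<bar>\<phi> y - u y\<bar> \<le> e'"
      "(LINT y:ball x r|lebesgue. norm (grad \<phi> y - Du y)) \<le> e'"
      by (rule smooth_approximation[OF u wg sub e']) (rule that)
    let ?\<phi> = "\<lambda>y. (1 - \<eta> y) * \<phi> y + w y"
    have "smooth ?\<phi>" by (intro smooth_add smooth_mult s1 s \<phi>(1))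
    moreover have "\<bar>?\<phi> y - ?v y\<bar> \<le> e" if y: "y \<in> cball x r" for y
    proof -
      have "?\<phi> y - ?v y = (1 - \<eta> y) * (\<phi> y - u y)" by (simp add: algebra_simps)
      then have "\<bar>?\<phi> y - ?v y\<bar> = \<bar>1 - \<eta> y\<bar> * \<bar>\<phi> y - u y\<bar>" by (simp only: abs_mult)
      also have "\<dots> \<le> B * e'" using B(2)[OF y] \<phi>(2)[OF y] B(1) by (intro mult_mono) auto
      finally show ?thesis using eB' by linarith
    qed
    moreover have "(LINT y:ball x r|lebesgue. norm (grad ?\<phi> y - ?Dv y)) \<le> e"
    proof -
      have gd: "grad ?\<phi> y = (1 - \<eta> y) *\<^sub>R grad \<phi> y + \<phi> y *\<^sub>R (- grad \<eta> y) + grad w y" for y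
        using grad_add[of "\<lambda>y. (1 - \<eta> y) * \<phi> y" y w] grad_mult[of "\<lambda>y. 1 - \<eta> y" y \<phi>] s s1 \<phi>(1)
        by (simp add: smooth_differentiable smooth_mult grad_one_minus)
      have "set_integrable lebesgue (ball x r) (grad \<phi>)"
        by (rule L1_loc_ball_integrable[OF L1_loc_continuous[of "cball x r"]]) (auto intro: grad_continuous \<phi>)
      then have gi: "set_integrable lebesgue (ball x r) (\<lambda>y. B * norm (grad \<phi> y - Du y))"
        by (intro set_integrable_mult_right set_integrable_norm set_integral_diff LD)
      note ci = set_integrable_const_ball[of x r "E * e'"]
      have "(LINT y:ball x r|lebesgue. norm (grad ?\<phi> y - ?Dv y)) \<le>
         (LINT y:ball x r|lebesgue. B * norm (grad \<phi> y - Du y) + E * e')"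
      proof (rule set_integral_mono_nonneg[OF set_integral_add(1)[OF gi ci]])
        fix y assume "y \<in> ball x r"
        then have y: "y \<in> cball x r" by simp
        have "grad ?\<phi> y - ?Dv y = (1 - \<eta> y) *\<^sub>R (grad \<phi> y - Du y) + (u y - \<phi> y) *\<^sub>R grad \<eta> y"
          unfolding gd by (simp add: algebra_simps)
        also have "norm \<dots> \<le> \<bar>1 - \<eta> y\<bar> * norm (grad \<phi> y - Du y) + \<bar>u y - \<phi> y\<bar> * norm (grad \<eta> y)"
          by (rule norm_triangle_le) simp
        also have "\<dots> \<le> B * norm (grad \<phi> y - Du y) + e' * E"
          using B(2)[OF y] \<phi>(2)[OF y] E(2)[OF y] e' by (intro add_mono mult_mono) (auto simp: abs_minus_commute)
        finally show "norm (grad ?\<phi> y - ?Dv y) \<le> B * norm (grad \<phi> y - Du y) + E * e'" by (simp add: mult.commute)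
        show "0 \<le> B * norm (grad \<phi> y - Du y) + E * e'" using B(1) E(1) e' by simp
      qed
      also have "\<dots> = B * (LINT y:ball x r|lebesgue. norm (grad \<phi> y - Du y)) + E * e' * ?V"
        unfolding set_integral_add(2)[OF gi ci] by (simp add: set_integral_const_ball)
      also have "\<dots> \<le> B * e' + E * e' * ?V" using \<phi>(3) B(1) by simp
      finally show ?thesis using eB by linarith
    qed
    ultimately show "\<exists>\<phi>. smooth \<phi> \<and> (\<forall>y\<in>cball x r. \<bar>\<phi> y - ?v y\<bar> \<le> e) \<and>
      (LINT y:ball x r|lebesgue. norm (grad \<phi> y - ?Dv y)) \<le> e" by blast
  qed
  moreover have "(\<lambda>y. indicat_real (sphere x r) y * ?v y) = (\<lambda>y. indicat_real (sphere x r) y * u y)"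
    by (auto simp: fun_eq_iff indicator_def test_function_sphere[OF \<eta>] test_function_sphere[OF w])
  ultimately have "same_trace x r ?v u" unfolding same_trace_def using has_trace_self by metis
  then show ?thesis unfolding competitor_def using L1v wgb L2v by blast
qed

end

section \<open>Reduction to the Dirichlet energy in one phase\<close>

definition compact_almost_minimizer :: "('a::euclidean_space \<Rightarrow> real) \<Rightarrow> ('a \<Rightarrow> real) \<Rightarrow>
    real \<Rightarrow> real \<Rightarrow> 'a set \<Rightarrow> ('a \<Rightarrow> real) \<Rightarrow> bool" where
  "compact_almost_minimizer qp qm \<kappa> \<alpha> \<Omega> u \<longleftrightarrow> u \<in> K_loc \<Omega> \<and>
     (\<forall>x r Du v Dv. 0 < r \<and> cball x r \<subseteq> \<Omega> \<and> has_weak_gradient_on (ball x r) u Du \<and>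
        competitor x r u v Dv \<longrightarrow>
        J qp qm x r u Du \<le> (1 + \<kappa> * r powr \<alpha>) * J qp qm x r v Dv)"

lemma Linfty_square_integrable:
  fixes q :: "'a::euclidean_space \<Rightarrow> real"
  assumes q: "Linfty_on \<Omega> q"
  shows "\<exists>M\<ge>0. \<forall>x r. ball x r \<subseteq> \<Omega> \<longrightarrow> set_integrable lebesgue (ball x r) (\<lambda>y. (q y)\<^sup>2) \<and>
    (LINT y:ball x r|lebesgue. (q y)\<^sup>2) \<le> M * measure lebesgue (ball x r)"
proof -
  obtain M where M: "AE y in lebesgue. y \<in> \<Omega> \<longrightarrow> \<bar>q y\<bar> \<le> M" using q by (auto simp: Linfty_on_def)
  have m: "(\<lambda>y. indicat_real \<Omega> y * q y) \<in> borel_measurable lebesgue"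
    using q by (simp add: Linfty_on_def set_borel_measurable_def)
  have "set_integrable lebesgue (ball x r) (\<lambda>y. (q y)\<^sup>2) \<and>
    (LINT y:ball x r|lebesgue. (q y)\<^sup>2) \<le> M\<^sup>2 * measure lebesgue (ball x r)" if sub: "ball x r \<subseteq> \<Omega>" for x r
  proof -
    have bi: "integrable lebesgue (indicat_real (ball x r))"
      using lmeasurable_ball[of x r] by (simp add: lmeasurable_iff_integrable)
    have AE: "AE y in lebesgue. indicat_real (ball x r) y *\<^sub>R (q y)\<^sup>2 \<le> M\<^sup>2 * indicat_real (ball x r) y"
      using M
    proof eventually_elim
      case (elim y)
      show ?case
      proof (cases "y \<in> ball x r")
        case True
        then have "\<bar>q y\<bar> \<le> M" using elim sub by blast
        then have "(q y)\<^sup>2 \<le> M\<^sup>2" by (rule abs_le_square_iff[THEN iffD1, OF order_trans]) simp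
        then show ?thesis unfolding indicator_simps(1)[OF True] by simp
      qed simp
    qed
    have eq: "(\<lambda>y. indicat_real (ball x r) y *\<^sub>R (q y)\<^sup>2) =
       (\<lambda>y. indicat_real (ball x r) y * (indicat_real \<Omega> y * q y)\<^sup>2)"
      using sub by (auto simp: fun_eq_iff indicator_def)
    have "integrable lebesgue (\<lambda>y. indicat_real (ball x r) y *\<^sub>R (q y)\<^sup>2)"
    proof (rule Bochner_Integration.integrable_bound)
      show "integrable lebesgue (\<lambda>y. M\<^sup>2 * indicat_real (ball x r) y)" using bi by simp
      show "(\<lambda>y. indicat_real (ball x r) y *\<^sub>R (q y)\<^sup>2) \<in> borel_measurable lebesgue"
        unfolding eq using bi by (intro borel_measurable_times borel_measurable_power m) simp
      show "AE y in lebesgue. norm (indicat_real (ball x r) y *\<^sub>R (q y)\<^sup>2) \<le> norm (M\<^sup>2 * indicat_real (ball x r) y)"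
        using AE by eventually_elim simp
    qed
    moreover from this have "(LINT y|lebesgue. indicat_real (ball x r) y *\<^sub>R (q y)\<^sup>2) \<le> (LINT y|lebesgue. M\<^sup>2 * indicat_real (ball x r) y)"
      using bi AE by (intro integral_mono_AE) auto
    ultimately show ?thesis using bi by (simp add: set_integrable_def set_lebesgue_integral_def)
  qed
  then show ?thesis by (intro exI[of _ "M\<^sup>2"]) auto
qed

text \<open>In a ball where the function has one sign, exactly one characteristic function is active
  and equals 1, so the volume term is the same for all functions of that sign.\<close>

lemma J_sign:
  assumes sgn: "(\<forall>y\<in>ball x r. 0 < v y) \<and> q = qp \<or> (\<forall>y\<in>ball x r. v y < 0) \<and> q = qm"
    and L2: "L2_on (ball x r) Dv" and q: "set_integrable lebesgue (ball x r) (\<lambda>y. (q y)\<^sup>2)"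
  shows "J qp qm x r v Dv = (LINT y:ball x r|lebesgue. (norm (Dv y))\<^sup>2) + (LINT y:ball x r|lebesgue. (q y)\<^sup>2)"
proof -
  have "J qp qm x r v Dv = (LINT y:ball x r|lebesgue. (norm (Dv y))\<^sup>2 + (q y)\<^sup>2)"
    unfolding J_def set_lebesgue_integral_def
  proof (rule Bochner_Integration.integral_cong[OF refl])
    fix y
    show "indicat_real (ball x r) y *\<^sub>R ((norm (Dv y))\<^sup>2 + (qp y)\<^sup>2 * indicator {y. v y > 0} y + (qm y)\<^sup>2 * indicator {y. v y < 0} y)
      = indicat_real (ball x r) y *\<^sub>R ((norm (Dv y))\<^sup>2 + (q y)\<^sup>2)"
    proof (cases "y \<in> ball x r")
      case True
      from sgn show ?thesis
      proof
        assume "(\<forall>y\<in>ball x r. 0 < v y) \<and> q = qp"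
        then have "0 < v y" "q = qp" using True by auto
        then show ?thesis by simp
      next
        assume "(\<forall>y\<in>ball x r. v y < 0) \<and> q = qm"
        then have "v y < 0" "q = qm" using True by auto
        then show ?thesis by simp
      qed
    qed simp
  qed
  also have "\<dots> = (LINT y:ball x r|lebesgue. (norm (Dv y))\<^sup>2) + (LINT y:ball x r|lebesgue. (q y)\<^sup>2)"
    by (rule set_integral_add(2)) (use L2 q in \<open>auto simp: L2_on_def\<close>)
  finally show ?thesis .
qed

definition energy :: "('a::euclidean_space \<Rightarrow> 'a) \<Rightarrow> 'a \<Rightarrow> real \<Rightarrow> real" where
  "energy Du x r = (LINT y:ball x r|lebesgue. (norm (Du y))\<^sup>2)"

lemma energy_nonneg: "energy Du x r \<ge> 0"
  unfolding energy_def set_lebesgue_integral_def by (intro Bochner_Integration.integral_nonneg) simp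

lemma energy_mono:
  assumes "L2_on (ball x' r') Du" "ball x r \<subseteq> ball x' r'"
  shows "energy Du x r \<le> energy Du x' r'"
  unfolding energy_def set_lebesgue_integral_def
proof (rule integral_mono')
  show "integrable lebesgue (\<lambda>y. indicat_real (ball x' r') y *\<^sub>R (norm (Du y))\<^sup>2)"
    using assms(1) by (simp add: L2_on_def set_integrable_def)
  show "indicat_real (ball x r) y *\<^sub>R (norm (Du y))\<^sup>2 \<le> indicat_real (ball x' r') y *\<^sub>R (norm (Du y))\<^sup>2" for y
    using assms(2) by (intro scaleR_right_mono) (auto simp: indicator_def)
qed simp

text \<open>The condition \<open>0 < u y * ...\<close> keeps the competitor in the phase of
  \<open>u\<close>. Both sides of the almost minimality then contain the same integral of q^2, which
  cancels up to the factor \<open>\<kappa> * r powr \<alpha>\<close>; boundedness of q turns that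
  rest into a multiple of r^n.\<close>

lemma dirichlet_comparison:
  fixes u :: "'a::euclidean_space \<Rightarrow> real"
  assumes am: "compact_almost_minimizer qp qm \<kappa> \<alpha> \<Omega> u" and \<kappa>: "\<kappa> > 0"
    and q: "Linfty_on \<Omega> qp" "Linfty_on \<Omega> qm"
    and box: "cbox a b \<subseteq> \<Omega>" and u: "continuous_on (cbox a b) u"
    and sgn: "(\<forall>y\<in>cbox a b. 0 < u y) \<or> (\<forall>y\<in>cbox a b. u y < 0)"
    and wg: "has_weak_gradient_on (box a b) u Du" and L2: "\<And>x r. cball x r \<subseteq> box a b \<Longrightarrow> L2_on (ball x r) Du"
  shows "\<exists>M\<ge>0. \<forall>x r \<eta> w. 0 < r \<and> cball x r \<subseteq> box a b \<and> test_function_on (ball x r) \<eta> \<and> test_function_on (ball x r) w \<and>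
     (\<forall>y\<in>ball x r. 0 < u y * ((1 - \<eta> y) * u y + w y)) \<longrightarrow>
     energy Du x r \<le> (1 + \<kappa> * r powr \<alpha>) *
        energy (\<lambda>y. (1 - \<eta> y) *\<^sub>R Du y - u y *\<^sub>R grad \<eta> y + grad w y) x r
        + \<kappa> * r powr \<alpha> * (M * r powr real DIM('a))"
proof -
  obtain Mp where Mp: "Mp \<ge> 0" "\<And>x r. ball x r \<subseteq> \<Omega> \<Longrightarrow> set_integrable lebesgue (ball x r) (\<lambda>y. (qp y)\<^sup>2)"
    "\<And>x r. ball x r \<subseteq> \<Omega> \<Longrightarrow> (LINT y:ball x r|lebesgue. (qp y)\<^sup>2) \<le> Mp * measure lebesgue (ball x r)"
    using Linfty_square_integrable[OF q(1)] by blast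
  obtain Mm where Mm: "Mm \<ge> 0" "\<And>x r. ball x r \<subseteq> \<Omega> \<Longrightarrow> set_integrable lebesgue (ball x r) (\<lambda>y. (qm y)\<^sup>2)"
    "\<And>x r. ball x r \<subseteq> \<Omega> \<Longrightarrow> (LINT y:ball x r|lebesgue. (qm y)\<^sup>2) \<le> Mm * measure lebesgue (ball x r)"
    using Linfty_square_integrable[OF q(2)] by blast
  \<comment> \<open>Volume of the unit ball, which converts the measure of a ball into a power of
    its radius.\<close>
  let ?c = "unit_ball_vol (real DIM('a))"
  show ?thesis
  proof (intro exI[of _ "(Mp + Mm) * ?c"] conjI allI impI)
    show "0 \<le> (Mp + Mm) * ?c" using Mp(1) Mm(1) by simp
    fix x r \<eta> w
    assume H: "0 < r \<and> cball x r \<subseteq> box a b \<and> test_function_on (ball x r) \<eta> \<and> test_function_on (ball x r) w \<and>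
     (\<forall>y\<in>ball x r. 0 < u y * ((1 - \<eta> y) * u y + w y))"
    let ?v = "\<lambda>y. (1 - \<eta> y) * u y + w y"
    let ?Dv = "\<lambda>y. (1 - \<eta> y) *\<^sub>R Du y - u y *\<^sub>R grad \<eta> y + grad w y"
    have r: "0 < r" and sub: "cball x r \<subseteq> box a b" and t: "test_function_on (ball x r) \<eta>" "test_function_on (ball x r) w"
      and pos: "\<And>y. y \<in> ball x r \<Longrightarrow> 0 < u y * ?v y"
      using H by auto
    have "ball x r \<subseteq> cbox a b" using sub box_subset_cbox[of a b] ball_subset_cball[of x r] by blast
    then have sgn: "(\<forall>y\<in>ball x r. 0 < u y \<and> 0 < ?v y) \<or> (\<forall>y\<in>ball x r. u y < 0 \<and> ?v y < 0)"
      using sgn pos unfolding zero_less_mult_iff by (meson less_asym subsetD)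
    have b\<Omega>: "cball x r \<subseteq> \<Omega>" using sub box box_subset_cbox[of a b] by (meson order_trans)
    then have b\<Omega>': "ball x r \<subseteq> \<Omega>" using ball_subset_cball by (rule order_trans[rotated])
    have comp: "competitor x r u ?v ?Dv"
      by (rule competitor_perturb[OF u wg sub r L2[OF sub] t])
    then have L2v: "L2_on (ball x r) ?Dv" by (simp add: competitor_def)
    have wgb: "has_weak_gradient_on (ball x r) u Du"
      using has_weak_gradient_on_subset[OF wg] sub ball_subset_cball by blast
    have le: "J qp qm x r u Du \<le> (1 + \<kappa> * r powr \<alpha>) * J qp qm x r ?v ?Dv"
      using am r b\<Omega> wgb comp unfolding compact_almost_minimizer_def by blast
    have "\<exists>q. ((\<forall>y\<in>ball x r. 0 < u y) \<and> q = qp \<or> (\<forall>y\<in>ball x r. u y < 0) \<and> q = qm) \<and>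
       ((\<forall>y\<in>ball x r. 0 < ?v y) \<and> q = qp \<or> (\<forall>y\<in>ball x r. ?v y < 0) \<and> q = qm) \<and> (q = qp \<or> q = qm)"
      using sgn by blast
    then obtain q where sq: "(\<forall>y\<in>ball x r. 0 < u y) \<and> q = qp \<or> (\<forall>y\<in>ball x r. u y < 0) \<and> q = qm"
       "(\<forall>y\<in>ball x r. 0 < ?v y) \<and> q = qp \<or> (\<forall>y\<in>ball x r. ?v y < 0) \<and> q = qm" and qq: "q = qp \<or> q = qm"
      by blast
    have qi: "set_integrable lebesgue (ball x r) (\<lambda>y. (q y)\<^sup>2)" using qq Mp(2)[OF b\<Omega>'] Mm(2)[OF b\<Omega>'] by blast
    have vol: "measure lebesgue (ball x r) = ?c * r powr real DIM('a)"
      using r by (simp add: content_ball measure_completion powr_realpow)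
    have qb: "(LINT y:ball x r|lebesgue. (q y)\<^sup>2) \<le> (Mp + Mm) * ?c * r powr real DIM('a)"
    proof -
      have "(LINT y:ball x r|lebesgue. (q y)\<^sup>2) \<le> (Mp + Mm) * measure lebesgue (ball x r)"
      proof -
        have "0 \<le> Mp * measure lebesgue (ball x r)" "0 \<le> Mm * measure lebesgue (ball x r)" using Mp(1) Mm(1) by auto
        then show ?thesis using qq Mp(3)[OF b\<Omega>'] Mm(3)[OF b\<Omega>'] unfolding distrib_right by (elim disjE) simp_all
      qed
      then show ?thesis unfolding vol by (simp only: mult.assoc)
    qed
    have "energy Du x r + (LINT y:ball x r|lebesgue. (q y)\<^sup>2) \<le> (1 + \<kappa> * r powr \<alpha>) *
      (energy ?Dv x r + (LINT y:ball x r|lebesgue. (q y)\<^sup>2))"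
      using le unfolding J_sign[OF sq(1) L2[OF sub] qi] J_sign[OF sq(2) L2v qi] energy_def .
    moreover have "\<kappa> * r powr \<alpha> * (LINT y:ball x r|lebesgue. (q y)\<^sup>2) \<le> \<kappa> * r powr \<alpha> * ((Mp + Mm) * ?c * r powr real DIM('a))"
      using qb \<kappa> by (intro mult_left_mono) auto
    ultimately show "energy Du x r \<le> (1 + \<kappa> * r powr \<alpha>) *
        energy ?Dv x r + \<kappa> * r powr \<alpha> * ((Mp + Mm) * ?c * r powr real DIM('a))"
      unfolding distrib_left distrib_right by linarith
  qed
qed

section \<open>Energy decay and the bootstrap\<close>

text \<open>With a small \<open>t\<close> the coefficient of the first vector stays close to 1,
  which is essential when it carries the full energy.\<close>

lemma young_norm_square:
  fixes p q :: "'a::real_normed_vector"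
  assumes t: "t > 0"
  shows "(norm (p + q))\<^sup>2 \<le> (1 + t) * (norm p)\<^sup>2 + (1 + 1 / t) * (norm q)\<^sup>2"
proof -
  have "(norm (p + q))\<^sup>2 \<le> (norm p + norm q)\<^sup>2" by (intro power_mono norm_triangle_ineq) auto
  also have "\<dots> = (norm p)\<^sup>2 + 2 * (norm p * norm q) + (norm q)\<^sup>2" by (simp add: power2_sum)
  also have "2 * (norm p * norm q) \<le> t * (norm p)\<^sup>2 + (1 / t) * (norm q)\<^sup>2"
  proof -
    have "0 \<le> (t * norm p - norm q)\<^sup>2" by simp
    then have "2 * (norm p * norm q) * t \<le> (t * (norm p)\<^sup>2 + (1 / t) * (norm q)\<^sup>2) * t"
      using t by (simp add: power2_diff power2_eq_square algebra_simps)
    then show ?thesis using t by simp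
  qed
  finally show ?thesis by (simp add: algebra_simps)
qed

text \<open>Passing from radius 4r to r multiplies the power r^m by 4^(-m); since theta 4^m <= 1/2,
  half of the claimed constant survives the recursion and the other half pays for the inhomogeneous
  term.\<close>

lemma quarter_iteration:
  fixes \<phi> :: "real \<Rightarrow> real"
  assumes r0: "r0 > 0" and m: "m \<ge> 0" and C: "C \<ge> 0" and \<theta>: "\<theta> \<ge> 0" "\<theta> * 4 powr m \<le> 1/2"
    and nn: "\<And>r. 0 \<le> \<phi> r" and mono: "\<And>r. 0 < r \<Longrightarrow> r \<le> r0 \<Longrightarrow> \<phi> r \<le> B"
    and step: "\<And>r. 0 < r \<Longrightarrow> r \<le> r0 \<Longrightarrow> \<phi> (r/4) \<le> \<theta> * \<phi> r + C * r powr m"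
    and r: "0 < r" "r \<le> r0"
  shows "\<phi> r \<le> (B * 4 powr m / r0 powr m + 2 * C * 4 powr m) * r powr m"
proof -
  \<comment> \<open>The first summand settles the radii in (r0/4, r0] by monotonicity; the second
    makes C 4^m at most half of \<open>A\<close>.\<close>
  define A where "A = B * 4 powr m / r0 powr m + 2 * C * 4 powr m"
  have B: "B \<ge> 0" using mono[OF r0] nn[of r0] by simp
  have A: "A \<ge> 0" using B C by (simp add: A_def)
  \<comment> \<open>Induction over the dyadic depth, in layers of ratio 4: the hypothesis is used at
    4r, or at r itself if 4r already exceeds \<open>r0\<close>.\<close>
  have "\<forall>r. r0 / 4 ^ Suc k < r \<and> r \<le> r0 \<longrightarrow> \<phi> r \<le> A * r powr m" for k
  proof (induction k)
    case 0
    show ?case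
    proof (intro allI impI)
      fix r assume r: "r0 / 4 ^ Suc 0 < r \<and> r \<le> r0"
      then have rp: "r > 0" using r0 by (auto intro: less_trans[of 0 "r0/4"])
      have "r0 powr m \<le> (4 * r) powr m" using r r0 m by (intro powr_mono2) auto
      then have "1 \<le> 4 powr m * r powr m / r0 powr m" using r0 rp by (simp add: powr_mult)
      then have "B * 1 \<le> B * (4 powr m * r powr m / r0 powr m)" using B by (intro mult_left_mono)
      also have "\<dots> = B * 4 powr m / r0 powr m * r powr m" by simp
      also have "\<dots> \<le> A * r powr m" unfolding A_def using C by (intro mult_right_mono) auto
      finally show "\<phi> r \<le> A * r powr m" using mono[OF rp] r by simp
    qed
  next
    case (Suc k)
    show ?case
    proof (intro allI impI)
      fix r assume r: "r0 / 4 ^ Suc (Suc k) < r \<and> r \<le> r0"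
      show "\<phi> r \<le> A * r powr m"
      proof (cases "4 * r \<le> r0")
        case True
        have rp: "r > 0" using r r0 by (auto intro: less_trans[of 0 "r0 / 4 ^ Suc (Suc k)"])
        have "r0 / 4 ^ Suc k < 4 * r" using r by (simp add: field_simps)
        then have IH: "\<phi> (4 * r) \<le> A * (4 * r) powr m" using Suc True by blast
        have "\<phi> r \<le> \<theta> * \<phi> (4 * r) + C * (4 * r) powr m" using step[of "4 * r"] rp True by simp
        also have "\<dots> \<le> \<theta> * (A * (4 * r) powr m) + C * (4 * r) powr m"
          using IH \<theta>(1) by (intro add_right_mono mult_left_mono)
        also have "\<dots> = ((\<theta> * 4 powr m) * A + C * 4 powr m) * r powr m"
          using rp by (simp add: powr_mult algebra_simps)
        also have "\<dots> \<le> A * r powr m"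
        proof (rule mult_right_mono)
          have "(\<theta> * 4 powr m) * A \<le> 1/2 * A" using \<theta>(2) A by (rule mult_right_mono)
          moreover have "2 * C * 4 powr m \<le> A" unfolding A_def using B by simp
          ultimately show "(\<theta> * 4 powr m) * A + C * 4 powr m \<le> A" by simp
        qed simp
        finally show ?thesis .
      next
        case False
        then have "r0 / 4 ^ Suc k < r"
        proof -
          have "r0 / 4 ^ Suc k \<le> r0 / 4" using r0 by (simp add: field_simps)
          then show ?thesis using False by simp
        qed
        then show ?thesis using Suc r by blast
      qed
    qed
  qed
  moreover obtain k where "r0 / 4 ^ Suc k < r"
  proof -
    obtain k where "r0 / r < 4 ^ k" using real_arch_pow[of 4 "r0 / r"] by auto
    also have "\<dots> \<le> (4::real) ^ Suc k" by simp
    finally have "r0 / 4 ^ Suc k < r" using r by (simp add: field_simps)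
    then show ?thesis using that by blast
  qed
  ultimately show ?thesis using r unfolding A_def by blast
qed

lemma ball_volume_powr:
  "r > 0 \<Longrightarrow> measure lebesgue (ball (x::'a::euclidean_space) r) = unit_ball_vol (real DIM('a)) * r powr real DIM('a)"
  by (simp add: content_ball measure_completion powr_realpow)

text \<open>What remains of the problem after the reduction: a comparison inequality for the
  Dirichlet energy, with neither traces nor volume terms. The constant sign is stated through
  products, so that both phases are treated together.\<close>

locale dirichlet_almost_minimizer =
  fixes a b :: "'a::euclidean_space" and u :: "'a \<Rightarrow> real" and Du :: "'a \<Rightarrow> 'a" and \<kappa> \<alpha> M :: real
  assumes dim: "DIM('a) \<ge> 2"
    and u: "continuous_on (cbox a b) u" and wg: "has_weak_gradient_on (box a b) u Du"
    and L2: "\<And>x r. cball x r \<subseteq> box a b \<Longrightarrow> L2_on (ball x r) Du"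
    and \<kappa>: "\<kappa> > 0" and \<alpha>: "0 < \<alpha>" "\<alpha> \<le> 1" and M: "M \<ge> 0"
    and sgn: "\<And>x y. x \<in> cbox a b \<Longrightarrow> y \<in> cbox a b \<Longrightarrow> 0 < u x * u y"
    and comparison: "\<And>x r \<eta> w. 0 < r \<Longrightarrow> cball x r \<subseteq> box a b \<Longrightarrow>
       test_function_on (ball x r) \<eta> \<Longrightarrow> test_function_on (ball x r) w \<Longrightarrow>
       (\<And>y. y \<in> ball x r \<Longrightarrow> 0 < u y * ((1 - \<eta> y) * u y + w y)) \<Longrightarrow>
       energy Du x r \<le> (1 + \<kappa> * r powr \<alpha>) * energy (\<lambda>y. (1 - \<eta> y) *\<^sub>R Du y - u y *\<^sub>R grad \<eta> y + grad w y) x r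
        + \<kappa> * r powr \<alpha> * (M * r powr real DIM('a))"
begin

lemma subset_cbox: "cball x r \<subseteq> box a b \<Longrightarrow> y \<in> ball x r \<Longrightarrow> y \<in> cbox a b"
  using box_subset_cbox[of a b] ball_subset_cball[of x r] by blast

lemma energy_integrable:
  "cball x r \<subseteq> box a b \<Longrightarrow> set_integrable lebesgue (ball x r) (\<lambda>y. (norm (Du y))\<^sup>2)"
  using L2[of x r] by (simp add: L2_on_def)

text \<open>The competitor loses a fixed share of the energy on the quarter ball and has leading
  coefficient (1 + k)(1 + t), close to 1, on the whole ball. After cancellation only the small
  excess over 1 multiplies the full energy, so the factor \<open>\<theta>\<close> can be made as
  small as desired, as the iteration with an arbitrary exponent requires.\<close>

lemma hole_filling:
  assumes \<theta>: "\<theta> > 0"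
  shows "\<exists>r0>0. \<exists>C\<ge>0. r0 \<le> 1 \<and> (\<forall>x r d. 0 < r \<and> r \<le> r0 \<and> cball x r \<subseteq> box a b \<and>
     (\<forall>y\<in>ball x r. \<bar>u y - u x\<bar> \<le> d) \<longrightarrow>
     energy Du x (r/4) \<le> \<theta> * energy Du x r + C * (r powr (real DIM('a) - 2) * d\<^sup>2 + r powr real DIM('a)))"
proof -
  let ?n = "real DIM('a)"
  let ?c = "unit_ball_vol ?n"
  obtain \<zeta> :: "'a \<Rightarrow> real" and c where \<zeta>: "unit_test \<zeta>" "\<And>z. 0 \<le> \<zeta> z" "\<And>z. \<zeta> z \<le> 1"
     and c: "c > 0" "\<And>z. norm z \<le> 1/2 \<Longrightarrow> c \<le> \<zeta> z"
    using cutoff by metis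
  have sm: "smooth \<zeta>" using \<zeta>(1) unit_test_smooth by blast
  obtain F where F: "F > 0" "\<And>z. norm (grad \<zeta> z) \<le> F" using unit_test_grad_bounded[OF \<zeta>(1)] by blast
  \<comment> \<open>Aims at (1 + t)^2 <= 1 + 3t <= 1 + c theta, where 1 + c theta bounds the leading
    coefficient and division by \<open>c\<close> leaves theta.\<close>
  define t where "t = min 1 (c * \<theta> / 3)"
  have t: "0 < t" "t \<le> 1" "3 * t \<le> c * \<theta>" using c \<theta> by (auto simp: t_def min_def field_simps)
  \<comment> \<open>Below this radius the almost minimality error
    \<open>\<kappa> * r powr \<alpha>\<close> is at most \<open>t\<close>.\<close>
  define r0 where "r0 = min 1 ((t / \<kappa>) powr (1 / \<alpha>))"
  have r0: "r0 > 0" "r0 \<le> 1" using t \<kappa> by (auto simp: r0_def)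
  have rk: "\<kappa> * r powr \<alpha> \<le> t" if "0 < r" "r \<le> r0" for r
  proof -
    have "r powr \<alpha> \<le> ((t / \<kappa>) powr (1 / \<alpha>)) powr \<alpha>" using that \<alpha> by (intro powr_mono2) (auto simp: r0_def)
    also have "\<dots> = t / \<kappa>" using \<alpha> t \<kappa> by (simp add: powr_powr)
    finally show ?thesis using \<kappa> by (simp add: field_simps)
  qed
  define C1 where "C1 = (1 + \<kappa>) * ((1 + 1 / t) * (2 * F)\<^sup>2 * ?c) / c"
  define C2 where "C2 = \<kappa> * M / c"
  have C1: "C1 \<ge> 0" using \<kappa> t c F by (simp add: C1_def)
  have C2: "C2 \<ge> 0" using \<kappa> M c by (simp add: C2_def)
  have main: "energy Du x (r/4) \<le> \<theta> * energy Du x r + (C1 + C2) * (r powr (?n - 2) * d\<^sup>2 + r powr ?n)"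
    if r: "0 < r" "r \<le> r0" and sub: "cball x r \<subseteq> box a b" and d: "\<And>y. y \<in> ball x r \<Longrightarrow> \<bar>u y - u x\<bar> \<le> d" for x r d
  proof -
    have d0: "d \<ge> 0" using d[of x] r by simp
    \<comment> \<open>The cutoff at scale r/2 is supported inside the open ball of radius r, and it
      is at least \<open>c\<close> on the ball of radius r/4, its own half ball.\<close>
    define s where "s = r / 2"
    have s: "s > 0" "s < r" using r by (auto simp: s_def)
    define \<eta> where "\<eta> = (\<lambda>y. \<zeta> ((1/s) *\<^sub>R (y - x)))"
    have sub_s: "cball x s \<subseteq> ball x r" using s by (simp add: cball_subset_ball_iff)
    have \<eta>t: "test_function_on (ball x r) \<eta>" unfolding \<eta>_def by (rule test_function_scaled[OF \<zeta>(1) s(1) sub_s])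
    define w where "w = (\<lambda>y. u x * \<eta> y)"
    have wt: "test_function_on (ball x r) w" unfolding w_def by (rule test_function_mult[OF \<eta>t smooth_const])
    have \<eta>01: "0 \<le> \<eta> y" "\<eta> y \<le> 1" for y using \<zeta> by (auto simp: \<eta>_def)
    have \<eta>sm: "smooth \<eta>" using \<eta>t by (simp add: test_function_on_def)
    have gw: "grad w y = u x *\<^sub>R grad \<eta> y" for y
      unfolding w_def using grad_mult[of "\<lambda>_. u x" y \<eta>] \<eta>sm
      by (simp add: smooth_differentiable grad_def)
    have g\<eta>: "norm (grad \<eta> y) \<le> F / s" for y
    proof -
      have "norm (grad \<eta> y) = (1/s) * norm (grad \<zeta> ((1/s) *\<^sub>R (y - x)))"
        unfolding \<eta>_def grad_affine[OF sm] using s(1) by simp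
      also have "\<dots> \<le> (1/s) * F" using F(2) s(1) by (intro mult_left_mono) auto
      finally show ?thesis by simp
    qed
    have xin: "x \<in> ball x r" using r by simp
    have sg: "0 < u y * ((1 - \<eta> y) * u y + w y)" if "y \<in> ball x r" for y
    proof -
      have pos: "0 < u y * u y" "0 < u y * u x" using sgn subset_cbox[OF sub] that xin by blast+
      have "0 < (1 - \<eta> y) * (u y * u y) + \<eta> y * (u y * u x)"
      proof (cases "\<eta> y = 1")
        case False
        then have "0 < 1 - \<eta> y" using \<eta>01[of y] by simp
        then have "0 < (1 - \<eta> y) * (u y * u y)" by (rule mult_pos_pos[OF _ pos(1)])
        moreover have "0 \<le> \<eta> y * (u y * u x)" by (rule mult_nonneg_nonneg[OF \<eta>01(1) less_imp_le[OF pos(2)]])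
        ultimately show ?thesis by linarith
      qed (use pos in simp)
      then show ?thesis by (simp add: w_def algebra_simps)
    qed
    let ?Dv = "\<lambda>y. (1 - \<eta> y) *\<^sub>R Du y - u y *\<^sub>R grad \<eta> y + grad w y"
    let ?K = "(1 + 1 / t) * (d * (F / s))\<^sup>2"
    have K0: "0 \<le> ?K" using t by simp
    have quarter: "\<eta> y \<ge> c" if "y \<in> ball x (r/4)" for y
      unfolding \<eta>_def
    proof (rule c(2))
      have "norm (y - x) < s / 2" using that by (simp add: dist_norm norm_minus_commute s_def)
      then have "norm (y - x) / s \<le> 1/2" using s(1) by (simp add: field_simps)
      then show "norm ((1/s) *\<^sub>R (y - x)) \<le> 1/2" using s(1) by simp
    qed
    have pw: "(norm (?Dv y))\<^sup>2 \<le> (1 + t) * (norm (Du y))\<^sup>2 - (1 + t) * c * (indicat_real (ball x (r/4)) y * (norm (Du y))\<^sup>2) + ?K"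
      if y: "y \<in> ball x r" for y
    proof -
      have "?Dv y = (1 - \<eta> y) *\<^sub>R Du y + (u x - u y) *\<^sub>R grad \<eta> y" unfolding gw by (simp add: algebra_simps)
      then have "(norm (?Dv y))\<^sup>2 \<le> (1 + t) * (norm ((1 - \<eta> y) *\<^sub>R Du y))\<^sup>2 + (1 + 1 / t) * (norm ((u x - u y) *\<^sub>R grad \<eta> y))\<^sup>2"
        by (simp only: young_norm_square[OF t(1)])
      moreover have "(1 + 1 / t) * (norm ((u x - u y) *\<^sub>R grad \<eta> y))\<^sup>2 \<le> ?K"
      proof (intro mult_left_mono power_mono)
        show "norm ((u x - u y) *\<^sub>R grad \<eta> y) \<le> d * (F / s)"
          unfolding norm_scaleR using d[OF y] g\<eta> d0 by (intro mult_mono) (auto simp: abs_minus_commute)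
      qed (use t in auto)
      moreover have "(norm ((1 - \<eta> y) *\<^sub>R Du y))\<^sup>2 \<le> (1 - c * indicat_real (ball x (r/4)) y) * (norm (Du y))\<^sup>2"
      proof -
        have "(1 - \<eta> y)\<^sup>2 \<le> 1 - \<eta> y" using \<eta>01[of y] by (simp add: power2_eq_square mult_left_le_one_le)
        also have "\<dots> \<le> 1 - c * indicat_real (ball x (r/4)) y"
          using quarter[of y] \<eta>01[of y] by (cases "y \<in> ball x (r/4)") auto
        finally have "(1 - \<eta> y)\<^sup>2 * (norm (Du y))\<^sup>2 \<le> (1 - c * indicat_real (ball x (r/4)) y) * (norm (Du y))\<^sup>2"
          by (rule mult_right_mono) simp
        then show ?thesis by (simp add: power_mult_distrib)
      qed
      then have "(1 + t) * (norm ((1 - \<eta> y) *\<^sub>R Du y))\<^sup>2 \<le> (1 + t) * ((1 - c * indicat_real (ball x (r/4)) y) * (norm (Du y))\<^sup>2)"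
        using t by (intro mult_left_mono) auto
      ultimately show ?thesis by (simp add: algebra_simps)
    qed
    have sub4: "cball x (r/4) \<subseteq> box a b"
      by (rule order_trans[OF subset_cball sub]) (use r in simp)
    let ?h = "\<lambda>y. (1 + t) * c * (indicat_real (ball x (r/4)) y * (norm (Du y))\<^sup>2)"
    have b4: "ball x (r/4) \<subseteq> ball x r" using r by (intro subset_ball) simp
    have ind: "(\<lambda>y. indicat_real (ball x r) y *\<^sub>R (indicat_real (ball x (r/4)) y * (norm (Du y))\<^sup>2))
      = (\<lambda>y. indicat_real (ball x (r/4)) y *\<^sub>R (norm (Du y))\<^sup>2)"
      using b4 by (auto simp: fun_eq_iff indicator_def)
    have i1: "set_integrable lebesgue (ball x r) (\<lambda>y. (1 + t) * (norm (Du y))\<^sup>2)"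
      by (rule set_integrable_mult_right) (rule energy_integrable[OF sub])
    have i4: "set_integrable lebesgue (ball x r) ?h"
      by (rule set_integrable_mult_right) (use energy_integrable[OF sub4] in \<open>simp only: set_integrable_def ind\<close>)
    note i5 = set_integral_diff(1)[OF i1 i4] and ci = set_integrable_const_ball[of x r ?K]
    have "energy ?Dv x r \<le> (LINT y:ball x r|lebesgue. (1 + t) * (norm (Du y))\<^sup>2 - ?h y + ?K)"
      unfolding energy_def
      by (rule set_integral_mono_nonneg[OF set_integral_add(1)[OF i5 ci] pw order_trans[OF zero_le_power2 pw]])
    also have "\<dots> = (1 + t) * energy Du x r - (1 + t) * c * energy Du x (r/4) + ?K * measure lebesgue (ball x r)"
    proof -
      have "(LINT y:ball x r|lebesgue. indicat_real (ball x (r/4)) y * (norm (Du y))\<^sup>2) = energy Du x (r/4)"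
        unfolding energy_def set_lebesgue_integral_def ind ..
      then show ?thesis
        unfolding set_integral_add(2)[OF i5 ci] set_integral_diff(2)[OF i1 i4] set_integral_const_ball
        by (simp add: energy_def)
    qed
    finally have Dv: "energy ?Dv x r \<le>
      (1 + t) * energy Du x r - (1 + t) * c * energy Du x (r/4) + ?K * (?c * r powr ?n)"
      unfolding ball_volume_powr[OF r(1)] .
    define k where "k = \<kappa> * r powr \<alpha>"
    have k: "0 \<le> k" "k \<le> t" using rk[OF r] \<kappa> by (auto simp: k_def)
    have k\<kappa>: "k \<le> \<kappa>" using r r0 \<alpha> \<kappa> unfolding k_def by (simp add: powr_le1)
    define D where "D = energy Du x r"
    define D4 where "D4 = energy Du x (r/4)"
    define Q where "Q = ?K * (?c * r powr ?n)"
    have Q0: "0 \<le> Q" unfolding Q_def using K0 by simp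
    have D0: "0 \<le> D" "0 \<le> D4" by (auto simp: D_def D4_def energy_nonneg)
    have "D \<le> (1 + k) * energy ?Dv x r + k * (M * r powr ?n)"
      using comparison[OF r(1) sub \<eta>t wt sg] unfolding D_def k_def .
    also have "\<dots> \<le> (1 + k) * ((1 + t) * D - (1 + t) * c * D4 + Q) + k * (M * r powr ?n)"
      using Dv k unfolding D_def D4_def Q_def by (intro add_right_mono mult_left_mono) auto
    finally have ineq: "D \<le> (1 + k) * ((1 + t) * D - (1 + t) * c * D4 + Q) + k * (M * r powr ?n)" .
    define q where "q = (1 + k) * (1 + t)"
    have q1: "1 \<le> q" unfolding q_def using k t mult_mono[of 1 "1+k" 1 "1+t"] by simp
    have q2: "q \<le> 1 + c * \<theta>"
    proof -
      have "q \<le> (1 + t) * (1 + t)" unfolding q_def using k t by (intro mult_right_mono) auto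
      also have "\<dots> = 1 + 2 * t + t * t" by (simp add: algebra_simps)
      also have "t * t \<le> t" using t by (simp add: mult_left_le_one_le)
      finally show ?thesis using t(3) by simp
    qed
    \<comment> \<open>The saving on the quarter ball moves to the left, and the full energy keeps
      only the coefficient q - 1, at most c theta.\<close>
    have "q * (c * D4) \<le> (q - 1) * D + (1 + k) * Q + k * (M * r powr ?n)"
      using ineq unfolding q_def by (simp add: algebra_simps)
    moreover have "1 * (c * D4) \<le> q * (c * D4)" using q1 c(1) D0 by (intro mult_right_mono) auto
    moreover have "(q - 1) * D \<le> c * \<theta> * D" using q2 D0 by (intro mult_right_mono) auto
    moreover have "(1 + k) * Q \<le> (1 + \<kappa>) * Q" using k\<kappa> Q0 by (intro mult_right_mono) auto
    moreover have "k * (M * r powr ?n) \<le> \<kappa> * (M * r powr ?n)" using k\<kappa> M by (intro mult_right_mono) auto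
    ultimately have "c * D4 \<le> c * \<theta> * D + (1 + \<kappa>) * Q + \<kappa> * (M * r powr ?n)" by linarith
    then have "D4 \<le> (c * \<theta> * D + (1 + \<kappa>) * Q + \<kappa> * (M * r powr ?n)) / c"
      using c(1) by (simp add: pos_le_divide_eq mult.commute)
    also have "\<dots> = \<theta> * D + ((1 + \<kappa>) * Q / c + C2 * r powr ?n)"
      using c(1) by (simp add: C2_def add_divide_distrib)
    also have "(1 + \<kappa>) * Q / c = C1 * (r powr (?n - 2) * d\<^sup>2)"
    proof -
      have "r powr ?n = r powr (?n - 2) * r\<^sup>2" using r(1) by (simp add: powr_diff)
      then have "(d * (F / s))\<^sup>2 * (?c * r powr ?n) = (2 * F)\<^sup>2 * ?c * (r powr (?n - 2) * d\<^sup>2)"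
        using r(1) by (simp add: s_def power2_eq_square field_simps)
      then have "Q = (1 + 1 / t) * ((2 * F)\<^sup>2 * ?c * (r powr (?n - 2) * d\<^sup>2))"
        unfolding Q_def by (simp only: mult.assoc)
      then show ?thesis unfolding C1_def by (simp only: mult.assoc times_divide_eq_left times_divide_eq_right mult.left_commute)
    qed
    also have "\<theta> * D + (C1 * (r powr (?n - 2) * d\<^sup>2) + C2 * r powr ?n) \<le> \<theta> * D + (C1 + C2) * (r powr (?n - 2) * d\<^sup>2 + r powr ?n)"
    proof -
      have "0 \<le> C1 * r powr ?n" "0 \<le> C2 * (r powr (?n - 2) * d\<^sup>2)" using C1 C2 by auto
      then show ?thesis unfolding distrib_left distrib_right by linarith
    qed
    finally show ?thesis unfolding D_def D4_def .
  qed
  show ?thesis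
    by (rule exI[of _ r0], intro conjI exI[of _ "C1 + C2"]) (use r0 C1 C2 main in auto)
qed

end

lemma cball_subset_double:
  fixes x0 :: "'a::euclidean_space"
  assumes "x \<in> ball x0 \<rho>" "r \<le> \<rho>"
  shows "cball x r \<subseteq> cball x0 (2 * \<rho>)" "ball x r \<subseteq> ball x0 (2 * \<rho>)"
proof -
  have "dist x0 y < 2 * \<rho>" if "dist x y \<le> r" for y
    using that assms dist_triangle[of x0 y x] by simp
  then show "cball x r \<subseteq> cball x0 (2 * \<rho>)" "ball x r \<subseteq> ball x0 (2 * \<rho>)"
    by (force simp: less_imp_le)+
qed

section \<open>Improvement of the Hoelder exponent\<close>

context dirichlet_almost_minimizer
begin

text \<open>Radius and constant may depend on the point, so each step of the iteration may shrink
  the neighbourhood. Exponent 0 expresses local boundedness and starts the iteration.\<close>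

definition locally_Holder :: "real \<Rightarrow> bool" where
  "locally_Holder \<gamma> \<longleftrightarrow> (\<forall>x0\<in>box a b. \<exists>\<rho>>0. \<exists>L. cball x0 \<rho> \<subseteq> box a b \<and>
     (\<forall>x\<in>ball x0 \<rho>. \<forall>y\<in>ball x0 \<rho>. \<bar>u x - u y\<bar> \<le> L * dist x y powr \<gamma>))"

text \<open>Hole filling with oscillation d = |L| r^gamma: both error terms are at most a constant
  times r^m with m = n - 2 + 2 gamma, and \<open>quarter_iteration\<close> gives the same power for
  the energy.\<close>

lemma energy_decay:
  assumes H: "locally_Holder \<gamma>" and \<gamma>: "0 \<le> \<gamma>" "\<gamma> < 1" and x0: "x0 \<in> box a b"
  shows "\<exists>\<rho>>0. \<exists>A\<ge>0. \<rho> \<le> 1 \<and> cball x0 (2 * \<rho>) \<subseteq> box a b \<and>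
    (\<forall>x\<in>ball x0 \<rho>. \<forall>r. 0 < r \<and> r \<le> \<rho> \<longrightarrow> energy Du x r \<le> A * r powr (real DIM('a) - 2 + 2 * \<gamma>))"
proof -
  let ?n = "real DIM('a)"
  define m where "m = ?n - 2 + 2 * \<gamma>"
  \<comment> \<open>The lower bound, needed for the iteration, uses n >= 2; the upper bound uses
    gamma < 1 and makes r^n <= r^m for radii up to 1.\<close>
  have m: "0 \<le> m" "m \<le> ?n" using dim \<gamma> by (auto simp: m_def)
  obtain \<rho>1 L where L: "\<rho>1 > 0" "cball x0 \<rho>1 \<subseteq> box a b"
    "\<And>x y. x \<in> ball x0 \<rho>1 \<Longrightarrow> y \<in> ball x0 \<rho>1 \<Longrightarrow> \<bar>u x - u y\<bar> \<le> L * dist x y powr \<gamma>"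
    using H x0 unfolding locally_Holder_def by blast
  \<comment> \<open>The largest factor that \<open>quarter_iteration\<close> accepts for the
    exponent \<open>m\<close>.\<close>
  define \<theta> where "\<theta> = 1 / (2 * 4 powr m)"
  have \<theta>: "\<theta> > 0" "\<theta> * 4 powr m \<le> 1/2" by (auto simp: \<theta>_def)
  obtain r0 C where r0: "r0 > 0" "r0 \<le> 1" and C: "C \<ge> 0" and hole: "\<forall>x r d. 0 < r \<and> r \<le> r0 \<and> cball x r \<subseteq> box a b \<and>
     (\<forall>y\<in>ball x r. \<bar>u y - u x\<bar> \<le> d) \<longrightarrow>
     energy Du x (r/4) \<le> \<theta> * energy Du x r + C * (r powr (?n - 2) * d\<^sup>2 + r powr ?n)"
    using hole_filling[OF \<theta>(1)] by (elim exE conjE) (rule that)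
  \<comment> \<open>A third of the Hoelder radius leaves room for all balls of radius at most
    \<open>\<rho>\<close> centred in \<open>ball x0 \<rho>\<close>.\<close>
  define \<rho> where "\<rho> = min (\<rho>1 / 3) r0"
  have \<rho>: "\<rho> > 0" "\<rho> \<le> 1" "\<rho> \<le> r0" "2 * \<rho> < \<rho>1" using L r0 by (auto simp: \<rho>_def min_def)
  have in1: "cball x0 (2 * \<rho>) \<subseteq> ball x0 \<rho>1" using \<rho>(4) by auto
  have sub0: "cball x0 (2 * \<rho>) \<subseteq> box a b" using in1 L(2) ball_subset_cball[of x0 \<rho>1] by blast
  define C' where "C' = C * (L\<^sup>2 + 1)"
  have C': "C' \<ge> 0" using C by (simp add: C'_def)
  define B where "B = energy Du x0 (2 * \<rho>)"
  define A where "A = B * 4 powr m / \<rho> powr m + 2 * C' * 4 powr m"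
  have A: "A \<ge> 0" unfolding A_def B_def using energy_nonneg[of Du x0 "2 * \<rho>"] C' by simp
  have "energy Du x r \<le> A * r powr m" if x: "x \<in> ball x0 \<rho>" and r: "0 < r" "r \<le> \<rho>" for x r
    unfolding A_def
  proof (rule quarter_iteration[OF \<rho>(1) m(1) C' less_imp_le[OF \<theta>(1)] \<theta>(2) energy_nonneg _ _ r])
    fix r assume r: "0 < r" "r \<le> \<rho>"
    note sub = cball_subset_double[OF x r(2)]
    show "energy Du x r \<le> B" unfolding B_def by (rule energy_mono[OF L2[OF sub0] sub(2)])
    have "energy Du x (r/4) \<le> \<theta> * energy Du x r + C * (r powr (?n - 2) * (\<bar>L\<bar> * r powr \<gamma>)\<^sup>2 + r powr ?n)"
    proof (intro hole[rule_format] conjI ballI)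
      show "cball x r \<subseteq> box a b" using sub(1) sub0 by (rule order_trans)
      fix y assume y: "y \<in> ball x r"
      have "x \<in> ball x r" using r by simp
      then have "y \<in> ball x0 \<rho>1" "x \<in> ball x0 \<rho>1" using y sub(1) in1 ball_subset_cball[of x r] by blast+
      then have "\<bar>u y - u x\<bar> \<le> L * dist y x powr \<gamma>" by (rule L(3))
      also have "\<dots> \<le> \<bar>L\<bar> * r powr \<gamma>"
        using y \<gamma> by (intro mult_mono powr_mono2) (auto simp: dist_commute)
      finally show "\<bar>u y - u x\<bar> \<le> \<bar>L\<bar> * r powr \<gamma>" .
    qed (use r \<rho> in auto)
    also have "r powr (?n - 2) * (\<bar>L\<bar> * r powr \<gamma>)\<^sup>2 = L\<^sup>2 * r powr m"
    proof -
      have "(r powr \<gamma>)\<^sup>2 = r powr (2 * \<gamma>)" by (simp add: power2_eq_square powr_add[symmetric])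
      then show ?thesis by (simp add: m_def power_mult_distrib powr_add)
    qed
    also have "\<theta> * energy Du x r + C * (L\<^sup>2 * r powr m + r powr ?n) \<le> \<theta> * energy Du x r + C' * r powr m"
    proof -
      have "r powr ?n \<le> r powr m" using r \<rho> m by (intro powr_mono') auto
      then have "C * (L\<^sup>2 * r powr m + r powr ?n) \<le> C * (L\<^sup>2 * r powr m + r powr m)"
        using C by (intro mult_left_mono) auto
      then show ?thesis by (simp add: C'_def algebra_simps)
    qed
    finally show "energy Du x (r/4) \<le> \<theta> * energy Du x r + C' * r powr m" .
  qed
  then show ?thesis unfolding m_def using \<rho> A sub0 by blast
qed

text \<open>Each derivative of the rescaled kernel is again a test function, so one integration by
  parts per coordinate moves the gradient off \<open>u\<close>; the two derivatives on the kernel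
  give the factor s^(-2).\<close>

lemma weak_laplacian:
  assumes f: "unit_test f" and s: "s > 0" and sub: "cball x s \<subseteq> box a b" "cball x s \<subseteq> ball x r"
  shows "(LINT y:ball x r|lebesgue. Du y \<bullet> grad (\<lambda>y. f ((1/s) *\<^sub>R (y - x))) y) = - ((1/s)\<^sup>2 * kernel_int a b u (lap f) x s)"
    and "set_integrable lebesgue (ball x r) (\<lambda>y. Du y \<bullet> grad (\<lambda>y. f ((1/s) *\<^sub>R (y - x))) y)"
proof -
  let ?\<phi> = "\<lambda>y. f ((1/s) *\<^sub>R (y - x))"
  have sm: "smooth f" using f unit_test_smooth by blast
  have L: "L1_loc (box a b) Du" using wg by (simp add: has_weak_gradient_on_iff)
  have pd\<phi>: "pd i ?\<phi> y = (1/s) * pd i f ((1/s) *\<^sub>R (y - x))" if "i \<in> Basis" for i y by (rule pd_affine[OF sm that])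
  have t: "test_function_on (box a b) (\<lambda>y. pd i f ((1/s) *\<^sub>R (y - x)))" if "i \<in> Basis" for i
    by (rule test_function_scaled[OF unit_test_pd[OF f that] s sub(1)])
  have tr: "test_function_on (ball x r) ?\<phi>" by (rule test_function_scaled[OF f s sub(2)])
  have g0: "grad ?\<phi> y = 0" if "y \<notin> ball x r" for y
  proof -
    have "y \<notin> closure {x. ?\<phi> x \<noteq> 0}" using tr that unfolding test_function_on_def by blast
    then show ?thesis using test_function_zero(2)[OF tr] unfolding grad_pd by simp
  qed
  have eq: "(\<lambda>y. indicat_real (ball x r) y *\<^sub>R (Du y \<bullet> grad ?\<phi> y)) =
      (\<lambda>y. \<Sum>i\<in>Basis. (1/s) * (pd i f ((1/s) *\<^sub>R (y - x)) * (Du y \<bullet> i)))"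
  proof
    fix y
    have "indicat_real (ball x r) y *\<^sub>R (Du y \<bullet> grad ?\<phi> y) = Du y \<bullet> grad ?\<phi> y"
      using g0[of y] by (cases "y \<in> ball x r") auto
    also have "\<dots> = (\<Sum>i\<in>Basis. pd i ?\<phi> y * (Du y \<bullet> i))"
      unfolding grad_pd inner_sum_right by (simp only: inner_scaleR_right)
    also have "\<dots> = (\<Sum>i\<in>Basis. (1/s) * (pd i f ((1/s) *\<^sub>R (y - x)) * (Du y \<bullet> i)))"
      by (intro sum.cong refl) (simp only: pd\<phi> mult.assoc)
    finally show "indicat_real (ball x r) y *\<^sub>R (Du y \<bullet> grad ?\<phi> y) = (\<Sum>i\<in>Basis. (1/s) * (pd i f ((1/s) *\<^sub>R (y - x)) * (Du y \<bullet> i)))" .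
  qed
  have ii: "integrable lebesgue (\<lambda>y. pd i f ((1/s) *\<^sub>R (y - x)) * (Du y \<bullet> i))" if "i \<in> Basis" for i
    using integrable_inner_left[OF test_function_integrable(1)[OF t[OF that] L that], of i] by simp
  show "set_integrable lebesgue (ball x r) (\<lambda>y. Du y \<bullet> grad ?\<phi> y)"
    unfolding set_integrable_def eq using ii by (intro Bochner_Integration.integrable_sum integrable_mult_right)
  have k: "(LINT y|lebesgue. pd i f ((1/s) *\<^sub>R (y - x)) * (Du y \<bullet> i)) = - ((1/s) * kernel_int a b u (pd i (pd i f)) x s)"
    if i: "i \<in> Basis" for i
  proof -
    have zero: "pd i (pd i f) ((1/s) *\<^sub>R (y - x)) = 0" if "y \<notin> cbox a b" for y
      using unit_test_scaled_zero[OF unit_test_pd[OF unit_test_pd[OF f i] i] s] that sub(1) box_subset_cbox[of a b] by blast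
    have "(LINT y|lebesgue. u y * pd i (\<lambda>y. pd i f ((1/s) *\<^sub>R (y - x))) y)
      = - (LINT y|lebesgue. pd i f ((1/s) *\<^sub>R (y - x)) * (Du y \<bullet> i))"
      using wg t[OF i] i unfolding has_weak_gradient_on_iff by blast
    moreover have "(LINT y|lebesgue. u y * pd i (\<lambda>y. pd i f ((1/s) *\<^sub>R (y - x))) y)
       = (LINT y|lebesgue. (1/s) * (u y * pd i (pd i f) ((1/s) *\<^sub>R (y - x))))"
      unfolding pd_affine[OF smooth_pd[OF sm i] i] by (simp only: mult.left_commute)
    moreover have "\<dots> = (1/s) * (LINT y|lebesgue. u y * pd i (pd i f) ((1/s) *\<^sub>R (y - x)))"
      by (rule integral_mult_right_zero)
    moreover have "(LINT y|lebesgue. u y * pd i (pd i f) ((1/s) *\<^sub>R (y - x))) = kernel_int a b u (pd i (pd i f)) x s"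
      unfolding kernel_int_def
    proof (rule lebesgue_integral_eq_cbox(2))
      show "continuous_on (cbox a b) (\<lambda>y. u y * pd i (pd i f) ((1/s) *\<^sub>R (y - x)))"
        by (intro continuous_on_mult u smooth_continuous smooth_affine smooth_pd sm i)
      show "u y * pd i (pd i f) ((1/s) *\<^sub>R (y - x)) = 0" if "y \<notin> cbox a b" for y
        using zero[OF that] by simp
    qed
    ultimately show ?thesis by simp
  qed
  have lapk: "kernel_int a b u (lap f) x s = (\<Sum>i\<in>Basis. kernel_int a b u (pd i (pd i f)) x s)"
  proof -
    have "kernel_int a b u (lap f) x s = integral (cbox a b) (\<lambda>y. \<Sum>i\<in>Basis. u y * pd i (pd i f) ((1/s) *\<^sub>R (y - x)))"
      unfolding kernel_int_def lap_def by (simp only: sum_distrib_left)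
    also have "\<dots> = (\<Sum>i\<in>Basis. kernel_int a b u (pd i (pd i f)) x s)"
      unfolding kernel_int_def by (intro integral_sum kernel_int_integrable[OF u] smooth_pd sm) auto
    finally show ?thesis .
  qed
  have "(LINT y:ball x r|lebesgue. Du y \<bullet> grad ?\<phi> y) = (\<Sum>i\<in>Basis. LINT y|lebesgue. (1/s) * (pd i f ((1/s) *\<^sub>R (y - x)) * (Du y \<bullet> i)))"
    unfolding set_lebesgue_integral_def eq
    using ii by (intro Bochner_Integration.integral_sum integrable_mult_right)
  also have "\<dots> = (\<Sum>i\<in>Basis. - ((1/s)\<^sup>2 * kernel_int a b u (pd i (pd i f)) x s))"
  proof (intro sum.cong refl)
    fix i :: 'a assume i: "i \<in> Basis"
    have "(LINT y|lebesgue. (1/s) * (pd i f ((1/s) *\<^sub>R (y - x)) * (Du y \<bullet> i)))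
      = (1/s) * (LINT y|lebesgue. pd i f ((1/s) *\<^sub>R (y - x)) * (Du y \<bullet> i))" by (rule integral_mult_right_zero)
    then show "(LINT y|lebesgue. (1/s) * (pd i f ((1/s) *\<^sub>R (y - x)) * (Du y \<bullet> i)))
       = - ((1/s)\<^sup>2 * kernel_int a b u (pd i (pd i f)) x s)"
      unfolding k[OF i] by (simp add: power2_eq_square)
  qed
  also have "\<dots> = - ((1/s)\<^sup>2 * kernel_int a b u (lap f) x s)"
    unfolding lapk sum_distrib_left sum_negf ..
  finally show "(LINT y:ball x r|lebesgue. Du y \<bullet> grad ?\<phi> y) = - ((1/s)\<^sup>2 * kernel_int a b u (lap f) x s)" .
qed

text \<open>Expand the energy of \<open>u\<close> + t phi. The full energy cancels up to the almost
  minimality error and leaves the linear term against that error plus tau^2 times the energy of phi;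
  both signs of t bound the absolute value. The condition on \<open>\<tau>\<close> prevents a change
  of sign, and the ball of radius 2s makes phi compactly supported in its interior.\<close>

lemma first_variation:
  assumes f: "unit_test f" and s: "s > 0" and sub: "cball x (2 * s) \<subseteq> box a b"
    and F: "\<And>z. norm (grad f z) \<le> F" and \<tau>: "\<tau> > 0" "\<And>y z. y \<in> cbox a b \<Longrightarrow> \<tau> * \<bar>f z\<bar> < \<bar>u y\<bar>"
  shows "2 * \<tau> * \<bar>kernel_int a b u (lap f) x s\<bar> \<le> s\<^sup>2 * (\<kappa> * (2 * s) powr \<alpha> * (energy Du x (2 * s) + M * (2 * s) powr real DIM('a))
     + \<tau>\<^sup>2 * ((F / s)\<^sup>2 * (unit_ball_vol (real DIM('a)) * (2 * s) powr real DIM('a))))"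
proof -
  let ?n = "real DIM('a)"
  let ?r = "2 * s"
  let ?\<phi> = "\<lambda>y. f ((1/s) *\<^sub>R (y - x))"
  have sm: "smooth f" using f unit_test_smooth by blast
  have r: "0 < ?r" using s by simp
  have sr: "cball x s \<subseteq> ball x ?r" using s by (simp add: cball_subset_ball_iff)
  have sb: "cball x s \<subseteq> box a b" using sr sub ball_subset_cball[of x ?r] by blast
  have \<phi>t: "test_function_on (ball x ?r) ?\<phi>" by (rule test_function_scaled[OF f s sr])
  have \<phi>sm: "smooth ?\<phi>" by (rule smooth_affine[OF sm])
  have zt: "test_function_on (ball x ?r) (\<lambda>y. 0::real)" by (simp add: test_function_on_def)
  define I where "I = (LINT y:ball x ?r|lebesgue. Du y \<bullet> grad ?\<phi> y)"
  define G where "G = (F / s)\<^sup>2 * (unit_ball_vol ?n * ?r powr ?n)"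
  define k where "k = \<kappa> * ?r powr \<alpha>"
  define E where "E = energy Du x ?r"
  have I: "I = - ((1/s)\<^sup>2 * kernel_int a b u (lap f) x s)" unfolding I_def by (rule weak_laplacian(1)[OF f s sb sr])
  have k0: "k \<ge> 0" using \<kappa> by (simp add: k_def)
  have ineq: "E \<le> (1 + k) * (E + 2 * t * I + t\<^sup>2 * G) + k * (M * ?r powr ?n)" if t: "\<bar>t\<bar> = \<tau>" for t
  proof -
    let ?w = "\<lambda>y. t * ?\<phi> y"
    have wt: "test_function_on (ball x ?r) ?w" by (rule test_function_mult[OF \<phi>t smooth_const])
    have gw: "grad ?w y = t *\<^sub>R grad ?\<phi> y" for y
      using grad_mult[of "\<lambda>_. t" y ?\<phi>] \<phi>sm by (simp add: smooth_differentiable grad_def)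
    have g0: "grad (\<lambda>y::'a. 0::real) y = 0" for y by (rule grad_unique) simp
    have small: "\<bar>?w y\<bar> < \<bar>u y\<bar>" if "y \<in> ball x ?r" for y
      using \<tau>(2)[OF subset_cbox[OF sub that]] t by (simp add: abs_mult)
    have sg: "0 < u y * ((1 - 0) * u y + ?w y)" if "y \<in> ball x ?r" for y
    proof (cases "0 < u y")
      case True
      then have "0 < u y + ?w y" using small[OF that] by linarith
      with True show ?thesis by simp
    next
      case False
      then have "u y < 0" "u y + ?w y < 0" using small[OF that] by linarith+
      then show ?thesis by (simp add: mult_neg_neg)
    qed
    have Dveq: "(1 - 0) *\<^sub>R Du y - u y *\<^sub>R grad (\<lambda>y::'a. 0::real) y + grad ?w y = Du y + t *\<^sub>R grad ?\<phi> y" for y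
      unfolding g0 gw by simp
    have g\<phi>: "norm (grad ?\<phi> y) \<le> F / s" for y
    proof -
      have "norm (grad ?\<phi> y) = (1/s) * norm (grad f ((1/s) *\<^sub>R (y - x)))"
        unfolding grad_affine[OF sm] using s by simp
      also have "\<dots> \<le> (1/s) * F" using F s by (intro mult_left_mono) auto
      finally show ?thesis by simp
    qed
    have pw: "(norm (Du y + t *\<^sub>R grad ?\<phi> y))\<^sup>2 \<le> (norm (Du y))\<^sup>2 + 2 * t * (Du y \<bullet> grad ?\<phi> y) + t\<^sup>2 * (F / s)\<^sup>2" for y
    proof -
      have "(norm (Du y + t *\<^sub>R grad ?\<phi> y))\<^sup>2 = (norm (Du y))\<^sup>2 + 2 * t * (Du y \<bullet> grad ?\<phi> y) + t\<^sup>2 * (norm (grad ?\<phi> y))\<^sup>2"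
        unfolding power2_norm_eq_inner by (simp add: inner_add_left inner_add_right inner_commute power2_eq_square algebra_simps)
      moreover have "t\<^sup>2 * (norm (grad ?\<phi> y))\<^sup>2 \<le> t\<^sup>2 * (F / s)\<^sup>2"
        using g\<phi> by (intro mult_left_mono power_mono) auto
      ultimately show ?thesis by linarith
    qed
    have ip: "set_integrable lebesgue (ball x ?r) (\<lambda>y. 2 * t * (Du y \<bullet> grad ?\<phi> y))"
      by (rule set_integrable_mult_right) (rule weak_laplacian(2)[OF f s sb sr])
    note ei = set_integral_add[OF energy_integrable[OF sub] ip] and ci = set_integrable_const_ball[of x ?r "t\<^sup>2 * (F / s)\<^sup>2"]
    have "energy (\<lambda>y. Du y + t *\<^sub>R grad ?\<phi> y) x ?r
      \<le> (LINT y:ball x ?r|lebesgue. (norm (Du y))\<^sup>2 + 2 * t * (Du y \<bullet> grad ?\<phi> y) + t\<^sup>2 * (F / s)\<^sup>2)"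
      unfolding energy_def
      by (rule set_integral_mono_nonneg[OF set_integral_add(1)[OF ei(1) ci] pw order_trans[OF zero_le_power2 pw]])
    also have "\<dots> = E + 2 * t * I + t\<^sup>2 * (F / s)\<^sup>2 * measure lebesgue (ball x ?r)"
      unfolding set_integral_add(2)[OF ei(1) ci] ei(2) set_integral_const_ball by (simp add: E_def I_def energy_def)
    also have "\<dots> = E + 2 * t * I + t\<^sup>2 * G"
      unfolding ball_volume_powr[OF r] G_def by (simp only: mult.assoc)
    finally have Dv: "energy (\<lambda>y. Du y + t *\<^sub>R grad ?\<phi> y) x ?r \<le> E + 2 * t * I + t\<^sup>2 * G" .
    have "E \<le> (1 + k) * energy (\<lambda>y. Du y + t *\<^sub>R grad ?\<phi> y) x ?r + k * (M * ?r powr ?n)"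
      using comparison[OF r sub zt wt sg] unfolding Dveq E_def k_def .
    also have "\<dots> \<le> (1 + k) * (E + 2 * t * I + t\<^sup>2 * G) + k * (M * ?r powr ?n)"
      using Dv k0 by (intro add_right_mono mult_left_mono) auto
    finally show ?thesis .
  qed
  have E0: "E \<ge> 0" unfolding E_def by (rule energy_nonneg)
  \<comment> \<open>With X the linear gain minus the quadratic cost, the comparison reads (1 + k) X
    <= R with R >= 0, hence X <= R.\<close>
  have var: "2 * (- t * I) \<le> k * (E + M * ?r powr ?n) + \<tau>\<^sup>2 * G" if t: "\<bar>t\<bar> = \<tau>" for t
  proof -
    have tt: "t\<^sup>2 = \<tau>\<^sup>2" using t by (metis power2_abs)
    define X where "X = 2 * (- t * I) - \<tau>\<^sup>2 * G"
    have "(1 + k) * X \<le> k * (E + M * ?r powr ?n)"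
      using ineq[OF t] unfolding X_def tt by (simp add: algebra_simps)
    moreover have "0 \<le> k * (E + M * ?r powr ?n)" using k0 E0 M by simp
    ultimately have "X \<le> k * (E + M * ?r powr ?n)"
      using k0 by (cases "X \<ge> 0") (auto simp: distrib_right intro: order_trans[of X "X + k * X"])
    then show ?thesis by (simp add: X_def)
  qed
  have bound: "2 * \<tau> * \<bar>I\<bar> \<le> k * (E + M * ?r powr ?n) + \<tau>\<^sup>2 * G"
    using var[of \<tau>] var[of "- \<tau>"] \<tau>(1) by (cases "I \<ge> 0") auto
  have "\<bar>kernel_int a b u (lap f) x s\<bar> = s\<^sup>2 * \<bar>I\<bar>"
    unfolding I using s by (simp add: abs_mult power_divide)
  then have "2 * \<tau> * \<bar>kernel_int a b u (lap f) x s\<bar> = s\<^sup>2 * (2 * \<tau> * \<bar>I\<bar>)" by simp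
  also have "\<dots> \<le> s\<^sup>2 * (k * (E + M * ?r powr ?n) + \<tau>\<^sup>2 * G)"
    by (rule mult_left_mono[OF bound]) simp
  finally have "2 * \<tau> * \<bar>kernel_int a b u (lap f) x s\<bar> \<le> s\<^sup>2 * (k * (E + M * ?r powr ?n) + \<tau>\<^sup>2 * G)" .
  then show ?thesis unfolding k_def E_def G_def .
qed

text \<open>With amplitude s^(alpha/2 + gamma) both terms of \<open>first_variation\<close> are of
  order s^(alpha + m). Multiplication by s^2 and division by the amplitude leave s^(n + gamma +
  alpha/2). Any smaller \<open>\<mu>\<close> is allowed, so that the caller can stay away from
  integer exponents.\<close>

lemma Holder_imp_lap_decay:
  assumes H: "locally_Holder \<gamma>" and \<gamma>: "0 \<le> \<gamma>" "\<gamma> < 1" and x0: "x0 \<in> box a b" and \<mu>: "\<mu> \<le> \<gamma> + \<alpha> / 2"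
  shows "\<exists>\<rho>>0. \<rho> \<le> 1 \<and> cball x0 (2 * \<rho>) \<subseteq> box a b \<and> lap_decay a b u (ball x0 \<rho>) \<rho> \<mu>"
proof -
  let ?n = "real DIM('a)"
  let ?c = "unit_ball_vol ?n"
  define m where "m = ?n - 2 + 2 * \<gamma>"
  have m: "0 \<le> m" "m \<le> ?n" using dim \<gamma> by (auto simp: m_def)
  obtain \<rho>1 A where \<rho>1: "\<rho>1 > 0" "\<rho>1 \<le> 1" and A: "A \<ge> 0" and sub1: "cball x0 (2 * \<rho>1) \<subseteq> box a b"
    and ed: "\<forall>x\<in>ball x0 \<rho>1. \<forall>r. 0 < r \<and> r \<le> \<rho>1 \<longrightarrow> energy Du x r \<le> A * r powr m"
    using energy_decay[OF H \<gamma> x0, folded m_def] by (elim exE conjE) (rule that)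
  define \<rho> where "\<rho> = \<rho>1 / 2"
  have \<rho>: "\<rho> > 0" "\<rho> \<le> 1" "2 * \<rho> = \<rho>1" using \<rho>1 by (auto simp: \<rho>_def)
  have "cbox a b \<noteq> {}" using x0 box_subset_cbox[of a b] by blast
  moreover have "continuous_on (cbox a b) (\<lambda>y. \<bar>u y\<bar>)" using u by (rule continuous_on_rabs)
  ultimately obtain y0 where y0: "y0 \<in> cbox a b" "\<And>y. y \<in> cbox a b \<Longrightarrow> \<bar>u y0\<bar> \<le> \<bar>u y\<bar>"
    using continuous_attains_inf[OF compact_cbox] by metis
  define c0 where "c0 = \<bar>u y0\<bar>"
  have c0: "c0 > 0" using sgn[OF y0(1) y0(1)] by (auto simp: c0_def)
  have "\<exists>C. \<forall>x\<in>ball x0 \<rho>. \<forall>s. 0 < s \<and> s \<le> \<rho> \<longrightarrow> \<bar>kernel_int a b u (lap f) x s\<bar> \<le> C * s powr (?n + \<mu>)"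
    if f: "unit_test f" for f
  proof -
    obtain F where F: "F > 0" "\<And>z. \<bar>f z\<bar> \<le> F" using unit_test_bounded[OF f] by blast
    obtain F' where F': "F' > 0" "\<And>z. norm (grad f z) \<le> F'" using unit_test_grad_bounded[OF f] by blast
    \<comment> \<open>Keeps the perturbation below half of the minimum of |u| on the box.\<close>
    define \<tau>0 where "\<tau>0 = c0 / (2 * F)"
    have \<tau>0: "\<tau>0 > 0" "\<tau>0 * F < c0" using c0 F(1) by (auto simp: \<tau>0_def)
    define K where "K = \<kappa> * 2 * ((A + M) * 2 powr ?n) + \<tau>0\<^sup>2 * (F'\<^sup>2 * (?c * 2 powr ?n))"
    have K: "K \<ge> 0" unfolding K_def using \<kappa> A M by simp
    have "\<bar>kernel_int a b u (lap f) x s\<bar> \<le> K / (2 * \<tau>0) * s powr (?n + \<mu>)" if x: "x \<in> ball x0 \<rho>" and s: "0 < s" "s \<le> \<rho>" for x s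
    proof -
      \<comment> \<open>The amplitude balancing the energy error s^alpha s^(n-2+2 gamma) against the
        quadratic term tau^2 s^(n-2).\<close>
      define \<tau> where "\<tau> = \<tau>0 * s powr (\<alpha> / 2 + \<gamma>)"
      have s1: "s \<le> 1" using s \<rho> by simp
      have "s powr (\<alpha> / 2 + \<gamma>) \<le> 1" using s s1 \<alpha> \<gamma> by (intro powr_le1) auto
      then have \<tau>: "0 < \<tau>" "\<tau> \<le> \<tau>0" using \<tau>0 s by (auto simp: \<tau>_def mult_left_le)
      have x1: "x \<in> ball x0 \<rho>1" using x \<rho> by simp
      have r: "0 < 2 * s" "2 * s \<le> \<rho>1" using s \<rho> by auto
      have sub: "cball x (2 * s) \<subseteq> box a b"
        using cball_subset_double(1)[OF x1 r(2)] sub1 by (rule order_trans)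
      have small: "\<tau> * \<bar>f z\<bar> < \<bar>u y\<bar>" if "y \<in> cbox a b" for y z
      proof -
        have "\<tau> * \<bar>f z\<bar> \<le> \<tau>0 * F" using \<tau> F(2) \<tau>0 by (intro mult_mono) auto
        then show ?thesis using \<tau>0(2) y0(2)[OF that] unfolding c0_def by linarith
      qed
      have E: "energy Du x (2 * s) + M * (2 * s) powr ?n \<le> (A + M) * 2 powr ?n * s powr m"
      proof -
        have "energy Du x (2 * s) \<le> A * (2 * s) powr m" using ed x1 r by blast
        also have "\<dots> = A * (2 powr m * s powr m)" using s by (simp add: powr_mult)
        also have "\<dots> \<le> A * (2 powr ?n * s powr m)" using A m by (intro mult_left_mono mult_right_mono) auto
        finally have 1: "energy Du x (2 * s) \<le> A * (2 powr ?n * s powr m)" .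
        have "M * (2 * s) powr ?n = M * (2 powr ?n * s powr ?n)" using s by (simp add: powr_mult)
        also have "\<dots> \<le> M * (2 powr ?n * s powr m)"
          using M m s s1 by (intro mult_left_mono powr_mono') auto
        finally show ?thesis using 1 by (simp add: algebra_simps)
      qed
      have P1: "\<kappa> * (2 * s) powr \<alpha> * (energy Du x (2 * s) + M * (2 * s) powr ?n) \<le> \<kappa> * 2 * ((A + M) * 2 powr ?n) * s powr (\<alpha> + m)"
      proof -
        have "(2 * s) powr \<alpha> = 2 powr \<alpha> * s powr \<alpha>" using s by (simp add: powr_mult)
        also have "2 powr \<alpha> \<le> (2::real) powr 1" using \<alpha> by (intro powr_mono) auto
        then have "2 powr \<alpha> * s powr \<alpha> \<le> 2 * s powr \<alpha>" by (intro mult_right_mono) auto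
        finally have "(2 * s) powr \<alpha> \<le> 2 * s powr \<alpha>" .
        then have "\<kappa> * (2 * s) powr \<alpha> * (energy Du x (2 * s) + M * (2 * s) powr ?n) \<le> \<kappa> * (2 * s powr \<alpha>) * ((A + M) * 2 powr ?n * s powr m)"
          using E \<kappa> energy_nonneg[of Du x "2 * s"] M by (intro mult_mono mult_left_mono) auto
        also have "\<dots> = \<kappa> * 2 * ((A + M) * 2 powr ?n) * s powr (\<alpha> + m)" by (simp add: powr_add)
        finally show ?thesis .
      qed
      have P2: "\<tau>\<^sup>2 * ((F' / s)\<^sup>2 * (?c * (2 * s) powr ?n)) = \<tau>0\<^sup>2 * (F'\<^sup>2 * (?c * 2 powr ?n)) * s powr (\<alpha> + m)"
      proof -
        have "(s powr (\<alpha> / 2 + \<gamma>))\<^sup>2 = s powr (\<alpha> + 2 * \<gamma>)"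
          by (simp add: power2_eq_square powr_add[symmetric])
        then have t2: "\<tau>\<^sup>2 = \<tau>0\<^sup>2 * s powr (\<alpha> + 2 * \<gamma>)" by (simp add: \<tau>_def power_mult_distrib)
        have s2: "s powr (\<alpha> + 2 * \<gamma>) * s powr ?n = s powr (\<alpha> + m) * s\<^sup>2"
        proof -
          have "s powr (\<alpha> + 2 * \<gamma>) * s powr ?n = s powr ((\<alpha> + m) + 2)"
            unfolding powr_add[symmetric] by (rule arg_cong[where f="\<lambda>q. s powr q"]) (simp add: m_def)
          also have "\<dots> = s powr (\<alpha> + m) * s\<^sup>2" using s(1) by (simp add: powr_add)
          finally show ?thesis .
        qed
        have "\<tau>\<^sup>2 * ((F' / s)\<^sup>2 * (?c * (2 * s) powr ?n)) = \<tau>0\<^sup>2 * (F'\<^sup>2 * (?c * 2 powr ?n)) * ((s powr (\<alpha> + 2 * \<gamma>) * s powr ?n) / s\<^sup>2)"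
          unfolding t2 using s(1) by (simp add: powr_mult power_divide)
        also have "(s powr (\<alpha> + 2 * \<gamma>) * s powr ?n) / s\<^sup>2 = s powr (\<alpha> + m)" unfolding s2 using s(1) by simp
        finally show ?thesis .
      qed
      have "2 * \<tau> * \<bar>kernel_int a b u (lap f) x s\<bar> \<le> s\<^sup>2 * (\<kappa> * (2 * s) powr \<alpha> * (energy Du x (2 * s) + M * (2 * s) powr ?n)
         + \<tau>\<^sup>2 * ((F' / s)\<^sup>2 * (?c * (2 * s) powr ?n)))"
        by (rule first_variation[OF f s(1) sub F'(2) \<tau>(1) small])
      also have "\<dots> \<le> s\<^sup>2 * (\<kappa> * 2 * ((A + M) * 2 powr ?n) * s powr (\<alpha> + m) + \<tau>0\<^sup>2 * (F'\<^sup>2 * (?c * 2 powr ?n)) * s powr (\<alpha> + m))"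
        unfolding P2 using P1 by (intro mult_left_mono add_right_mono) auto
      also have "\<dots> = K * (s\<^sup>2 * s powr (\<alpha> + m))" by (simp add: K_def algebra_simps)
      also have "s\<^sup>2 * s powr (\<alpha> + m) = s powr (\<alpha> / 2 + \<gamma>) * s powr (?n + (\<gamma> + \<alpha> / 2))"
      proof -
        have "s\<^sup>2 * s powr (\<alpha> + m) = s powr 2 * s powr (\<alpha> + m)" using s(1) by simp
        also have "\<dots> = s powr (\<alpha> / 2 + \<gamma>) * s powr (?n + (\<gamma> + \<alpha> / 2))"
          unfolding powr_add[symmetric] by (rule arg_cong[where f="\<lambda>q. s powr q"]) (simp add: m_def)
        finally show ?thesis .
      qed
      finally have fv: "2 * \<tau> * \<bar>kernel_int a b u (lap f) x s\<bar> \<le> K * (s powr (\<alpha> / 2 + \<gamma>) * s powr (?n + (\<gamma> + \<alpha> / 2)))" .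
      define P where "P = s powr (\<alpha> / 2 + \<gamma>)"
      have P: "P > 0" using s(1) by (simp add: P_def)
      have "P * (2 * \<tau>0 * \<bar>kernel_int a b u (lap f) x s\<bar>) \<le> P * (K * s powr (?n + (\<gamma> + \<alpha> / 2)))"
        using fv unfolding \<tau>_def P_def[symmetric] by (simp only: mult_ac)
      then have "2 * \<tau>0 * \<bar>kernel_int a b u (lap f) x s\<bar> \<le> K * s powr (?n + (\<gamma> + \<alpha> / 2))"
        using P by (simp only: mult_le_cancel_left_pos)
      also have "\<dots> \<le> K * s powr (?n + \<mu>)"
        using K s s1 \<mu> by (intro mult_left_mono powr_mono') auto
      finally have "\<bar>kernel_int a b u (lap f) x s\<bar> \<le> (K * s powr (?n + \<mu>)) / (2 * \<tau>0)"
        using \<tau>0(1) by (simp add: pos_le_divide_eq mult.commute)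
      then show ?thesis by simp
    qed
    then show ?thesis by blast
  qed
  then have "lap_decay a b u (ball x0 \<rho>) \<rho> \<mu>" unfolding lap_decay_def by blast
  moreover have "cball x0 (2 * \<rho>) \<subseteq> box a b"
    by (rule order_trans[OF subset_cball sub1]) (use \<rho> \<rho>1 in simp)
  ultimately show ?thesis using \<rho> by blast
qed

text \<open>Halving the radius makes any two points closer than \<open>\<rho>\<close>, which removes
  the distance condition of \<open>lap_decay_Holder\<close>.\<close>

lemma locally_Holder_step:
  assumes H: "locally_Holder \<gamma>" "0 \<le> \<gamma>" "\<gamma> < 1" and \<mu>: "0 < \<mu>" "\<mu> < 1" "\<mu> \<le> \<gamma> + \<alpha> / 2"
  shows "locally_Holder \<mu>"
  unfolding locally_Holder_def
proof
  fix x0 assume x0: "x0 \<in> box a b"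
  obtain \<rho> where \<rho>: "\<rho> > 0" "cball x0 (2 * \<rho>) \<subseteq> box a b" "lap_decay a b u (ball x0 \<rho>) \<rho> \<mu>"
    using Holder_imp_lap_decay[OF H x0 \<mu>(3)] by blast
  have sub: "cball x \<rho> \<subseteq> cbox a b" if "x \<in> ball x0 \<rho>" for x
    using cball_subset_double(1)[OF that order_refl] \<rho>(2) box_subset_cbox[of a b] by (meson order_trans)
  obtain C where C: "\<forall>x\<in>ball x0 \<rho>. \<forall>y\<in>ball x0 \<rho>. dist x y \<le> \<rho> \<longrightarrow> \<bar>u x - u y\<bar> \<le> C * dist x y powr \<mu>"
    using lap_decay_Holder[OF u \<rho>(1) sub \<rho>(3) \<mu>(1,2) convex_ball] by blast
  show "\<exists>\<rho>>0. \<exists>L. cball x0 \<rho> \<subseteq> box a b \<and> (\<forall>x\<in>ball x0 \<rho>. \<forall>y\<in>ball x0 \<rho>. \<bar>u x - u y\<bar> \<le> L * dist x y powr \<mu>)"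
  proof (rule exI[of _ "\<rho> / 2"], intro exI[of _ C] conjI ballI)
    show "\<rho> / 2 > 0" using \<rho>(1) by simp
    show "cball x0 (\<rho> / 2) \<subseteq> box a b"
      by (rule order_trans[OF subset_cball \<rho>(2)]) (use \<rho>(1) in simp)
    fix x y assume xy: "x \<in> ball x0 (\<rho> / 2)" "y \<in> ball x0 (\<rho> / 2)"
    have "ball x0 (\<rho> / 2) \<subseteq> ball x0 \<rho>" using \<rho>(1) by (intro subset_ball) simp
    then have xy': "x \<in> ball x0 \<rho>" "y \<in> ball x0 \<rho>" using xy by blast+
    have "dist x y \<le> \<rho>" using xy dist_triangle[of x y x0] by (simp add: dist_commute)
    then show "\<bar>u x - u y\<bar> \<le> C * dist x y powr \<mu>" using C xy' by blast
  qed
qed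

lemma locally_Holder_0: "locally_Holder 0"
  unfolding locally_Holder_def
proof
  fix x0 assume x0: "x0 \<in> box a b"
  obtain \<rho> where \<rho>: "\<rho> > 0" "cball x0 \<rho> \<subseteq> box a b" using x0 open_box open_contains_cball by blast
  obtain B where B: "B > 0" "\<And>y. y \<in> cbox a b \<Longrightarrow> \<bar>u y\<bar> \<le> B"
    using continuous_compact_support_bounded[OF u compact_cbox] by blast
  have "\<bar>u x - u y\<bar> \<le> (2 * B) * dist x y powr 0" if "x \<in> ball x0 \<rho>" "y \<in> ball x0 \<rho>" for x y
  \<comment> \<open>Equal points are separate because \<open>0 powr 0\<close> is 0; for distinct
    points the power is 1.\<close>
  proof (cases "x = y")
    case False
    have "\<bar>u x\<bar> \<le> B" "\<bar>u y\<bar> \<le> B" using B(2) subset_cbox[OF \<rho>(2)] that by auto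
    then show ?thesis using False by simp
  qed simp
  then show "\<exists>\<rho>>0. \<exists>L. cball x0 \<rho> \<subseteq> box a b \<and> (\<forall>x\<in>ball x0 \<rho>. \<forall>y\<in>ball x0 \<rho>. \<bar>u x - u y\<bar> \<le> L * dist x y powr 0)"
    using \<rho> by blast
qed

text \<open>Each step gains alpha/2. The cap 1 - alpha/4 keeps all exponents below 1, as both the
  energy decay and the Hoelder step require.\<close>

lemma locally_Holder_bootstrap: "locally_Holder (min (real k * (\<alpha> / 2)) (1 - \<alpha> / 4))"
proof (induction k)
  case 0
  have "min (real 0 * (\<alpha> / 2)) (1 - \<alpha> / 4) = 0" using \<alpha> by simp
  then show ?case using locally_Holder_0 by simp
next
  case (Suc k)
  have "0 \<le> min (real k * (\<alpha> / 2)) (1 - \<alpha> / 4)" "min (real k * (\<alpha> / 2)) (1 - \<alpha> / 4) < 1"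
    using \<alpha> by auto
  moreover have "0 < min (real (Suc k) * (\<alpha> / 2)) (1 - \<alpha> / 4)" "min (real (Suc k) * (\<alpha> / 2)) (1 - \<alpha> / 4) < 1"
    using \<alpha> by auto
  moreover have "min (real (Suc k) * (\<alpha> / 2)) (1 - \<alpha> / 4) \<le> min (real k * (\<alpha> / 2)) (1 - \<alpha> / 4) + \<alpha> / 2"
  proof -
    have "real (Suc k) * (\<alpha> / 2) = real k * (\<alpha> / 2) + \<alpha> / 2" by (simp add: algebra_simps add_divide_distrib)
    then show ?thesis using \<alpha> by (simp add: min_def)
  qed
  ultimately show ?case by (rule locally_Holder_step[OF Suc])
qed

text \<open>One more gain of alpha/2 from the cap gives exactly 1 + alpha/4, strictly between 1 and
  2. The bound on the distance is recorded so that the exponent may be lowered afterwards.\<close>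

lemma interior_C1_Holder:
  assumes x0: "x0 \<in> box a b"
  shows "\<exists>\<rho>>0. \<exists>G C. (\<forall>x\<in>ball x0 \<rho>. GDERIV u x :> G x) \<and>
    (\<forall>x\<in>ball x0 \<rho>. \<forall>y\<in>ball x0 \<rho>. dist x y \<le> 1 \<and> norm (G x - G y) \<le> C * dist x y powr (\<alpha> / 4))"
proof -
  obtain k where k: "(1 - \<alpha> / 4) / (\<alpha> / 2) \<le> real k" using real_arch_simple by blast
  have "1 - \<alpha> / 4 \<le> real k * (\<alpha> / 2)" using k \<alpha> by (simp add: pos_divide_le_eq)
  then have "min (real k * (\<alpha> / 2)) (1 - \<alpha> / 4) = 1 - \<alpha> / 4" by simp
  then have H: "locally_Holder (1 - \<alpha> / 4)" using locally_Holder_bootstrap[of k] by simp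
  have g: "0 \<le> 1 - \<alpha> / 4" "1 - \<alpha> / 4 < 1" "1 + \<alpha> / 4 \<le> (1 - \<alpha> / 4) + \<alpha> / 2" using \<alpha> by auto
  obtain \<rho> where \<rho>: "\<rho> > 0" "\<rho> \<le> 1" "cball x0 (2 * \<rho>) \<subseteq> box a b" "lap_decay a b u (ball x0 \<rho>) \<rho> (1 + \<alpha> / 4)"
    using Holder_imp_lap_decay[OF H g(1,2) x0 g(3)] by blast
  have sub: "cball x \<rho> \<subseteq> cbox a b" if "x \<in> ball x0 \<rho>" for x
    using cball_subset_double(1)[OF that order_refl] \<rho>(3) box_subset_cbox[of a b] by (meson order_trans)
  have \<mu>: "1 < 1 + \<alpha> / 4" "1 + \<alpha> / 4 < 2" using \<alpha> by auto
  obtain G C where GC: "\<forall>x\<in>ball x0 \<rho>. GDERIV u x :> G x"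
    "\<forall>x\<in>ball x0 \<rho>. \<forall>y\<in>ball x0 \<rho>. dist x y \<le> \<rho> \<longrightarrow> norm (G x - G y) \<le> C * dist x y powr ((1 + \<alpha> / 4) - 1)"
    using lap_decay_C1_Holder[OF u \<rho>(1) sub \<rho>(4) \<mu> convex_ball open_ball] by blast
  show ?thesis
  proof (rule exI[of _ "\<rho> / 2"], intro exI[of _ G] exI[of _ C] conjI ballI)
    show "\<rho> / 2 > 0" using \<rho>(1) by simp
    show "GDERIV u x :> G x" if "x \<in> ball x0 (\<rho> / 2)" for x
      using GC(1) that \<rho>(1) by auto
    fix x y assume xy: "x \<in> ball x0 (\<rho> / 2)" "y \<in> ball x0 (\<rho> / 2)"
    have "ball x0 (\<rho> / 2) \<subseteq> ball x0 \<rho>" using \<rho>(1) by (intro subset_ball) simp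
    then have xy': "x \<in> ball x0 \<rho>" "y \<in> ball x0 \<rho>" using xy by blast+
    have d: "dist x y \<le> \<rho>" using xy dist_triangle[of x y x0] by (simp add: dist_commute)
    then show "dist x y \<le> 1" using \<rho>(2) by simp
    show "norm (G x - G y) \<le> C * dist x y powr (\<alpha> / 4)" using GC(2) d xy' by simp
  qed
qed

end

section \<open>Passage to compact sets and conclusion\<close>

lemma gderiv_grad_unique: "GDERIV f x :> g \<Longrightarrow> grad f x = g"
  unfolding gderiv_def by (intro grad_unique) (simp add: inner_commute)

text \<open>By uniqueness all local gradients agree with \<open>grad f\<close>, so they glue. On a
  compact set take finitely many half balls: two close points lie in one full ball, and for distant
  points a bound on the gradient suffices.\<close>

lemma locally_C1_holderI:
  fixes f :: "'a::euclidean_space \<Rightarrow> real"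
  assumes \<beta>: "\<beta> > 0"
    and loc: "\<And>x0. x0 \<in> U \<Longrightarrow> \<exists>\<rho>>0. \<exists>G C. (\<forall>x\<in>ball x0 \<rho>. GDERIV f x :> G x) \<and>
      (\<forall>x\<in>ball x0 \<rho>. \<forall>y\<in>ball x0 \<rho>. norm (G x - G y) \<le> C * dist x y powr \<beta>)"
  shows "locally_C1_holder \<beta> U f"
proof -
  have "\<forall>x0\<in>U. \<exists>\<rho> C. \<rho> > 0 \<and> (\<forall>x\<in>ball x0 \<rho>. GDERIV f x :> grad f x) \<and>
    (\<forall>x\<in>ball x0 \<rho>. \<forall>y\<in>ball x0 \<rho>. norm (grad f x - grad f y) \<le> C * dist x y powr \<beta>)"
  proof
    fix x0 assume "x0 \<in> U"
    then obtain \<rho> G C where H: "\<rho> > 0" "\<forall>x\<in>ball x0 \<rho>. GDERIV f x :> G x"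
      "\<forall>x\<in>ball x0 \<rho>. \<forall>y\<in>ball x0 \<rho>. norm (G x - G y) \<le> C * dist x y powr \<beta>"
      using loc by blast
    have "grad f x = G x" if "x \<in> ball x0 \<rho>" for x using H(2) that gderiv_grad_unique by blast
    then show "\<exists>\<rho> C. \<rho> > 0 \<and> (\<forall>x\<in>ball x0 \<rho>. GDERIV f x :> grad f x) \<and>
      (\<forall>x\<in>ball x0 \<rho>. \<forall>y\<in>ball x0 \<rho>. norm (grad f x - grad f y) \<le> C * dist x y powr \<beta>)"
      using H by (intro exI[of _ \<rho>] exI[of _ C]) auto
  qed
  from bchoice[OF this] obtain \<rho> where "\<forall>x0\<in>U. \<exists>C. \<rho> x0 > 0 \<and> (\<forall>x\<in>ball x0 (\<rho> x0). GDERIV f x :> grad f x) \<and>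
    (\<forall>x\<in>ball x0 (\<rho> x0). \<forall>y\<in>ball x0 (\<rho> x0). norm (grad f x - grad f y) \<le> C * dist x y powr \<beta>)" by blast
  from bchoice[OF this] obtain C where H: "\<And>x0. x0 \<in> U \<Longrightarrow> \<rho> x0 > 0"
    "\<And>x0 x. x0 \<in> U \<Longrightarrow> x \<in> ball x0 (\<rho> x0) \<Longrightarrow> GDERIV f x :> grad f x"
    "\<And>x0 x y. x0 \<in> U \<Longrightarrow> x \<in> ball x0 (\<rho> x0) \<Longrightarrow> y \<in> ball x0 (\<rho> x0) \<Longrightarrow> norm (grad f x - grad f y) \<le> C x0 * dist x y powr \<beta>"
    by blast
  have "\<exists>D. \<forall>x\<in>K. \<forall>y\<in>K. norm (grad f x - grad f y) \<le> D * dist x y powr \<beta>" if K: "compact K" "K \<subseteq> U" for K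
  proof -
    have "K \<subseteq> (\<Union>t\<in>K. ball t (\<rho> t / 2))" using H(1) K(2) by (force simp: subset_iff)
    then obtain T where T: "T \<subseteq> K" "finite T" "K \<subseteq> (\<Union>t\<in>T. ball t (\<rho> t / 2))"
      using compactE_image[OF K(1), of K "\<lambda>t. ball t (\<rho> t / 2)"] by blast
    have TU: "t \<in> U" if "t \<in> T" for t using that T(1) K(2) by blast
    \<comment> \<open>At most half of every chosen radius: a point within this distance of a half
      ball stays in the full ball. The inserted 1 keeps \<open>Min\<close> meaningful for an empty
      cover.\<close>
    define \<delta> where "\<delta> = Min (insert 1 ((\<lambda>t. \<rho> t / 2) ` T))"
    have \<delta>: "\<delta> > 0" "\<And>t. t \<in> T \<Longrightarrow> \<delta> \<le> \<rho> t / 2"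
      unfolding \<delta>_def using T(2) H(1) TU by (auto simp only: Min_gr_iff finite_insert finite_imageI intro!: Min_le) auto
    define E where "E = (\<Sum>t\<in>T. \<bar>C t\<bar>)"
    have CE: "C t \<le> E" if "t \<in> T" for t
    proof -
      have "\<bar>C t\<bar> \<le> E" unfolding E_def by (rule member_le_sum[OF that]) (use T(2) in auto)
      then show ?thesis by linarith
    qed
    define B where "B = (\<Sum>t\<in>T. norm (grad f t) + \<bar>C t\<bar> * \<rho> t powr \<beta>)"
    have near: "\<exists>t\<in>T. z \<in> ball t (\<rho> t / 2)" if "z \<in> K" for z using T(3) that by blast
    have inb: "z \<in> ball t (\<rho> t)" if "z \<in> ball t (\<rho> t / 2)" "t \<in> T" for z t
    proof -
      have "ball t (\<rho> t / 2) \<subseteq> ball t (\<rho> t)" using H(1)[OF TU[OF that(2)]] by (intro subset_ball) simp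
      then show ?thesis using that by blast
    qed
    have bound: "norm (grad f z) \<le> B" if z: "z \<in> K" for z
    proof -
      obtain t where t: "t \<in> T" "z \<in> ball t (\<rho> t / 2)" using near[OF z] by blast
      have "norm (grad f z - grad f t) \<le> C t * dist z t powr \<beta>"
        by (rule H(3)[OF TU[OF t(1)] inb[OF t(2,1)]]) (use H(1)[OF TU[OF t(1)]] in simp)
      also have "\<dots> \<le> \<bar>C t\<bar> * \<rho> t powr \<beta>"
        using inb[OF t(2,1)] \<beta> by (intro mult_mono powr_mono2) (auto simp: dist_commute)
      finally have "norm (grad f z) \<le> norm (grad f t) + \<bar>C t\<bar> * \<rho> t powr \<beta>"
        using norm_triangle_sub[of "grad f z" "grad f t"] by linarith
      also have "\<dots> \<le> B" unfolding B_def by (rule member_le_sum[OF t(1)]) (use T(2) in auto)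
      finally show ?thesis .
    qed
    \<comment> \<open>The first summand serves close pairs. The second serves pairs at distance at
      least \<open>\<delta>\<close>, where twice the gradient bound is compared with
      \<open>\<delta>\<close> to the power \<open>\<beta>\<close>.\<close>
    define D where "D = E + 2 * \<bar>B\<bar> / \<delta> powr \<beta>"
    have E0: "E \<ge> 0" unfolding E_def by (simp add: sum_nonneg)
    have "norm (grad f x - grad f y) \<le> D * dist x y powr \<beta>" if xy: "x \<in> K" "y \<in> K" for x y
    proof (cases "dist x y < \<delta>")
      case True
      obtain t where t: "t \<in> T" "x \<in> ball t (\<rho> t / 2)" using near[OF xy(1)] by blast
      have "dist t y < \<rho> t" using True \<delta>(2)[OF t(1)] t(2) dist_triangle[of t y x] by simp
      then have "norm (grad f x - grad f y) \<le> C t * dist x y powr \<beta>"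
        by (intro H(3)[OF TU[OF t(1)] inb[OF t(2,1)]]) simp
      also have "\<dots> \<le> D * dist x y powr \<beta>"
        using CE[OF t(1)] unfolding D_def by (intro mult_right_mono) (auto intro: add_increasing2)
      finally show ?thesis .
    next
      case False
      have "norm (grad f x - grad f y) \<le> norm (grad f x) + norm (grad f y)" by (rule norm_triangle_ineq4)
      also have "\<dots> \<le> 2 * \<bar>B\<bar>" using bound[OF xy(1)] bound[OF xy(2)] by linarith
      also have "\<dots> = 2 * \<bar>B\<bar> / \<delta> powr \<beta> * \<delta> powr \<beta>" using \<delta>(1) by simp
      also have "\<dots> \<le> D * dist x y powr \<beta>"
        unfolding D_def using False \<delta>(1) \<beta> E0 by (intro mult_mono powr_mono2) auto
      finally show ?thesis .
    qed
    then show ?thesis by blast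
  qed
  moreover have "GDERIV f x :> grad f x" if "x \<in> U" for x
    using H(2)[OF that, of x] H(1)[OF that] by simp
  ultimately show ?thesis unfolding locally_C1_holder_def by blast
qed

lemma almost_minimizer_compact:
  "almost_minimizer qp qm \<kappa> \<alpha> \<Omega> u \<Longrightarrow> compact_almost_minimizer qp qm \<kappa> \<alpha> \<Omega> u"
  unfolding almost_minimizer_def compact_almost_minimizer_def using ball_subset_cball by (meson order_trans)

text \<open>With the negative weight set to zero the two functionals coincide, so both kinds of
  minimizer share one regularity proof.\<close>

lemma almost_minimizer_plus_compact:
  "almost_minimizer_plus qp \<kappa> \<alpha> \<Omega> u \<Longrightarrow> compact_almost_minimizer qp (\<lambda>_. 0) \<kappa> \<alpha> \<Omega> u"
proof -
  have "J qp (\<lambda>_. 0) x r v Dv = J_plus qp x r v Dv" for x r v Dv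
    by (simp add: J_def J_plus_def)
  then show "almost_minimizer_plus qp \<kappa> \<alpha> \<Omega> u \<Longrightarrow> compact_almost_minimizer qp (\<lambda>_. 0) \<kappa> \<alpha> \<Omega> u"
    unfolding almost_minimizer_plus_def compact_almost_minimizer_def by (simp add: K_loc_plus_def)
qed

lemma compact_almost_minimizer_C1_holder:
  fixes u :: "'a::euclidean_space \<Rightarrow> real"
  assumes am: "compact_almost_minimizer qp qm \<kappa> \<alpha> \<Omega> u" and dim: "DIM('a) \<ge> 2"
    and q: "Linfty_on \<Omega> qp" "Linfty_on \<Omega> qm" and \<kappa>: "0 < \<kappa>" and \<alpha>: "0 < \<alpha>" "\<alpha> \<le> 1"
    and u: "continuous_on \<Omega> u"
    and U: "open U" "U \<subseteq> \<Omega>" "(\<forall>y\<in>U. 0 < u y) \<or> (\<forall>y\<in>U. u y < 0)"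
    and \<beta>: "0 < \<beta>" "\<beta> \<le> \<alpha> / 4"
  shows "locally_C1_holder \<beta> U u"
proof (rule locally_C1_holderI[OF \<beta>(1)])
  fix x0 assume x0: "x0 \<in> U"
  then obtain e where e: "e > 0" "ball x0 e \<subseteq> U" using U(1) open_contains_ball by blast
  obtain a b where ab: "x0 \<in> box a b" "cbox a b \<subseteq> U"
  proof -
    \<comment> \<open>Half the radius, so that the closed box, the closure of the open one, still
      lies in the phase.\<close>
    obtain a b where box: "x0 \<in> box a b" "box a b \<subseteq> ball x0 (e / 2)" using rational_boxes[of "e/2" x0] e(1) by auto
    have "box a b \<noteq> {}" using box(1) by blast
    then have "cbox a b = closure (box a b)" using closure_box by metis
    also have "\<dots> \<subseteq> closure (ball x0 (e / 2))" using box(2) by (rule closure_mono)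
    also have "\<dots> \<subseteq> ball x0 e" using e(1) by (auto simp: closure_ball)
    finally show ?thesis using that box(1) e(2) by blast
  qed
  have sub: "cbox a b \<subseteq> \<Omega>" "box a b \<subseteq> \<Omega>" using ab(2) U(2) box_subset_cbox[of a b] by blast+
  obtain Du where Du: "has_weak_gradient_on \<Omega> u Du" "\<And>x r. ball x r \<subseteq> \<Omega> \<Longrightarrow> L2_on (ball x r) Du"
    using am unfolding compact_almost_minimizer_def K_loc_def by blast
  have wg: "has_weak_gradient_on (box a b) u Du" by (rule has_weak_gradient_on_subset[OF Du(1) sub(2)])
  have L2: "L2_on (ball x r) Du" if "cball x r \<subseteq> box a b" for x r
    by (rule Du(2)) (use that sub(2) ball_subset_cball[of x r] in blast)
  have uc: "continuous_on (cbox a b) u" using continuous_on_subset[OF u sub(1)] .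
  have sgn: "(\<forall>y\<in>cbox a b. 0 < u y) \<or> (\<forall>y\<in>cbox a b. u y < 0)" using U(3) ab(2) by blast
  obtain M where M: "M \<ge> 0" and cmp: "\<forall>x r \<eta> w. 0 < r \<and> cball x r \<subseteq> box a b \<and> test_function_on (ball x r) \<eta> \<and> test_function_on (ball x r) w \<and>
     (\<forall>y\<in>ball x r. 0 < u y * ((1 - \<eta> y) * u y + w y)) \<longrightarrow>
     energy Du x r \<le> (1 + \<kappa> * r powr \<alpha>) * energy (\<lambda>y. (1 - \<eta> y) *\<^sub>R Du y - u y *\<^sub>R grad \<eta> y + grad w y) x r
        + \<kappa> * r powr \<alpha> * (M * r powr real DIM('a))"
    by (rule exE[OF dirichlet_comparison[OF am \<kappa> q sub(1) uc sgn wg]], rule L2, assumption, elim conjE, rule that)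
  interpret dirichlet_almost_minimizer a b u Du \<kappa> \<alpha> M
  proof
    show "0 < u x * u y" if "x \<in> cbox a b" "y \<in> cbox a b" for x y
      using sgn that by (auto simp: zero_less_mult_iff)
    show "energy Du x r \<le> (1 + \<kappa> * r powr \<alpha>) * energy (\<lambda>y. (1 - \<eta> y) *\<^sub>R Du y - u y *\<^sub>R grad \<eta> y + grad w y) x r
        + \<kappa> * r powr \<alpha> * (M * r powr real DIM('a))"
      if "0 < r" "cball x r \<subseteq> box a b" "test_function_on (ball x r) \<eta>" "test_function_on (ball x r) w"
       "\<And>y. y \<in> ball x r \<Longrightarrow> 0 < u y * ((1 - \<eta> y) * u y + w y)"
      for x r \<eta> w
      by (rule cmp[rule_format]) (intro conjI ballI that)
  qed (use dim uc wg L2 \<kappa> \<alpha> M in auto)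
  obtain \<rho> G C where H: "\<rho> > 0" "\<forall>x\<in>ball x0 \<rho>. GDERIV u x :> G x"
    "\<forall>x\<in>ball x0 \<rho>. \<forall>y\<in>ball x0 \<rho>. dist x y \<le> 1 \<and> norm (G x - G y) \<le> C * dist x y powr (\<alpha> / 4)"
    using interior_C1_Holder[OF ab(1)] by blast
  \<comment> \<open>For distances at most 1 a larger exponent gives a smaller power, so alpha/4 may
    be lowered to \<open>\<beta>\<close>; the absolute value covers a negative
    \<open>C\<close>.\<close>
  have "norm (G x - G y) \<le> \<bar>C\<bar> * dist x y powr \<beta>" if "x \<in> ball x0 \<rho>" "y \<in> ball x0 \<rho>" for x y
  proof -
    have d: "dist x y \<le> 1" "norm (G x - G y) \<le> C * dist x y powr (\<alpha> / 4)" using H(3) that by blast+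
    have "C * dist x y powr (\<alpha> / 4) \<le> \<bar>C\<bar> * dist x y powr \<beta>"
      using \<beta> d(1) by (intro mult_mono powr_mono') auto
    with d(2) show ?thesis by linarith
  qed
  then show "\<exists>\<rho>>0. \<exists>G C. (\<forall>x\<in>ball x0 \<rho>. GDERIV u x :> G x) \<and>
      (\<forall>x\<in>ball x0 \<rho>. \<forall>y\<in>ball x0 \<rho>. norm (G x - G y) \<le> C * dist x y powr \<beta>)"
    using H(1,2) by blast
qed

theorem theorem3p2:
  fixes \<Omega> :: "'a::euclidean_space set"
    and q_plus q_minus u :: "'a \<Rightarrow> real"
    and \<kappa> \<alpha> \<beta> :: real
  assumes "DIM('a) \<ge> 2"
    and "open \<Omega>"
    and "Linfty_on \<Omega> q_plus"
    and "Linfty_on \<Omega> q_minus"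
    and "0 < \<kappa>"
    and "0 < \<alpha>" and "\<alpha> \<le> 1"
    and "almost_minimizer q_plus q_minus \<kappa> \<alpha> \<Omega> u \<or> almost_minimizer_plus q_plus \<kappa> \<alpha> \<Omega> u"
    and "continuous_on \<Omega> u"
    and "\<beta> = \<alpha> / (real DIM('a) + 2 + \<alpha>)"
  shows "locally_C1_holder \<beta> {x \<in> \<Omega>. u x > 0} u \<and> locally_C1_holder \<beta> {x \<in> \<Omega>. u x < 0} u"
proof -
  have "Linfty_on \<Omega> (\<lambda>_. 0)"
    unfolding Linfty_on_def set_borel_measurable_def by auto
  \<comment> \<open>The given negative weight for \<open>J\<close>, and the zero function for
    \<open>J_plus\<close>.\<close>
  then obtain qm where qm: "Linfty_on \<Omega> qm" "compact_almost_minimizer q_plus qm \<kappa> \<alpha> \<Omega> u"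
    using assms(4,8) almost_minimizer_compact almost_minimizer_plus_compact by blast
  have \<beta>: "0 < \<beta>" "\<beta> \<le> \<alpha> / 4"
  proof -
    have "4 \<le> real DIM('a) + 2 + \<alpha>" using assms(1,6) by simp
    then have "\<alpha> / (real DIM('a) + 2 + \<alpha>) \<le> \<alpha> / 4" using assms(6) by (intro divide_left_mono) auto
    then show "\<beta> \<le> \<alpha> / 4" unfolding assms(10) .
    show "0 < \<beta>" unfolding assms(10) using assms(6) by (intro divide_pos_pos) auto
  qed
  have "open {x \<in> \<Omega>. u x > 0}" "open {x \<in> \<Omega>. u x < 0}"
    using continuous_open_preimage[OF assms(9,2), of "{0<..}"] continuous_open_preimage[OF assms(9,2), of "{..<0}"]
    by (simp_all add: vimage_def Int_def)
  then show ?thesis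
    using compact_almost_minimizer_C1_holder[OF qm(2) assms(1,3) qm(1) assms(5,6,7,9) _ _ _ \<beta>]
    by (intro conjI) auto
qed

end
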